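(* Let $A$ be a unital C*-algebra and $E:A\to B\subseteq A$ a conditional expectation onto a C*-subalgebra $B$ such that $K\cdot E-\mathrm{id}_A$ is positive for some $K\ge 1$. Then there exist a right Hilbert $B$-module $\mathcal{M}$, a $*$-homomorphism $\pi:A\to\mathrm{End}_B(\mathcal{M})$, and a partial isometry $V$ from the Hilbert $B$-module $\{A,E(\langle\cdot,\cdot\rangle_A)\}$ to $\mathcal{M}$ such that $E(a)=V^*\circ\pi(a)\circ V$ for every $a\in A$, and the linear hull of $\{\pi(a_1)(V(a_2)):a_1,a_2\in A\}$ is norm-dense in $\mathcal{M}$.
   Context: A conditional expectation is a norm-one projection onto a C*-subalgebra. $\{A,E(\langle\cdot,\cdot\rangle_A)\}$ denotes $A$ as a right Hilbert $B$-module with inner product $\langle a,b\rangle=E(a^*b)$. $\mathrm{End}_B(\mathcal{M})$ denotes the bounded $B$-linear operators on $\mathcal{M}$. In the identity $E(a)=V^*\pi(a)V$, $E(a)$ is regarded as the $B$-linear operator on $A$ of left multiplication by $E(a)$. *)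

theory Defs
  imports "HOL-Analysis.Analysis"
begin

text \<open>A unital complex C*-algebra is modelled on a real Banach algebra type 'a
  (class real_normed_algebra_1 + banach) together with an explicit complex scalar
  multiplication sc extending scaleR and an involution st.\<close>

definition unital_cstar_algebra ::
  "(complex \<Rightarrow> 'a::{real_normed_algebra_1,banach} \<Rightarrow> 'a) \<Rightarrow> ('a \<Rightarrow> 'a) \<Rightarrow> bool"
  where "unital_cstar_algebra sc st \<longleftrightarrow>
    (\<forall>(r::real) x. sc (complex_of_real r) x = r *\<^sub>R x) \<and>
    (\<forall>c x y. sc c (x + y) = sc c x + sc c y) \<and>
    (\<forall>c d x. sc (c + d) x = sc c x + sc d x) \<and>
    (\<forall>c d x. sc (c * d) x = sc c (sc d x)) \<and>
    (\<forall>c x y. sc c (x * y) = sc c x * y \<and> sc c (x * y) = x * sc c y) \<and>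
    (\<forall>c x. norm (sc c x) = cmod c * norm x) \<and>
    (\<forall>x. st (st x) = x) \<and>
    (\<forall>x y. st (x + y) = st x + st y) \<and>
    (\<forall>c x. st (sc c x) = sc (cnj c) (st x)) \<and>
    (\<forall>x y. st (x * y) = st y * st x) \<and>
    (\<forall>x. norm (st x * x) = norm x ^ 2)"

definition cstar_pos :: "('a::{real_normed_algebra_1,banach} \<Rightarrow> 'a) \<Rightarrow> 'a \<Rightarrow> bool"
  where "cstar_pos st a \<longleftrightarrow> (\<exists>x. a = st x * x)"

definition cstar_subalgebra ::
  "(complex \<Rightarrow> 'a \<Rightarrow> 'a) \<Rightarrow> ('a::{real_normed_algebra_1,banach} \<Rightarrow> 'a) \<Rightarrow> 'a set \<Rightarrow> bool"
  where "cstar_subalgebra sc st B \<longleftrightarrow>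
    0 \<in> B \<and> (\<forall>x\<in>B. \<forall>y\<in>B. x + y \<in> B \<and> x * y \<in> B) \<and>
    (\<forall>c. \<forall>x\<in>B. sc c x \<in> B) \<and> (\<forall>x\<in>B. st x \<in> B) \<and> closed B"

definition complex_linear_map ::
  "(complex \<Rightarrow> 'a \<Rightarrow> 'a) \<Rightarrow> ('a::{real_normed_algebra_1,banach} \<Rightarrow> 'a) \<Rightarrow> bool"
  where "complex_linear_map sc f \<longleftrightarrow>
    (\<forall>x y. f (x + y) = f x + f y) \<and> (\<forall>c x. f (sc c x) = sc c (f x))"

definition cond_expectation ::
  "(complex \<Rightarrow> 'a \<Rightarrow> 'a) \<Rightarrow> ('a::{real_normed_algebra_1,banach} \<Rightarrow> 'a) \<Rightarrow> 'a set \<Rightarrow> bool"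
  where "cond_expectation sc E B \<longleftrightarrow>
    complex_linear_map sc E \<and> (\<forall>x. E x \<in> B) \<and> (\<forall>b\<in>B. E b = b) \<and> onorm E = 1"

definition positive_map ::
  "('a \<Rightarrow> 'a) \<Rightarrow> ('a::{real_normed_algebra_1,banach} \<Rightarrow> 'a) \<Rightarrow> bool"
  where "positive_map st f \<longleftrightarrow> (\<forall>a. cstar_pos st a \<longrightarrow> cstar_pos st (f a))"

record ('m, 'a) hmod =
  hcarrier :: "'m set"
  hadd :: "'m \<Rightarrow> 'm \<Rightarrow> 'm"
  hzero :: "'m"
  hsc :: "complex \<Rightarrow> 'm \<Rightarrow> 'm"
  hract :: "'m \<Rightarrow> 'a \<Rightarrow> 'm"
  hinner :: "'m \<Rightarrow> 'm \<Rightarrow> 'a"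

definition hnorm :: "('m, 'a::real_normed_vector) hmod \<Rightarrow> 'm \<Rightarrow> real"
  where "hnorm M x = sqrt (norm (hinner M x x))"

definition hdiff :: "('m, 'a) hmod \<Rightarrow> 'm \<Rightarrow> 'm \<Rightarrow> 'm"
  where "hdiff M x y = hadd M x (hsc M (-1) y)"

definition hilbert_module ::
  "(complex \<Rightarrow> 'a \<Rightarrow> 'a) \<Rightarrow> ('a::{real_normed_algebra_1,banach} \<Rightarrow> 'a) \<Rightarrow> 'a set
    \<Rightarrow> ('m, 'a) hmod \<Rightarrow> bool"
  where "hilbert_module sc st B M \<longleftrightarrow> (let C = hcarrier M in
    \<comment> \<open>closure\<close>
    hzero M \<in> C \<and>
    (\<forall>x\<in>C. \<forall>y\<in>C. hadd M x y \<in> C) \<and>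
    (\<forall>c. \<forall>x\<in>C. hsc M c x \<in> C) \<and>
    (\<forall>x\<in>C. \<forall>b\<in>B. hract M x b \<in> C) \<and>
    \<comment> \<open>complex vector space\<close>
    (\<forall>x\<in>C. \<forall>y\<in>C. \<forall>z\<in>C. hadd M (hadd M x y) z = hadd M x (hadd M y z)) \<and>
    (\<forall>x\<in>C. \<forall>y\<in>C. hadd M x y = hadd M y x) \<and>
    (\<forall>x\<in>C. hadd M x (hzero M) = x) \<and>
    (\<forall>x\<in>C. hadd M x (hsc M (-1) x) = hzero M) \<and>
    (\<forall>c. \<forall>x\<in>C. \<forall>y\<in>C. hsc M c (hadd M x y) = hadd M (hsc M c x) (hsc M c y)) \<and>
    (\<forall>c d. \<forall>x\<in>C. hsc M (c + d) x = hadd M (hsc M c x) (hsc M d x)) \<and>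
    (\<forall>c d. \<forall>x\<in>C. hsc M (c * d) x = hsc M c (hsc M d x)) \<and>
    (\<forall>x\<in>C. hsc M 1 x = x) \<and>
    \<comment> \<open>right B-module\<close>
    (\<forall>x\<in>C. \<forall>y\<in>C. \<forall>b\<in>B. hract M (hadd M x y) b = hadd M (hract M x b) (hract M y b)) \<and>
    (\<forall>x\<in>C. \<forall>b\<in>B. \<forall>b'\<in>B. hract M x (b + b') = hadd M (hract M x b) (hract M x b')) \<and>
    (\<forall>x\<in>C. \<forall>b\<in>B. \<forall>b'\<in>B. hract M x (b * b') = hract M (hract M x b) b') \<and>
    (\<forall>c. \<forall>x\<in>C. \<forall>b\<in>B. hsc M c (hract M x b) = hract M (hsc M c x) b \<and>
                        hsc M c (hract M x b) = hract M x (sc c b)) \<and>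
    \<comment> \<open>B-valued inner product\<close>
    (\<forall>x\<in>C. \<forall>y\<in>C. hinner M x y \<in> B) \<and>
    (\<forall>x\<in>C. \<forall>y\<in>C. \<forall>z\<in>C. hinner M x (hadd M y z) = hinner M x y + hinner M x z) \<and>
    (\<forall>c. \<forall>x\<in>C. \<forall>y\<in>C. hinner M x (hsc M c y) = sc c (hinner M x y)) \<and>
    (\<forall>x\<in>C. \<forall>y\<in>C. \<forall>b\<in>B. hinner M x (hract M y b) = hinner M x y * b) \<and>
    (\<forall>x\<in>C. \<forall>y\<in>C. hinner M y x = st (hinner M x y)) \<and>
    (\<forall>x\<in>C. cstar_pos st (hinner M x x)) \<and>
    (\<forall>x\<in>C. hinner M x x = 0 \<longrightarrow> x = hzero M) \<and>
    \<comment> \<open>completeness w.r.t. the norm sqrt of the norm of the inner square\<close>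
    (\<forall>s::nat \<Rightarrow> 'm. (\<forall>n. s n \<in> C) \<and>
         (\<forall>e>0. \<exists>N::nat. \<forall>m\<ge>N. \<forall>n\<ge>N. hnorm M (hdiff M (s m) (s n)) < e) \<longrightarrow>
         (\<exists>l\<in>C. \<forall>e>0. \<exists>N::nat. \<forall>n\<ge>N. hnorm M (hdiff M (s n) l) < e)))"

definition hmod_end ::
  "(complex \<Rightarrow> 'a \<Rightarrow> 'a) \<Rightarrow> 'a set \<Rightarrow> ('m, 'a::{real_normed_algebra_1,banach}) hmod
    \<Rightarrow> ('m \<Rightarrow> 'm) \<Rightarrow> bool"
  where "hmod_end sc B M T \<longleftrightarrow> (let C = hcarrier M in
    (\<forall>x\<in>C. T x \<in> C) \<and>
    (\<forall>x\<in>C. \<forall>y\<in>C. T (hadd M x y) = hadd M (T x) (T y)) \<and>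
    (\<forall>c. \<forall>x\<in>C. T (hsc M c x) = hsc M c (T x)) \<and>
    (\<forall>x\<in>C. \<forall>b\<in>B. T (hract M x b) = hract M (T x) b) \<and>
    (\<exists>K. \<forall>x\<in>C. hnorm M (T x) \<le> K * hnorm M x))"

text \<open>*-homomorphism A -> End_B(M); the involution on End_B(M) is the module adjoint.\<close>
definition star_hom_end ::
  "(complex \<Rightarrow> 'a \<Rightarrow> 'a) \<Rightarrow> ('a::{real_normed_algebra_1,banach} \<Rightarrow> 'a) \<Rightarrow> 'a set
    \<Rightarrow> ('m, 'a) hmod \<Rightarrow> ('a \<Rightarrow> 'm \<Rightarrow> 'm) \<Rightarrow> bool"
  where "star_hom_end sc st B M \<pi> \<longleftrightarrow> (let C = hcarrier M in
    (\<forall>a. hmod_end sc B M (\<pi> a)) \<and>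
    (\<forall>a a'. \<forall>x\<in>C. \<pi> (a + a') x = hadd M (\<pi> a x) (\<pi> a' x)) \<and>
    (\<forall>c a. \<forall>x\<in>C. \<pi> (sc c a) x = hsc M c (\<pi> a x)) \<and>
    (\<forall>a a'. \<forall>x\<in>C. \<pi> (a * a') x = \<pi> a (\<pi> a' x)) \<and>
    (\<forall>a. \<forall>x\<in>C. \<forall>y\<in>C. hinner M (\<pi> a x) y = hinner M x (\<pi> (st a) y)))"

text \<open>Partial isometry V from the Hilbert B-module {A, E(<.,.>)} (inner product
  <x,y> = E(x* y), right action by multiplication) to M, with adjoint W = V*.\<close>
definition partial_isometry_from_A ::
  "('a::{real_normed_algebra_1,banach} \<Rightarrow> 'a) \<Rightarrow> ('a \<Rightarrow> 'a) \<Rightarrow> ('m, 'a) hmod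
    \<Rightarrow> ('a \<Rightarrow> 'm) \<Rightarrow> ('m \<Rightarrow> 'a) \<Rightarrow> bool"
  where "partial_isometry_from_A st E M V W \<longleftrightarrow>
    (\<forall>x. V x \<in> hcarrier M) \<and>
    \<comment> \<open>W is the adjoint of V\<close>
    (\<forall>x. \<forall>m\<in>hcarrier M. hinner M (V x) m = E (st x * W m)) \<and>
    \<comment> \<open>partial isometry: V V* V = V\<close>
    (\<forall>x. V (W (V x)) = V x)"

inductive_set hspan :: "('m, 'a) hmod \<Rightarrow> 'm set \<Rightarrow> 'm set" for M S where
  hspan_zero: "hzero M \<in> hspan M S"
| hspan_gen: "x \<in> S \<Longrightarrow> x \<in> hspan M S"
| hspan_add: "x \<in> hspan M S \<Longrightarrow> y \<in> hspan M S \<Longrightarrow> hadd M x y \<in> hspan M S"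
| hspan_sc: "x \<in> hspan M S \<Longrightarrow> hsc M c x \<in> hspan M S"

definition hdense :: "('m, 'a::real_normed_vector) hmod \<Rightarrow> 'm set \<Rightarrow> bool"
  where "hdense M S \<longleftrightarrow>
    (\<forall>m\<in>hcarrier M. \<forall>e>0. \<exists>n\<in>S. hnorm M (hdiff M m n) < e)"

end

theory Submission
  imports Defs
begin

text \<open>
  The module is the interior tensor square \<open>A \<otimes>\<^sub>B A\<close> with inner product
  \<open>\<langle>a \<otimes> x, c \<otimes> y\<rangle> = E(x\<^sup>* E(a\<^sup>*c) y)\<close>, on which \<open>A\<close> acts from the left; \<open>V x = 1 \<otimes> x\<close> and
  \<open>V\<^sup>*(a \<otimes> x) = E(a) x\<close>.  A tensor \<open>m\<close> is determined by the function \<open>a \<mapsto> V\<^sup>*(a m)\<close> from \<open>A\<close> to \<open>A\<close>,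
  which for \<open>m = c \<otimes> x\<close> is \<open>a \<mapsto> E(a c) x\<close>.  Since \<open>norm (x)\<^sup>2 \<le> K norm (E(x\<^sup>*x))\<close>, Cauchy sequences of
  tensors converge pointwise as functions, so that the completion again consists of functions,
  with \<open>a\<close> acting by \<open>m \<mapsto> m(\<cdot> a)\<close> and \<open>V\<^sup>* m = m(1)\<close>.

  Positivity of the form needs that \<open>E\<close> is a \<open>B\<close>-bimodule map (Tomiyama's theorem).  Instead of passing
  to the bidual, this is deduced from \<open>q E(f a) = 0\<close> for orthogonal positive \<open>f, q \<in> B\<close>, applied to the
  positive and negative parts of \<open>b - l\<close> for all real \<open>l\<close>.
\<close>


text \<open>Positivity of \<open>K E - id\<close> acts in three places: it makes \<open>E\<close>
  positive, it forces \<open>1\<close> into \<open>B\<close>, whose definition does not ask for a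
  unit, and it bounds evaluation at a point by the module norm, which keeps the completion inside a
  space of functions. Elements of the form \<open>st x * x\<close> are not visibly closed under
  sums. The order theory therefore starts from a norm condition, and square roots inside the closed
  real subalgebra generated by one element do the work of functional calculus. Tomiyama's own
  argument cuts with projections, and \<open>B\<close> may have only trivial ones; positive and
  negative parts of \<open>c = b - l\<close> stand in for spectral projections. The resulting
  identities involve \<open>absv c\<close>, which is controlled only up to a Lipschitz bound in l,
  while \<open>c * absv c\<close> has a derivative. Integrating in l then yields no more than the
  vanishing of a third-order commutator of \<open>E\<close> with \<open>b\<close>. To bring the
  order down to one, \<open>b\<close> is exchanged for a unitary: its powers stay bounded, whereas a
  nonzero commutator that itself commutes with the unitary would force linear growth.\<close>

section \<open>Square roots and Neumann series in Banach algebras\<close>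

text \<open>A fixed point \<open>z\<close> satisfies \<open>(1 - z) * (1 - z) = 1 - w\<close>. The
  scalar case \<open>w = 1\<close> dominates every increment of the iteration.\<close>

primrec sqrt_iter :: "'a::real_normed_algebra_1 \<Rightarrow> nat \<Rightarrow> 'a" where
  "sqrt_iter w 0 = 0"
| "sqrt_iter w (Suc n) = (1/2) *\<^sub>R (w + sqrt_iter w n * sqrt_iter w n)"

lemma sqrt_iter_one_bounds: "0 \<le> sqrt_iter (1::real) n \<and> sqrt_iter (1::real) n \<le> 1"
proof (induction n)
  case (Suc n)
  then have "sqrt_iter (1::real) n * sqrt_iter 1 n \<le> 1 * 1" by (intro mult_mono) auto
  with Suc show ?case by simp
qed simp

lemma norm_sqrt_iter_le:
  assumes "norm w \<le> 1"
  shows "norm (sqrt_iter w n) \<le> sqrt_iter (1::real) n"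
proof (induction n)
  case (Suc n)
  have "norm (w + sqrt_iter w n * sqrt_iter w n) \<le> 1 + sqrt_iter (1::real) n * sqrt_iter 1 n"
    by (intro norm_triangle_le add_mono assms order_trans[OF norm_mult_ineq] mult_mono Suc)
      (use sqrt_iter_one_bounds in auto)
  then show ?case by simp
qed simp

text \<open>The scalar increments telescope to at most 1, so this majorisation gives convergence up
  to and including \<open>norm w = 1\<close>, where a geometric rate cannot be expected.\<close>

lemma norm_sqrt_iter_diff_le:
  assumes "norm w \<le> 1"
  shows "norm (sqrt_iter w (Suc n) - sqrt_iter w n) \<le> sqrt_iter (1::real) (Suc n) - sqrt_iter 1 n"
proof (induction n)
  case 0
  then show ?case using assms by simp
next
  case (Suc n)
  define x y where "x = sqrt_iter w (Suc n)" and "y = sqrt_iter w n"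
  define \<xi> \<eta> where "\<xi> = sqrt_iter (1::real) (Suc n)" and "\<eta> = sqrt_iter (1::real) n"
  have d: "norm (x - y) \<le> \<xi> - \<eta>" using Suc unfolding x_def y_def \<xi>_def \<eta>_def .
  have nx: "norm x \<le> \<xi>" and ny: "norm y \<le> \<eta>"
    unfolding x_def y_def \<xi>_def \<eta>_def using norm_sqrt_iter_le[OF assms] by blast+
  have pos: "0 \<le> \<xi> - \<eta>" using d norm_ge_zero order_trans by blast
  have "x * x - y * y = x * (x - y) + (x - y) * y" by (simp add: algebra_simps)
  then have "norm (x * x - y * y) \<le> norm x * norm (x - y) + norm (x - y) * norm y"
    by (metis norm_triangle_le add_mono norm_mult_ineq)
  also have "\<dots> \<le> \<xi> * (\<xi> - \<eta>) + (\<xi> - \<eta>) * \<eta>"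
    by (intro add_mono mult_mono d nx ny pos norm_ge_zero order_trans[OF norm_ge_zero nx])
  also have "\<dots> = \<xi> * \<xi> - \<eta> * \<eta>" by (simp add: algebra_simps)
  finally have "norm (x * x - y * y) \<le> \<xi> * \<xi> - \<eta> * \<eta>" .
  moreover have "sqrt_iter w (Suc (Suc n)) - sqrt_iter w (Suc n) = (1/2) *\<^sub>R (x * x - y * y)"
    by (simp add: x_def y_def algebra_simps)
  moreover have "sqrt_iter (1::real) (Suc (Suc n)) - sqrt_iter 1 (Suc n) = (1/2) * (\<xi> * \<xi> - \<eta> * \<eta>)"
    by (simp add: \<xi>_def \<eta>_def algebra_simps)
  ultimately show ?case by (simp del: sqrt_iter.simps)
qed

text \<open>Scalars are real so that a self-adjoint element generates only self-adjoint elements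
  (\<open>alg_gen_sa\<close>); complex scalars would destroy this. Carrying such a set along also
  locates roots and inverses in \<open>B\<close>.\<close>

definition closed_subalg :: "'a::real_normed_algebra_1 set \<Rightarrow> bool" where
  "closed_subalg X \<longleftrightarrow> closed X \<and> 1 \<in> X \<and>
     (\<forall>x\<in>X. \<forall>y\<in>X. x + y \<in> X \<and> x * y \<in> X) \<and> (\<forall>r. \<forall>x\<in>X. r *\<^sub>R x \<in> X)"

lemma closed_subalgD:
  assumes "closed_subalg X"
  shows "closed X" "1 \<in> X" "x \<in> X \<Longrightarrow> y \<in> X \<Longrightarrow> x + y \<in> X" "x \<in> X \<Longrightarrow> y \<in> X \<Longrightarrow> x * y \<in> X"
    "x \<in> X \<Longrightarrow> r *\<^sub>R x \<in> X" "0 \<in> X" "x \<in> X \<Longrightarrow> - x \<in> X"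
    "x \<in> X \<Longrightarrow> y \<in> X \<Longrightarrow> x - y \<in> X" "of_real r \<in> X" "x \<in> X \<Longrightarrow> x ^ n \<in> X"
proof -
  note s = assms[unfolded closed_subalg_def]
  show 1: "closed X" "1 \<in> X" and 2: "\<And>x y. x \<in> X \<Longrightarrow> y \<in> X \<Longrightarrow> x + y \<in> X"
    and 3: "\<And>x y. x \<in> X \<Longrightarrow> y \<in> X \<Longrightarrow> x * y \<in> X" and 4: "\<And>x r. x \<in> X \<Longrightarrow> r *\<^sub>R x \<in> X"
    using s by blast+
  show "0 \<in> X" using 4[of 1 0] 1 by simp
  show 5: "\<And>x. x \<in> X \<Longrightarrow> - x \<in> X" using 4[of _ "-1"] by simp
  show "x \<in> X \<Longrightarrow> y \<in> X \<Longrightarrow> x - y \<in> X" using 2[of x "-y"] 5[of y] by simp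
  show "of_real r \<in> X" using 4[of 1 r] 1 by (simp add: of_real_def)
  show "x \<in> X \<Longrightarrow> x ^ n \<in> X" by (induction n) (use 1 3 in auto)
qed

lemma closed_subalg_Int: "(\<And>X. X \<in> \<X> \<Longrightarrow> closed_subalg X) \<Longrightarrow> closed_subalg (\<Inter>\<X>)"
  unfolding closed_subalg_def by (auto intro!: closed_Inter)

lemma closed_subalg_commutant: "closed_subalg {y. x * y = y * x}"
  unfolding closed_subalg_def
proof (intro conjI)
  show "closed {y. x * y = y * x}"
    by (intro closed_Collect_eq continuous_intros)
qed (auto simp: algebra_simps, metis mult.assoc)

lemma sqrt_one_minus_exists:
  fixes w :: "'a::{real_normed_algebra_1,banach}"
  assumes X: "closed_subalg X" and w: "w \<in> X" "norm w \<le> 1"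
  shows "\<exists>z\<in>X. norm z \<le> 1 \<and> (1 - z) * (1 - z) = 1 - w"
proof -
  let ?z = "sqrt_iter w" and ?\<zeta> = "sqrt_iter (1::real)"
  have mono: "?\<zeta> n \<le> ?\<zeta> (Suc n)" for n
    using norm_sqrt_iter_diff_le[of "1::real" n] norm_ge_zero order_trans
    by (metis diff_ge_0_iff_ge norm_one order_refl)
  have "summable (\<lambda>n. ?\<zeta> (Suc n) - ?\<zeta> n)"
  proof (rule summableI_nonneg_bounded[where x = 1])
    show "(\<Sum>i<n. ?\<zeta> (Suc i) - ?\<zeta> i) \<le> 1" for n
      using sqrt_iter_one_bounds[of n] by (simp only: sum_lessThan_telescope) simp
  qed (use mono in \<open>simp del: sqrt_iter.simps\<close>)
  then have "summable (\<lambda>n. ?z (Suc n) - ?z n)"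
    by (rule summable_comparison_test'[where N = 0]) (rule norm_sqrt_iter_diff_le[OF w(2)])
  then have "(\<lambda>n. \<Sum>i<n. ?z (Suc i) - ?z i) \<longlonglongrightarrow> (\<Sum>i. ?z (Suc i) - ?z i)"
    by (rule summable_LIMSEQ)
  then obtain z where z: "?z \<longlonglongrightarrow> z"
    unfolding sum_lessThan_telescope by (auto simp: minus_zero)
  have "?z n \<in> X" for n
    by (induction n) (use closed_subalgD[OF X] w in auto)
  then have zX: "z \<in> X"
    using closed_sequentially[OF closed_subalgD(1)[OF X]] z by blast
  have "norm (?z n) \<le> 1" for n
    using norm_sqrt_iter_le[OF w(2), of n] sqrt_iter_one_bounds[of n] by linarith
  then have nz: "norm z \<le> 1"
    using z by (intro LIMSEQ_le_const2[OF tendsto_norm[OF z]]) auto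
  have "(\<lambda>n. ?z (Suc n)) \<longlonglongrightarrow> z" using z by (rule LIMSEQ_Suc)
  moreover have "(\<lambda>n. ?z (Suc n)) \<longlonglongrightarrow> (1/2) *\<^sub>R (w + z * z)"
    unfolding sqrt_iter.simps by (intro tendsto_intros z)
  ultimately have "z = (1/2) *\<^sub>R (w + z * z)" by (rule LIMSEQ_unique)
  then have "2 *\<^sub>R z = w + z * z"
    by (metis scaleR_half_double scaleR_right_distrib scaleR_2)
  then have "(1 - z) * (1 - z) = 1 - w"
    by (simp add: algebra_simps scaleR_2)
  with zX nz show ?thesis by blast
qed

lemma neumann_inverse_exists:
  fixes x :: "'a::{real_normed_algebra_1,banach}"
  assumes X: "closed_subalg X" and x: "x \<in> X" "norm x < 1"
  shows "\<exists>g\<in>X. (1 - x) * g = 1 \<and> g * (1 - x) = 1"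
proof
  let ?g = "\<Sum>n. x ^ n"
  have s: "summable (\<lambda>n. x ^ n)" by (rule complete_algebra_summable_geometric[OF x(2)])
  have "(\<Sum>n<m. x ^ n) \<in> X" for m
    by (induction m) (auto intro!: closed_subalgD[OF X] x)
  then show "?g \<in> X"
    by (rule closed_sequentially[OF closed_subalgD(1)[OF X] _ summable_LIMSEQ[OF s]])
  have g: "?g = 1 + x * ?g"
    using suminf_split_head[OF s] suminf_mult[OF s, of x] by (simp add: algebra_simps)
  have g': "?g = 1 + ?g * x"
    using suminf_split_head[OF s] suminf_mult2[OF s, of x] by (simp add: power_commutes algebra_simps)
  show "(1 - x) * ?g = 1 \<and> ?g * (1 - x) = 1"
    using g g' by (simp add: algebra_simps)
qed

section \<open>Positive elements of a C*-algebra\<close>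

locale unital_cstar =
  fixes sc :: "complex \<Rightarrow> 'a::{real_normed_algebra_1,banach} \<Rightarrow> 'a" and st :: "'a \<Rightarrow> 'a"
  assumes cstar: "unital_cstar_algebra sc st"
begin

section \<open>Rules for the complex scalars and the involution\<close>

lemma sc_of_real: "sc (complex_of_real r) x = r *\<^sub>R x"
  and sc_add_right: "sc c (x + y) = sc c x + sc c y"
  and sc_add_left: "sc (c + d) x = sc c x + sc d x"
  and sc_sc: "sc c (sc d x) = sc (c * d) x"
  and mult_sc_left: "sc c x * y = sc c (x * y)"
  and mult_sc_right: "x * sc c y = sc c (x * y)"
  and norm_sc: "norm (sc c x) = cmod c * norm x"
  and st_st [simp]: "st (st x) = x"
  and st_add: "st (x + y) = st x + st y"
  and st_sc: "st (sc c x) = sc (cnj c) (st x)"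
  and st_mult: "st (x * y) = st y * st x"
  and norm_st_mult: "norm (st x * x) = (norm x)\<^sup>2"
  using cstar unfolding unital_cstar_algebra_def by metis+

lemma sc_1 [simp]: "sc 1 x = x" using sc_of_real[of 1] by simp
lemma sc_minus1 [simp]: "sc (- 1) x = - x" using sc_of_real[of "-1"] by simp
lemma sc_0_right [simp]: "sc c 0 = 0" using norm_sc[of c 0] by simp
lemma sc_minus_right: "sc c (- x) = - sc c x"
  by (metis mult.commute sc_minus1 sc_sc)
lemma sc_minus_left: "sc (- c) x = - sc c x"
  by (metis mult_minus1 sc_minus1 sc_sc)
lemma sc_diff_right: "sc c (x - y) = sc c x - sc c y"
  by (metis diff_conv_add_uminus sc_add_right sc_minus_right)
lemma sc_scaleR: "sc c (r *\<^sub>R x) = r *\<^sub>R sc c x"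
  by (metis mult.commute sc_of_real sc_sc)
lemma sc_i_i [simp]: "sc \<i> (sc \<i> x) = - x" by (simp add: sc_sc)

lemma st_scaleR: "st (r *\<^sub>R x) = r *\<^sub>R st x"
  using st_sc[of "complex_of_real r" x] by (simp add: sc_of_real)
lemma st_minus: "st (- x) = - st x" using st_scaleR[of "-1" x] by simp
lemma st_diff: "st (x - y) = st x - st y"
  by (metis diff_conv_add_uminus st_add st_minus)
lemma st_0 [simp]: "st 0 = 0" using st_scaleR[of 0 0] by simp
lemma st_1 [simp]: "st 1 = 1" by (metis mult.right_neutral st_mult st_st)
lemma st_of_real [simp]: "st (of_real r) = of_real r" by (simp add: of_real_def st_scaleR)
lemma st_sum: "st (sum f I) = (\<Sum>i\<in>I. st (f i))"
  by (induction I rule: infinite_finite_induct) (auto simp: st_add)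

lemma norm_st [simp]: "norm (st x) = norm x"
proof -
  have "norm x \<le> norm (st x)" for x
  proof (cases "x = 0")
    case False
    have "norm x * norm x \<le> norm (st x) * norm x"
      using norm_st_mult[of x] norm_mult_ineq[of "st x" x] by (simp add: power2_eq_square)
    with False show ?thesis by simp
  qed simp
  from this[of x] this[of "st x"] show ?thesis by simp
qed

lemma norm_mult_st: "norm (x * st x) = (norm x)\<^sup>2"
  using norm_st_mult[of "st x"] by simp

lemma bounded_linear_st: "bounded_linear st"
  by (rule bounded_linear_intro[where K = 1]) (auto simp: st_add st_scaleR)

lemma bounded_linear_sc: "bounded_linear (sc c)"
  by (rule bounded_linear_intro[where K = "cmod c"]) (auto simp: sc_add_right sc_scaleR norm_sc)

lemmas tendsto_st = bounded_linear.tendsto[OF bounded_linear_st]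
lemmas tendsto_sc = bounded_linear.tendsto[OF bounded_linear_sc]

lemma st_mult_self_eq_0: "st x * x = 0 \<longleftrightarrow> x = 0"
  using norm_st_mult[of x] by auto

lemma norm_sa_square: "st x = x \<Longrightarrow> norm (x * x) = (norm x)\<^sup>2"
  using norm_st_mult[of x] by simp

lemma cartesian_decomposition:
  obtains h k where "st h = h" "st k = k" "x = h + sc \<i> k"
proof
  let ?h = "(1/2) *\<^sub>R (x + st x)" and ?k = "sc (- \<i>) ((1/2) *\<^sub>R (x - st x))"
  show "st ?h = ?h" by (simp add: st_scaleR st_add add.commute)
  show "st ?k = ?k" by (simp add: st_scaleR st_diff st_sc sc_minus_left flip: sc_minus_right scaleR_minus_right)
  have "sc \<i> ?k = (1/2) *\<^sub>R (x - st x)" by (simp add: sc_sc)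
  then show "x = ?h + sc \<i> ?k"
    by (simp add: scaleR_add_right[symmetric])
qed

text \<open>For self-adjoint \<open>a\<close> the norm condition places the spectrum between 0 and
  \<open>2 * r\<close>. It opens sums and limits to the triangle inequality; agreement with
  \<open>cstar_pos\<close> is \<open>cstar_pos_iff_pos\<close>.\<close>

definition pos :: "'a \<Rightarrow> bool" where
  "pos a \<longleftrightarrow> st a = a \<and> (\<exists>r. norm (of_real r - a) \<le> r)"

lemma pos_sa: "pos a \<Longrightarrow> st a = a" by (simp add: pos_def)

lemma pos_add: "pos a \<Longrightarrow> pos b \<Longrightarrow> pos (a + b)"
  unfolding pos_def st_add
proof safe
  fix r s assume "norm (of_real r - a) \<le> r" "norm (of_real s - b) \<le> s"
  then have "norm ((of_real r - a) + (of_real s - b)) \<le> r + s"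
    by (intro norm_triangle_le) auto
  then show "\<exists>r. norm (of_real r - (a + b)) \<le> r"
    by (intro exI[of _ "r + s"]) (simp add: algebra_simps)
qed simp

lemma pos_scaleR: "pos a \<Longrightarrow> c \<ge> 0 \<Longrightarrow> pos (c *\<^sub>R a)"
  unfolding pos_def st_scaleR
proof safe
  fix r assume "norm (of_real r - a) \<le> r" "c \<ge> 0"
  then have "norm (c *\<^sub>R (of_real r - a)) \<le> c * r"
    by (simp add: mult_left_mono)
  then show "\<exists>r. norm (of_real r - c *\<^sub>R a) \<le> r"
    by (intro exI[of _ "c * r"]) (simp add: algebra_simps scaleR_conv_of_real)
qed simp

lemma pos_of_real [simp]: "r \<ge> 0 \<Longrightarrow> pos (of_real r)"
  unfolding pos_def by (auto intro!: exI[of _ r])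

lemma pos_0 [simp]: "pos 0" and pos_1 [simp]: "pos 1"
  using pos_of_real[of 0] pos_of_real[of 1] by simp_all

lemma pos_of_real_diff: "st a = a \<Longrightarrow> norm a \<le> r \<Longrightarrow> pos (of_real r - a)"
  unfolding pos_def st_diff by (auto intro!: exI[of _ r])

lemma pos_of_real_add: "st a = a \<Longrightarrow> norm a \<le> r \<Longrightarrow> pos (of_real r + a)"
  using pos_of_real_diff[of "-a" r] by (simp add: st_minus)

text \<open>The square root \<open>1 - z\<close> has \<open>norm z \<le> 1\<close> and is therefore positive itself.\<close>

lemma pos_sqrt_aux:
  assumes "pos a" "closed_subalg X" "a \<in> X"
  shows "\<exists>y\<in>X. (\<exists>r. norm (of_real r - y) \<le> r) \<and> y * y = a"
proof -
  obtain r where r: "norm (of_real r - a) \<le> r" using assms by (auto simp: pos_def)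
  have r0: "r \<ge> 0" using r norm_ge_zero order_trans by blast
  show ?thesis
  proof (cases "r = 0")
    case True
    then have "a = 0" using r by simp
    then show ?thesis using assms by (intro bexI[of _ 0]) (auto intro!: exI[of _ 0])
  next
    case False
    with r0 have rp: "r > 0" by simp
    define w where "w = 1 - (1/r) *\<^sub>R a"
    have "w = (1/r) *\<^sub>R (of_real r - a)" using rp by (simp add: w_def of_real_def algebra_simps)
    then have "norm w \<le> 1" using r rp by simp
    moreover have "w \<in> X" using assms unfolding w_def by (intro closed_subalgD) auto
    ultimately obtain z where z: "z \<in> X" "norm z \<le> 1" "(1 - z) * (1 - z) = 1 - w"
      using sqrt_one_minus_exists[OF assms(2)] by blast
    define y where "y = sqrt r *\<^sub>R (1 - z)"
    have "y \<in> X" using z assms unfolding y_def by (intro closed_subalgD) auto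
    moreover have "y * y = a"
      using rp by (simp add: y_def z(3)) (simp add: w_def)
    moreover have "of_real (sqrt r) - y = sqrt r *\<^sub>R z"
      by (simp add: y_def of_real_def algebra_simps)
    then have "norm (of_real (sqrt r) - y) \<le> sqrt r" using z(2) rp
      by (simp add: mult_left_le)
    ultimately show ?thesis by blast
  qed
qed

section \<open>Generated subalgebras, square roots and norm estimates from the order\<close>

definition alg_gen :: "'a \<Rightarrow> 'a set" where
  "alg_gen a = \<Inter>{X. closed_subalg X \<and> a \<in> X}"

lemma closed_subalg_alg_gen: "closed_subalg (alg_gen a)"
  unfolding alg_gen_def by (rule closed_subalg_Int) auto

lemma alg_gen_self: "a \<in> alg_gen a" by (auto simp: alg_gen_def)

lemma alg_gen_subset: "closed_subalg X \<Longrightarrow> a \<in> X \<Longrightarrow> alg_gen a \<subseteq> X"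
  by (auto simp: alg_gen_def)

lemma alg_gen_commute_gen: "y \<in> alg_gen a \<Longrightarrow> x * a = a * x \<Longrightarrow> x * y = y * x"
  using alg_gen_subset[OF closed_subalg_commutant, of a x] by auto

lemma alg_gen_commute: "x \<in> alg_gen a \<Longrightarrow> y \<in> alg_gen a \<Longrightarrow> x * y = y * x"
  using alg_gen_commute_gen[of x a a] alg_gen_commute_gen[of y a x] by metis

lemma alg_gen_sa:
  assumes "st a = a" "y \<in> alg_gen a"
  shows "st y = y"
proof -
  let ?X = "{y \<in> alg_gen a. st y = y}"
  have eq: "?X = alg_gen a \<inter> {y. st y = y}" by auto
  note s = closed_subalgD[OF closed_subalg_alg_gen[of a]]
  have "closed ?X" unfolding eq
    by (intro closed_Int s closed_Collect_eq continuous_intros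
        linear_continuous_on bounded_linear_st)
  then have "closed_subalg ?X"
    unfolding closed_subalg_def using s
    by (auto simp: st_add st_mult st_scaleR intro: alg_gen_commute)
  then have "alg_gen a \<subseteq> ?X" using assms by (intro alg_gen_subset) (auto simp: alg_gen_self)
  with assms show ?thesis by auto
qed

lemma pos_sqrt:
  assumes "pos a"
  obtains y where "y \<in> alg_gen a" "pos y" "y * y = a"
  using pos_sqrt_aux[OF assms closed_subalg_alg_gen alg_gen_self] alg_gen_sa[OF pos_sa[OF assms]]
  unfolding pos_def by metis

lemma mult_st_pair:
  assumes "st y = y" "st v = v" "y * v = v * y"
  shows "st (y + sc \<i> v) * (y + sc \<i> v) = y * y + v * v"
  using assms by (simp add: st_add st_sc algebra_simps mult_sc_left mult_sc_right sc_minus_left sc_diff_right)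

text \<open>\<open>y\<close> is the real part of y + iv, and commutation cancels the cross terms, so
  that this element has norm exactly \<open>sqrt r\<close>.\<close>

lemma norm_le_of_sum_squares:
  assumes "st y = y" "st v = v" "y * v = v * y" "y * y + v * v = of_real r" "r \<ge> 0"
  shows "norm y \<le> sqrt r"
proof -
  let ?z = "y + sc \<i> v"
  have "(norm ?z)\<^sup>2 = r"
    using norm_st_mult[of ?z] mult_st_pair[OF assms(1-3)] assms(4,5) by simp
  then have nz: "norm ?z = sqrt r" by (metis abs_norm_cancel real_sqrt_abs)
  have "?z + st ?z = 2 *\<^sub>R y" using assms
    by (simp add: st_add st_sc sc_minus_left scaleR_2)
  then have "2 * norm y \<le> norm ?z + norm (st ?z)" by (metis norm_triangle_ineq norm_scaleR abs_numeral)
  then show ?thesis using nz by simp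
qed

text \<open>With square roots \<open>y\<close>, \<open>v\<close> of \<open>a\<close>, \<open>r - a\<close>, the element \<open>y + iv\<close> is \<open>\<surd>r\<close> times a unitary.\<close>

lemma norm_le_of_pos_diff:
  assumes "pos a" "pos (of_real r - a)" "r \<ge> 0"
  shows "norm a \<le> r"
proof -
  obtain y where y: "y \<in> alg_gen a" "pos y" "y * y = a" using pos_sqrt[OF assms(1)] .
  obtain v where v: "v \<in> alg_gen (of_real r - a)" "pos v" "v * v = of_real r - a"
    using pos_sqrt[OF assms(2)] .
  have "y * a = a * y" by (simp flip: y(3) add: mult.assoc)
  then have "y * (of_real r - a) = (of_real r - a) * y"
    by (simp add: algebra_simps of_real_def)
  then have yv: "y * v = v * y" by (rule alg_gen_commute_gen[OF v(1)])
  have "norm y \<le> sqrt r"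
    by (rule norm_le_of_sum_squares[OF _ _ yv _ assms(3)]) (use y v pos_sa in auto)
  then have "(norm y)\<^sup>2 \<le> r" using assms(3) by (simp add: sqrt_le_D real_le_rsqrt sqrt_ge_absD)
  then show ?thesis using norm_sa_square[OF pos_sa[OF y(2)]] y(3) by simp
qed

lemma pos_antisym: "pos a \<Longrightarrow> pos (- a) \<Longrightarrow> a = 0"
  using norm_le_of_pos_diff[of a 0] by simp

text \<open>For \<open>norm y \<le> 1\<close> the element \<open>y + i\<surd>(1 - y\<^sup>2)\<close> is unitary, so \<open>norm (\<surd>(1 - y\<^sup>2)) \<le> 1\<close>.\<close>

lemma norm_of_real_diff_square:
  assumes "st y = y" "norm y \<le> s"
  shows "norm (of_real (s\<^sup>2) - y * y) \<le> s\<^sup>2"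
proof -
  have "norm (1 - x * x) \<le> 1" if x: "st x = x" "norm x \<le> 1" for x
  proof -
    have xx: "x * x \<in> alg_gen x" by (intro closed_subalgD[OF closed_subalg_alg_gen] alg_gen_self)
    have "norm (x * x) \<le> 1"
      using x(2) by (simp add: norm_sa_square[OF x(1)] power_le_one)
    then obtain z where z: "z \<in> alg_gen x" "(1 - z) * (1 - z) = 1 - x * x"
      using sqrt_one_minus_exists[OF closed_subalg_alg_gen xx] by blast
    have zs: "1 - z \<in> alg_gen x" using z by (intro closed_subalgD[OF closed_subalg_alg_gen])
    then have sa: "st (1 - z) = 1 - z" using alg_gen_sa x by blast
    have "norm (1 - z) \<le> sqrt 1"
      by (rule norm_le_of_sum_squares[OF sa x(1) alg_gen_commute[OF zs alg_gen_self]]) (auto simp: z)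
    then show ?thesis using norm_sa_square[OF sa] z(2) by (simp add: power_le_one)
  qed
  note * = this
  show ?thesis
  proof (cases "s = 0")
    case False
    then have s: "s > 0" using assms norm_ge_zero[of y] by linarith
    have "norm (1 - ((1/s) *\<^sub>R y) * ((1/s) *\<^sub>R y)) \<le> 1"
      using assms s by (intro *) (auto simp: st_scaleR)
    moreover have "of_real (s\<^sup>2) - y * y = s\<^sup>2 *\<^sub>R (1 - ((1/s) *\<^sub>R y) * ((1/s) *\<^sub>R y))"
      using s by (simp add: algebra_simps of_real_def power2_eq_square)
    ultimately show ?thesis by (simp add: mult_left_le)
  qed (use assms in auto)
qed

lemma pos_square: "st y = y \<Longrightarrow> pos (y * y)"
  unfolding pos_def using norm_of_real_diff_square[of y "norm y"]
  by (metis order_refl st_mult)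

text \<open>Any bound for the norm can serve as the witness in \<open>pos\<close>. This gives
  \<open>pos_limit\<close> one witness for a whole convergent sequence.\<close>

lemma norm_of_real_diff_pos:
  assumes "pos a" "norm a \<le> r"
  shows "norm (of_real r - a) \<le> r"
proof -
  obtain y where y: "pos y" "y * y = a" using pos_sqrt[OF assms(1)] by metis
  have "(norm y)\<^sup>2 \<le> r" using assms y norm_sa_square[OF pos_sa[OF y(1)]] by simp
  then have "norm y \<le> sqrt r" by (rule real_le_rsqrt)
  moreover have "r \<ge> 0" using assms norm_ge_zero order_trans by blast
  ultimately show ?thesis
    using norm_of_real_diff_square[OF pos_sa[OF y(1)], of "sqrt r"] y by simp
qed

lemma pos_limit:
  assumes "\<And>n. pos (X n)" "X \<longlonglongrightarrow> a"
  shows "pos a"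
proof -
  obtain r where r: "\<And>n. norm (X n) \<le> r"
    using convergent_imp_Bseq[OF convergentI[OF assms(2)]] by (auto simp: Bseq_def)
  have "(\<lambda>n. norm (of_real r - X n)) \<longlonglongrightarrow> norm (of_real r - a)"
    by (intro tendsto_intros assms)
  then have "norm (of_real r - a) \<le> r"
    by (rule LIMSEQ_le_const2) (use norm_of_real_diff_pos[OF assms(1) r] in auto)
  moreover have "st a = a"
    using LIMSEQ_unique[OF tendsto_st[OF assms(2)]] assms pos_sa by simp
  ultimately show ?thesis by (auto simp: pos_def)
qed

lemma pos_of_add_eps:
  assumes "\<And>e. e > 0 \<Longrightarrow> pos (a + e *\<^sub>R b)"
  shows "pos a"
proof (rule pos_limit)
  show "pos (a + (1 / real (Suc n)) *\<^sub>R b)" for n by (intro assms) simp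
  have "(\<lambda>n. a + (1 / real (Suc n)) *\<^sub>R b) \<longlonglongrightarrow> a + 0 *\<^sub>R b"
    by (intro tendsto_intros LIMSEQ_inverse_real_of_nat[unfolded inverse_eq_divide])
  then show "(\<lambda>n. a + (1 / real (Suc n)) *\<^sub>R b) \<longlonglongrightarrow> a" by simp
qed

text \<open>Square roots taken in the generated algebras inherit the commutation, so the product is
  the square of the self-adjoint \<open>y * v\<close>.\<close>

lemma pos_mult:
  assumes "pos a" "pos b" "a * b = b * a"
  shows "pos (a * b)"
proof -
  obtain y where y: "y \<in> alg_gen a" "pos y" "y * y = a" using pos_sqrt[OF assms(1)] .
  obtain v where v: "v \<in> alg_gen b" "pos v" "v * v = b" using pos_sqrt[OF assms(2)] .
  have "b * y = y * b" using alg_gen_commute_gen[OF y(1)] assms(3) by simp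
  then have yv: "y * v = v * y" using alg_gen_commute_gen[OF v(1)] by simp
  have "pos ((y * v) * (y * v))"
    using y v yv by (intro pos_square) (simp add: st_mult pos_sa)
  also have "(y * v) * (y * v) = a * b"
    using yv y(3) v(3) by (metis mult.assoc)
  finally show ?thesis .
qed

lemma norm_mono_pos:
  assumes "pos a" "pos (b - a)"
  shows "norm a \<le> norm b"
proof -
  have "pos b" using pos_add[OF assms] by simp
  then have "pos ((of_real (norm b) - b) + (b - a))"
    by (intro pos_add pos_of_real_diff assms) (auto simp: pos_sa)
  then show ?thesis using norm_le_of_pos_diff[OF assms(1), of "norm b"] by simp
qed

lemma norm_le_of_pos_both:
  assumes "st a = a" "pos (of_real r - a)" "pos (of_real r + a)" "r \<ge> 0"
  shows "norm a \<le> r"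
proof -
  have "(of_real r - a) * (of_real r + a) = (of_real r + a) * (of_real r - a)"
    by (simp add: algebra_simps of_real_def)
  then have "pos ((of_real r - a) * (of_real r + a))" using assms by (intro pos_mult)
  also have "(of_real r - a) * (of_real r + a) = of_real (r\<^sup>2) - a * a"
    by (simp add: algebra_simps of_real_def power2_eq_square)
  finally have "norm (a * a) \<le> r\<^sup>2"
    using assms by (intro norm_le_of_pos_diff pos_square) auto
  then show ?thesis using norm_sa_square[OF assms(1)] assms(4) by (simp add: power2_le_iff_abs_le)
qed

text \<open>Divided by t + r, the element is 1 minus something of norm at most r / (t + r) < 1, so a
  Neumann series inverts it. \<open>X\<close> records where the inverse lies; the Schur elimination
  uses it with \<open>B\<close>.\<close>

lemma pos_add_of_real_invertible:
  assumes "pos p" "t > 0" "closed_subalg X" "p \<in> X"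
  shows "\<exists>g\<in>X. (of_real t + p) * g = 1 \<and> g * (of_real t + p) = 1"
proof -
  obtain r where r: "norm (of_real r - p) \<le> r" using assms by (auto simp: pos_def)
  have r0: "r \<ge> 0" using r norm_ge_zero order_trans by blast
  define x where "x = (1/(t+r)) *\<^sub>R (of_real r - p)"
  have "norm x \<le> r / (t + r)" using r r0 assms(2) by (simp add: x_def divide_right_mono)
  also have "\<dots> < 1" using r0 assms(2) by simp
  finally have "norm x < 1" .
  moreover have "x \<in> X" unfolding x_def using assms by (intro closed_subalgD) auto
  ultimately obtain g where g: "g \<in> X" "(1 - x) * g = 1" "g * (1 - x) = 1"
    using neumann_inverse_exists[OF assms(3)] by blast
  have eq: "of_real t + p = (t + r) *\<^sub>R (1 - x)"
    using r0 assms(2) by (simp add: x_def scaleR_diff_right) (simp add: of_real_def algebra_simps)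
  show ?thesis
  proof
    show "(1/(t+r)) *\<^sub>R g \<in> X" using g assms by (intro closed_subalgD) auto
    show "(of_real t + p) * ((1/(t+r)) *\<^sub>R g) = 1 \<and> ((1/(t+r)) *\<^sub>R g) * (of_real t + p) = 1"
      unfolding eq using g r0 assms(2) by simp
  qed
qed

lemma inverse_commute:
  assumes "a * g = 1" "g * a = 1" "x * a = a * x"
  shows "x * g = g * (x::'a)"
  by (metis assms mult.assoc mult.left_neutral mult.right_neutral)

lemma pos_inverse:
  assumes "pos a" "a * g = 1" "g * a = 1"
  shows "pos g"
proof -
  obtain y where y: "y \<in> alg_gen a" "pos y" "y * y = a" using pos_sqrt[OF assms(1)] .
  have gs: "st g = g"
    using assms by (metis mult.assoc mult.left_neutral mult.right_neutral pos_sa st_1 st_mult)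
  have yg: "y * g = g * y"
    by (rule inverse_commute[OF assms(2,3)]) (simp flip: y(3) add: mult.assoc)
  have "pos ((y * g) * (y * g))"
    using y yg gs by (intro pos_square) (simp add: st_mult pos_sa)
  also have "(y * g) * (y * g) = g" using yg y(3) assms by (metis mult.assoc mult.right_neutral)
  finally show ?thesis .
qed

text \<open>\<open>m\<close> plays the role of the absolute value of \<open>c\<close>. After
  perturbing \<open>m\<close> to the invertible p = e + m, the quotient s = c / p satisfies 1 -
  s\<cdot>s = (p\<cdot>p - c\<cdot>c) / (p\<cdot>p) \<ge> 0, so s is a contraction and p - c = p (1
  - s) is a product of commuting positive elements.\<close>

lemma pos_abs_diff:
  assumes c: "st c = c" and m: "pos m" "m * c = c * m" "m * m = c * c"
  shows "pos (m - c)"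
proof (rule pos_of_add_eps[where b = 1])
  fix e :: real assume e: "e > 0"
  let ?p = "of_real e + m"
  obtain g where g: "?p * g = 1" "g * ?p = 1"
    using pos_add_of_real_invertible[OF m(1) e closed_subalg_alg_gen alg_gen_self] by blast
  have pp: "pos ?p" using m e by (intro pos_add) auto
  have gp: "pos g" by (rule pos_inverse[OF pp g])
  have cp: "c * ?p = ?p * c" using m by (simp add: algebra_simps of_real_def)
  have cg: "c * g = g * c" by (rule inverse_commute[OF g cp])
  have mg: "m * g = g * m" by (rule inverse_commute[OF g]) (simp add: algebra_simps of_real_def)
  define s where "s = c * g"
  have ss: "st s = s" using c gp cg by (simp add: s_def st_mult pos_sa)
  \<comment> \<open>This is p\<cdot>p - c\<cdot>c, expanded by means of \<open>m * m = c * c\<close>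
    so that its positivity is visible.\<close>
  define k where "k = of_real e * of_real e + (2 * e) *\<^sub>R m"
  have k: "k = ?p * ?p - c * c"
    by (simp add: k_def algebra_simps m(3) of_real_def flip: scaleR_add_left)
  have kg: "k * g = g * k" using mg by (simp add: k_def algebra_simps of_real_def)
  have "pos k" unfolding k_def using e m by (intro pos_add pos_scaleR pos_square) auto
  moreover have "k * (g * g) = (g * g) * k" using kg by (metis mult.assoc)
  ultimately have "pos (k * (g * g))" using pos_mult pos_square[OF pos_sa[OF gp]] by blast
  also have "k * (g * g) = 1 - s * s"
  proof -
    have "(?p * ?p) * (g * g) = 1" using g by (metis mult.assoc mult.left_neutral)
    moreover have "(c * c) * (g * g) = s * s" unfolding s_def using cg by (metis mult.assoc)
    ultimately show ?thesis unfolding k by (simp add: left_diff_distrib)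
  qed
  finally have "norm (s * s) \<le> 1"
    using norm_le_of_pos_diff[OF pos_square[OF ss], of 1] by simp
  then have "norm s \<le> 1" using norm_sa_square[OF ss] by (simp add: abs_square_le_1)
  then have "pos (1 - s)" using pos_of_real_diff[OF ss, of 1] by simp
  moreover have "?p * s = c" using cg g unfolding s_def by (metis mult.assoc mult.left_neutral)
  moreover have "s * ?p = c" using g unfolding s_def by (metis mult.assoc mult.right_neutral)
  ultimately have "pos (?p * (1 - s))" using pp by (intro pos_mult) (auto simp: algebra_simps)
  also have "?p * (1 - s) = m - c + e *\<^sub>R 1"
    using \<open>?p * s = c\<close> by (simp add: right_diff_distrib of_real_def)
  finally show "pos (m - c + e *\<^sub>R 1)" .
qed

text \<open>Choosing the root inside \<open>alg_gen c\<close> makes it commute with whatever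
  commutes with \<open>c\<close>, and keeps the parts of a self-adjoint element of \<open>B\<close>
  in \<open>B\<close>.\<close>

definition absv :: "'a \<Rightarrow> 'a" where
  "absv c = (SOME m. m \<in> alg_gen c \<and> pos m \<and> m * m = c * c)"

definition pos_part :: "'a \<Rightarrow> 'a" where "pos_part c = (1/2) *\<^sub>R (absv c + c)"
definition neg_part :: "'a \<Rightarrow> 'a" where "neg_part c = (1/2) *\<^sub>R (absv c - c)"

context
  fixes c assumes c: "st c = c"
begin

lemma absv_props: "absv c \<in> alg_gen c \<and> pos (absv c) \<and> absv c * absv c = c * c"
  unfolding absv_def
proof (rule someI_ex)
  obtain m where m: "m \<in> alg_gen (c * c)" "pos m" "m * m = c * c"
    using pos_sqrt[OF pos_square[OF c]] .
  have "alg_gen (c * c) \<subseteq> alg_gen c"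
    by (intro alg_gen_subset closed_subalg_alg_gen closed_subalgD alg_gen_self)
  with m show "\<exists>m. m \<in> alg_gen c \<and> pos m \<and> m * m = c * c" by blast
qed

lemma absv_mem: "absv c \<in> alg_gen c" and pos_absv: "pos (absv c)"
  and absv_square: "absv c * absv c = c * c"
  using absv_props by auto

lemma absv_commute: "absv c * c = c * absv c"
  using alg_gen_commute[OF absv_mem alg_gen_self] .

lemma parts_mem: "pos_part c \<in> alg_gen c" "neg_part c \<in> alg_gen c"
  unfolding pos_part_def neg_part_def
  by (intro closed_subalgD[OF closed_subalg_alg_gen] absv_mem alg_gen_self)+

lemma pos_neg_part: "pos (neg_part c)"
  unfolding neg_part_def
  by (intro pos_scaleR pos_abs_diff c pos_absv absv_commute absv_square) simp

lemma pos_pos_part: "pos (pos_part c)"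
proof -
  have "pos (absv c - (- c))"
    using absv_commute absv_square c by (intro pos_abs_diff pos_absv) (auto simp: st_minus)
  then show ?thesis unfolding pos_part_def by (intro pos_scaleR) auto
qed

lemma parts_mult: "pos_part c * neg_part c = 0" "neg_part c * pos_part c = 0"
  unfolding pos_part_def neg_part_def
  by (simp_all add: algebra_simps absv_commute absv_square)

lemma parts_diff: "pos_part c - neg_part c = c"
  unfolding pos_part_def neg_part_def
  by (simp add: algebra_simps flip: scaleR_add_left)

lemma parts_add: "pos_part c + neg_part c = absv c"
  unfolding pos_part_def neg_part_def
  by (simp add: algebra_simps flip: scaleR_add_left)

end

text \<open>The norm of a nonzero positive element is a spectral value. An inverse \<open>g\<close>
  of norm b - b would satisfy g \<le> norm g, hence b \<le> norm b - 1 / norm g, which is below the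
  norm.\<close>

lemma pos_invertible_diff:
  assumes "pos b" "b \<noteq> 0" "(of_real (norm b) - b) * g = 1" "g * (of_real (norm b) - b) = 1"
  shows False
proof -
  let ?a = "of_real (norm b) - b"
  have pa: "pos ?a" by (intro pos_of_real_diff pos_sa assms) simp
  have pg: "pos g" by (rule pos_inverse[OF pa assms(3,4)])
  have g0: "norm g > 0" using assms(3) by auto
  have 1: "(of_real (norm g) - g) * ?a = norm g *\<^sub>R ?a - 1"
    using left_diff_distrib[of "of_real (norm g)" g ?a] assms(4) by (simp add: of_real_def)
  have 2: "?a * (of_real (norm g) - g) = norm g *\<^sub>R ?a - 1"
    using right_diff_distrib[of ?a "of_real (norm g)" g] assms(3) by (simp add: of_real_def)
  have "pos ((of_real (norm g) - g) * ?a)"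
    by (intro pos_mult pa pos_of_real_diff pos_sa pg order_refl) (simp only: 1 2)
  then have "pos ((1 / norm g) *\<^sub>R (norm g *\<^sub>R ?a - 1))"
    unfolding 1 by (intro pos_scaleR) auto
  also have "(1 / norm g) *\<^sub>R (norm g *\<^sub>R ?a - 1) = of_real (norm b - 1 / norm g) - b"
    using g0 by (simp add: scaleR_diff_right) (simp add: of_real_def algebra_simps)
  finally have *: "pos (of_real (norm b - 1 / norm g) - b)" .
  have "norm b \<le> norm b - 1 / norm g"
  proof (cases "norm b - 1 / norm g \<ge> 0")
    case True
    with * assms(1) show ?thesis by (intro norm_le_of_pos_diff)
  next
    \<comment> \<open>A negative upper bound would make \<open>- b\<close> positive as well, forcing
      \<open>b = 0\<close>.\<close>
    case False
    then have "pos (of_real (- (norm b - 1 / norm g)))" by (intro pos_of_real) simp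
    then have "pos (- b)" using pos_add[OF _ *, of "of_real (- (norm b - 1 / norm g))"] by simp
    then show ?thesis using assms(1,2) pos_antisym by blast
  qed
  then show False using g0 by simp
qed

text \<open>With z = h + ik the sum of \<open>z * st z\<close> and \<open>st z * z\<close> is 2
  (h\<cdot>h + k\<cdot>k), so \<open>z * st z\<close> is positive if \<open>- (st z * z)\<close> is.
  Then t + \<open>z * st z\<close> is invertible for t > 0, hence so is t + \<open>st z * z\<close>;
  for t the norm of \<open>st z * z\<close> this contradicts
  \<open>pos_invertible_diff\<close>.\<close>

lemma eq_0_if_pos_minus_st_mult_self:
  assumes "pos (- (st z * z))"
  shows "z = 0"
proof (rule ccontr)
  assume "z \<noteq> 0"
  let ?b = "- (st z * z)"
  define t where "t = norm ?b"
  have b0: "?b \<noteq> 0" using \<open>z \<noteq> 0\<close> st_mult_self_eq_0 by simp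
  then have t: "t > 0" by (simp add: t_def)
  obtain h k where hk: "st h = h" "st k = k" "z = h + sc \<i> k" using cartesian_decomposition .
  have "pos (2 *\<^sub>R (h * h + k * k) + ?b)"
    by (intro pos_add pos_scaleR pos_square hk assms) simp
  also have "2 *\<^sub>R (h * h + k * k) + ?b = z * st z"
    by (simp add: hk st_add st_sc algebra_simps mult_sc_left mult_sc_right sc_minus_left
        sc_diff_right sc_add_right sc_minus_right scaleR_2)
  finally have "pos (z * st z)" .
  then obtain G where G: "(of_real t + z * st z) * G = 1" "G * (of_real t + z * st z) = 1"
    using pos_add_of_real_invertible[OF _ t closed_subalg_alg_gen alg_gen_self] by blast
  \<comment> \<open>The algebraic transfer of inverses behind the equality of the nonzero spectra of
    xy and yx.\<close>
  define g where "g = (1/t) *\<^sub>R (1 - st z * G * z)"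
  let ?w = "of_real t + st z * z"
  have "?w * (st z * G * z) = st z * ((of_real t + z * st z) * G) * z"
    by (simp add: algebra_simps of_real_def)
  then have 1: "?w * (st z * G * z) = st z * z" using G by simp
  have "(st z * G * z) * ?w = st z * (G * (of_real t + z * st z)) * z"
    by (simp add: algebra_simps of_real_def)
  then have 2: "(st z * G * z) * ?w = st z * z" using G by simp
  have "?w * g = 1" "g * ?w = 1" unfolding g_def using t
    by (simp_all add: right_diff_distrib left_diff_distrib 1 2) (simp_all add: of_real_def)
  then show False using pos_invertible_diff[OF assms b0, of g] by (simp add: t_def)
qed

text \<open>With \<open>n\<close> the negative part of \<open>x\<^sup>*x\<close> and \<open>z = x n\<close> one has \<open>z\<^sup>*z = -n\<^sup>3\<close>.\<close>

theorem pos_st_mult_self: "pos (st x * x)"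
proof -
  let ?y = "st x * x"
  have y: "st ?y = ?y" by (simp add: st_mult)
  define n where "n = neg_part ?y"
  have n: "pos n" using pos_neg_part[OF y] by (simp add: n_def)
  have yn: "?y * n = - (n * n)"
    using parts_diff[OF y] parts_mult[OF y] unfolding n_def
    by (metis (no_types) diff_0 left_diff_distrib)
  have "st (x * n) * (x * n) = n * (?y * n)" by (simp add: st_mult pos_sa[OF n] mult.assoc)
  then have z: "- (st (x * n) * (x * n)) = n * (n * n)" by (simp add: yn)
  have "pos (n * (n * n))" by (intro pos_mult n) (simp_all add: mult.assoc)
  then have "x * n = 0" using z eq_0_if_pos_minus_st_mult_self by simp
  then have "n * (n * n) = 0" using z by simp
  then have "(n * n) * (n * n) = 0" by (simp add: mult.assoc)
  then have "n * n = 0" using norm_sa_square[of "n * n"] by (simp add: st_mult pos_sa[OF n])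
  then have "n = 0" using norm_sa_square[of n] by (simp add: pos_sa[OF n])
  then show ?thesis using parts_diff[OF y] pos_pos_part[OF y] by (simp add: n_def)
qed

lemma cstar_pos_iff_pos: "cstar_pos st a \<longleftrightarrow> pos a"
  unfolding cstar_pos_def by (metis pos_st_mult_self pos_sqrt pos_sa)

lemma pos_conj: "pos a \<Longrightarrow> pos (st x * a * x)"
  by (metis pos_sa pos_sqrt pos_st_mult_self st_mult mult.assoc)

end

section \<open>The expectation is positive, unital and contractive\<close>

locale finite_index_expectation = unital_cstar sc st
  for sc :: "complex \<Rightarrow> 'a::{real_normed_algebra_1,banach} \<Rightarrow> 'a" and st :: "'a \<Rightarrow> 'a" +
  fixes B :: "'a set" and E :: "'a \<Rightarrow> 'a" and K :: real
  assumes subalg: "cstar_subalgebra sc st B"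
    and expectation: "cond_expectation sc E B"
    and K_ge_1: "K \<ge> 1"
    and dominates: "positive_map st (\<lambda>a. K *\<^sub>R E a - a)"
begin

lemma B_add: "x \<in> B \<Longrightarrow> y \<in> B \<Longrightarrow> x + y \<in> B"
  and B_mult: "x \<in> B \<Longrightarrow> y \<in> B \<Longrightarrow> x * y \<in> B"
  and B_sc: "x \<in> B \<Longrightarrow> sc c x \<in> B" and B_st: "x \<in> B \<Longrightarrow> st x \<in> B"
  and B_0: "0 \<in> B" and B_closed: "closed B"
  using subalg unfolding cstar_subalgebra_def by auto

lemma B_scaleR: "x \<in> B \<Longrightarrow> r *\<^sub>R x \<in> B" using B_sc[of x "complex_of_real r"] by (simp add: sc_of_real)
lemma B_diff: "x \<in> B \<Longrightarrow> y \<in> B \<Longrightarrow> x - y \<in> B" using B_add[of x "- y"] B_scaleR[of y "-1"] by simp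

lemma E_add: "E (x + y) = E x + E y" and E_sc: "E (sc c x) = sc c (E x)"
  and E_mem: "E x \<in> B" and E_fix: "b \<in> B \<Longrightarrow> E b = b" and onorm_E: "onorm E = 1"
  using expectation unfolding cond_expectation_def complex_linear_map_def by auto

lemma E_scaleR: "E (r *\<^sub>R x) = r *\<^sub>R E x" using E_sc[of "complex_of_real r"] by (simp add: sc_of_real)
lemma E_minus: "E (- x) = - E x" using E_scaleR[of "-1" x] by simp
lemma E_diff: "E (x - y) = E x - E y" using E_add[of x "- y"] by (simp add: E_minus)
lemma E_0 [simp]: "E 0 = 0" using E_scaleR[of 0 0] by simp
lemma E_sum: "E (sum f I) = (\<Sum>i\<in>I. E (f i))"
  by (induction I rule: infinite_finite_induct) (auto simp: E_add)

lemma pos_dominates: "pos a \<Longrightarrow> pos (K *\<^sub>R E a - a)"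
  using dominates by (auto simp: positive_map_def cstar_pos_iff_pos)

text \<open>\<open>K *\<^sub>R E a\<close> is the sum of the positive elements
  \<open>K *\<^sub>R E a - a\<close> and \<open>a\<close>.\<close>

lemma E_pos:
  assumes "pos a" shows "pos (E a)"
proof -
  have "pos ((1/K) *\<^sub>R ((K *\<^sub>R E a - a) + a))"
    using pos_dominates assms K_ge_1 by (intro pos_scaleR pos_add) auto
  then show ?thesis using K_ge_1 by simp
qed

lemma E_sa: "st (E a) = E a" if "st a = a"
proof -
  have "pos (E (of_real (norm a) + a))" "pos (E (of_real (norm a)))"
    using that by (auto intro!: E_pos pos_of_real_add)
  then show ?thesis by (simp add: E_add pos_def st_add)
qed

lemma E_st: "E (st x) = st (E x)"
proof -
  obtain h k where hk: "st h = h" "st k = k" "x = h + sc \<i> k" using cartesian_decomposition .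
  then show ?thesis by (simp add: st_add st_sc E_add E_sc E_sa)
qed

text \<open>\<open>E 1 \<ge> 1/K\<close>, so \<open>1\<close> is a limit of polynomials in \<open>E 1 \<in> B\<close> without constant term.\<close>

lemma B_1: "1 \<in> B"
proof -
  define p where "p = E 1"
  define r where "r = norm p"
  \<comment> \<open>The spectrum of \<open>E 1\<close> lies between 1/K and r. With this s the
    distance from s to p is at most r, strictly less than s, so the powers of 1 - p/s tend to
    0.\<close>
  define s where "s = r + 1/K"
  have K0: "K > 0" using K_ge_1 by simp
  have r0: "r \<ge> 0" and s0: "s > 0" using K0 by (auto simp: r_def s_def add_nonneg_pos)
  have "pos ((1/K) *\<^sub>R (K *\<^sub>R E 1 - 1))" using K0 by (intro pos_scaleR pos_dominates) auto
  then have *: "pos (p - of_real (1/K))" using K0 by (simp add: p_def of_real_def scaleR_diff_right)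
  have "norm (p - of_real (1/K)) \<le> r"
    unfolding r_def using * K0 by (intro norm_mono_pos) (auto simp del: of_real_divide)
  then have "norm (of_real r - (p - of_real (1/K))) \<le> r" by (rule norm_of_real_diff_pos[OF *])
  then have n: "norm (of_real s - p) \<le> r" by (simp add: s_def algebra_simps)
  define x where "x = 1 - (1/s) *\<^sub>R p"
  have "x = (1/s) *\<^sub>R (of_real s - p)" using s0 by (simp add: x_def of_real_def scaleR_diff_right)
  then have "norm x \<le> r / s" using n s0 by (simp add: divide_right_mono)
  also have "\<dots> < 1" using s0 K0 by (simp add: s_def)
  finally have "norm x < 1" .
  then have "(\<lambda>n. x ^ n) \<longlonglongrightarrow> 0" by (rule LIMSEQ_power_zero)
  then have "(\<lambda>n. 1 - x ^ n) \<longlonglongrightarrow> 1 - 0" by (intro tendsto_diff tendsto_const)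
  moreover have "1 - x ^ n \<in> B" for n
  proof (induction n)
    case (Suc n)
    have "1 - x ^ Suc n = (1 - x ^ n) + (1/s) *\<^sub>R (p - (1 - x ^ n) * p)"
      by (simp add: power_Suc2 x_def algebra_simps del: power_Suc)
    moreover have "p \<in> B" by (simp add: p_def E_mem)
    ultimately show ?case using Suc B_add B_scaleR B_diff B_mult by presburger
  qed (simp add: B_0)
  ultimately show "1 \<in> B" using closed_sequentially[OF B_closed] by force
qed

lemma closed_subalg_B: "closed_subalg B"
  unfolding closed_subalg_def using B_closed B_1 B_add B_mult B_scaleR by blast

lemma E_1 [simp]: "E 1 = 1" by (intro E_fix B_1)
lemma E_of_real [simp]: "E (of_real r) = of_real r"
  by (intro E_fix closed_subalgD[OF closed_subalg_B])

lemma norm_E_sa: "st a = a \<Longrightarrow> norm (E a) \<le> norm a"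
  using E_pos[OF pos_of_real_diff[of a "norm a"]] E_pos[OF pos_of_real_add[of a "norm a"]]
  by (intro norm_le_of_pos_both) (auto simp: E_sa E_diff E_add)

text \<open>\<open>onorm\<close> is a supremum and controls values only once boundedness is known.
  The crude constant 2, from real and imaginary parts, unlocks \<open>onorm E = 1\<close> for
  \<open>norm_E\<close>.\<close>

lemma bounded_linear_E: "bounded_linear E"
proof (rule bounded_linear_intro[where K = 2])
  show "norm (E x) \<le> norm x * 2" for x
  proof -
    let ?h = "(1/2) *\<^sub>R (x + st x)" and ?k = "sc \<i> ((1/2) *\<^sub>R (x - st x))"
    have "x = ?h + sc (- \<i>) ?k" by (simp add: sc_sc flip: scaleR_add_right)
    then have "E x = E ?h + sc (- \<i>) (E ?k)" by (metis E_add E_sc)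
    then have "norm (E x) \<le> norm (E ?h) + norm (E ?k)"
      by (metis norm_triangle_ineq norm_sc norm_minus_cancel norm_ii mult_1)
    also have "norm (E ?h) \<le> norm ?h"
      by (rule norm_E_sa) (simp add: st_scaleR st_add add.commute)
    also have "norm (E ?k) \<le> norm ?k"
      by (rule norm_E_sa) (simp add: st_sc st_scaleR st_diff sc_minus_left sc_scaleR sc_diff_right)
    also have "norm ?h \<le> norm x" using norm_triangle_ineq[of x "st x"] by simp
    also have "norm ?k \<le> norm x" using norm_triangle_ineq4[of x "st x"] by (simp add: norm_sc)
    finally show ?thesis by simp
  qed
qed (simp_all add: E_add E_scaleR)

lemma norm_E: "norm (E x) \<le> norm x"
  using onorm[OF bounded_linear_E, of x] by (simp add: onorm_E)

lemmas tendsto_E = bounded_linear.tendsto[OF bounded_linear_E]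

text \<open>The Pimsner-Popa inequality: the norm of \<open>A\<close> is controlled by the norm of
  {A, E}. It later makes point evaluations continuous.\<close>

lemma norm_square_le_E: "(norm x)\<^sup>2 \<le> K * norm (E (st x * x))"
proof -
  have "norm (st x * x) \<le> norm (K *\<^sub>R E (st x * x))"
    by (intro norm_mono_pos pos_dominates pos_st_mult_self)
  then show ?thesis using K_ge_1 by (simp add: norm_st_mult)
qed

text \<open>Tomiyama's argument with \<open>q\<close> in place of a projection: compare the norms of
  \<open>f a + t q E(f a)\<close> and its image under \<open>E\<close> as \<open>t\<close> grows.\<close>

lemma orthogonal_E_eq_0:
  assumes q: "q \<in> B" "pos q" and f: "f \<in> B" and fq: "st f * q = 0"
  shows "q * E (f * a) = 0"
proof -
  have main: "q * E (f * a) = 0" if q: "q \<in> B" "pos q" "norm q \<le> 1" and fq: "st f * q = 0" for q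
  proof -
    define y where "y = E (f * a)"
    have yB: "y \<in> B" by (simp add: y_def E_mem)
    have qs: "st q = q" using q by (simp add: pos_sa)
    have est: "(1 + 2 * t) * (norm (q * y))\<^sup>2 \<le> (norm (f * a))\<^sup>2" if t: "t \<ge> 0" for t :: real
    proof -
      let ?u = "1 + t *\<^sub>R q"
      have tt: "(t * 2) *\<^sub>R x = t *\<^sub>R x + t *\<^sub>R x" for x :: 'a by (simp flip: scaleR_add_left)
      have us: "st ?u = ?u" by (simp add: st_add st_scaleR qs)
      \<comment> \<open>For a projection, (1 + t) q would equal u q with u = 1 + t q. For 0 \<le> q
        \<le> 1 this factorisation of u\<cdot>u - (1 + t)\<cdot>(1 + t)\<cdot>q\<cdot>q gives the
        inequality that suffices.\<close>
      have "pos ((1 - q) * (1 + (1 + 2 * t) *\<^sub>R q))"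
        using pos_of_real_diff[OF qs q(3)] q t
        by (intro pos_mult pos_add pos_scaleR) (auto simp: algebra_simps)
      also have "(1 - q) * (1 + (1 + 2 * t) *\<^sub>R q) = ?u * ?u - ((1 + t) *\<^sub>R q) * ((1 + t) *\<^sub>R q)"
        by (simp add: algebra_simps tt)
      finally have "pos (st y * (?u * ?u - ((1 + t) *\<^sub>R q) * ((1 + t) *\<^sub>R q)) * y)" by (rule pos_conj)
      also have "st y * (?u * ?u - ((1 + t) *\<^sub>R q) * ((1 + t) *\<^sub>R q)) * y
          = st (?u * y) * (?u * y) - st ((1 + t) *\<^sub>R q * y) * ((1 + t) *\<^sub>R q * y)"
        by (simp only: st_mult us) (simp add: st_mult st_scaleR st_add qs algebra_simps)
      finally have "(norm ((1 + t) *\<^sub>R q * y))\<^sup>2 \<le> (norm (?u * y))\<^sup>2"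
        unfolding norm_st_mult[symmetric] by (intro norm_mono_pos pos_st_mult_self)
      \<comment> \<open>\<open>q * y\<close> lies in \<open>B\<close> and is fixed by
        \<open>E\<close>, so contractivity applies to the whole sum.\<close>
      also have "?u * y = E (f * a + t *\<^sub>R (q * y))"
        using q yB by (simp add: E_add E_scaleR E_fix B_mult y_def algebra_simps)
      also have "(norm (E (f * a + t *\<^sub>R (q * y))))\<^sup>2 \<le> (norm (f * a + t *\<^sub>R (q * y)))\<^sup>2"
        by (intro power_mono norm_E) simp
      also have "\<dots> = norm (st (f * a) * (f * a) + t\<^sup>2 *\<^sub>R (st (q * y) * (q * y)))"
      proof -
        have 1: "st (f * a) * (q * y) = 0"
          using fq by (metis mult.assoc mult_zero_left mult_zero_right st_mult)
        have 2: "st (q * y) * (f * a) = 0" using 1 by (metis st_0 st_mult st_st)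
        show ?thesis unfolding norm_st_mult[symmetric] st_add st_scaleR distrib_left distrib_right
          by (simp add: 1 2 power2_eq_square)
      qed
      also have "\<dots> \<le> (norm (f * a))\<^sup>2 + t\<^sup>2 * (norm (q * y))\<^sup>2"
        by (rule norm_triangle_le) (simp add: norm_st_mult)
      finally have "((1 + t) * norm (q * y))\<^sup>2 \<le> (norm (f * a))\<^sup>2 + t\<^sup>2 * (norm (q * y))\<^sup>2"
        using t by simp
      then show ?thesis by (simp add: power2_eq_square algebra_simps)
    qed
    show ?thesis
    proof (rule ccontr)
      assume "q * E (f * a) \<noteq> 0"
      then have n: "(norm (q * y))\<^sup>2 > 0" by (simp add: y_def)
      obtain m :: nat where "(norm (f * a))\<^sup>2 < real m * (norm (q * y))\<^sup>2"
        using n reals_Archimedean3 by blast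
      moreover have "real m * (norm (q * y))\<^sup>2 \<le> (1 + 2 * real m) * (norm (q * y))\<^sup>2"
        by (intro mult_right_mono) auto
      ultimately show False using est[of "real m"] by simp
    qed
  qed
  \<comment> \<open>Scales \<open>q\<close> into the unit ball; the summand 1 covers
    \<open>q = 0\<close>.\<close>
  let ?s = "1 / (1 + norm q)"
  have "1 + norm q > 0" by (simp add: add_pos_nonneg)
  then have s: "?s \<ge> 0" "norm (?s *\<^sub>R q) \<le> 1" by (auto simp: divide_le_eq)
  have "(?s *\<^sub>R q) * E (f * a) = 0"
    by (rule main) (use q fq s in \<open>auto intro!: B_scaleR pos_scaleR simp del: norm_scaleR\<close>)
  moreover have "?s \<noteq> 0" using \<open>1 + norm q > 0\<close> by simp
  ultimately show ?thesis by simp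
qed

end

section \<open>Regularity of the absolute value\<close>

lemma has_vector_derivative_quadratic_bound:
  fixes f :: "real \<Rightarrow> 'b::real_normed_vector"
  assumes "\<And>y. norm (f y - f x - (y - x) *\<^sub>R f') \<le> C * (y - x)\<^sup>2"
  shows "(f has_vector_derivative f') (at x)"
  unfolding has_vector_derivative_def has_derivative_at2
proof (intro conjI bounded_linear_scaleR_left)
  show "((\<lambda>y. (1 / norm (y - x)) *\<^sub>R (f y - (f x + (y - x) *\<^sub>R f'))) \<longlongrightarrow> 0) (at x)"
  proof (rule Lim_null_comparison)
    show "\<forall>\<^sub>F y in at x. norm ((1 / norm (y - x)) *\<^sub>R (f y - (f x + (y - x) *\<^sub>R f'))) \<le> C * \<bar>y - x\<bar>"
    proof (rule eventuallyI)
      fix y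
      show "norm ((1 / norm (y - x)) *\<^sub>R (f y - (f x + (y - x) *\<^sub>R f'))) \<le> C * \<bar>y - x\<bar>"
      proof (cases "y = x")
        case False
        have "norm (f y - (f x + (y - x) *\<^sub>R f')) \<le> C * \<bar>y - x\<bar> * \<bar>y - x\<bar>"
          using assms[of y] by (simp add: algebra_simps power2_eq_square)
        then show ?thesis using False by (simp add: divide_le_eq)
      qed simp
    qed
    have "((\<lambda>y. C * \<bar>y - x\<bar>) \<longlongrightarrow> C * \<bar>x - x\<bar>) (at x)" by (intro tendsto_intros)
    then show "((\<lambda>y. C * \<bar>y - x\<bar>) \<longlongrightarrow> 0) (at x)" by simp
  qed
qed

context unital_cstar
begin

text \<open>With N the negative part, c N = - N\<cdot>N is positive and negative at once, so N
  vanishes.\<close>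

lemma absv_pos: assumes "pos c" shows "absv c = c"
proof -
  note c = pos_sa[OF assms]
  let ?N = "neg_part c"
  note N = pos_neg_part[OF c]
  have cN: "c * ?N = - (?N * ?N)"
    using parts_diff[OF c] parts_mult[OF c] by (metis (no_types) diff_0 left_diff_distrib)
  have "pos (c * ?N)"
    by (intro pos_mult assms N alg_gen_commute[OF alg_gen_self parts_mem(2)[OF c]])
  then have "?N * ?N = 0" using cN pos_antisym pos_square[OF pos_sa[OF N]] by metis
  then have "?N = 0" using norm_sa_square[OF pos_sa[OF N]] by simp
  then show ?thesis using parts_add[OF c] parts_diff[OF c] by simp
qed

lemma absv_neg: assumes "pos (- c)" shows "absv c = - c"
proof -
  have c: "st c = c" using pos_sa[OF assms] by (simp add: st_minus)
  let ?P = "pos_part c"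
  note P = pos_pos_part[OF c]
  have cP: "- c * ?P = - (?P * ?P)"
    using parts_diff[OF c] parts_mult[OF c]
    by (metis (no_types) diff_zero left_diff_distrib minus_mult_left)
  have "pos (- c * ?P)"
    using alg_gen_commute[OF alg_gen_self parts_mem(1)[OF c]] by (intro pos_mult assms P) auto
  then have "?P * ?P = 0" using cP pos_antisym pos_square[OF pos_sa[OF P]] by metis
  then have "?P = 0" using norm_sa_square[OF pos_sa[OF P]] by simp
  then show ?thesis using parts_add[OF c] parts_diff[OF c] by (metis add_0 minus_diff_eq diff_zero)
qed

section \<open>Absolute values of commuting elements that differ by a real scalar\<close>

context
  fixes b c c' :: 'a and t :: real
  assumes b: "st b = b" and c: "c \<in> alg_gen b" and c': "c' = c - of_real t"
begin

lemma c'_mem: "c' \<in> alg_gen b"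
  unfolding c' by (intro closed_subalgD[OF closed_subalg_alg_gen] c)

lemma sa_c: "st c = c" and sa_c': "st c' = c'"
  using alg_gen_sa[OF b] c c'_mem by auto

lemma parts_mem_gen: "x \<in> alg_gen b \<Longrightarrow> st x = x \<Longrightarrow>
    pos_part x \<in> alg_gen b \<and> neg_part x \<in> alg_gen b \<and> absv x \<in> alg_gen b"
  using parts_mem absv_mem alg_gen_subset[OF closed_subalg_alg_gen, of x b] by blast

lemma gen_commute: "x \<in> {c, c', pos_part c, pos_part c', neg_part c, neg_part c', absv c, absv c'}
    \<Longrightarrow> y \<in> {c, c', pos_part c, pos_part c', neg_part c, neg_part c', absv c, absv c'}
    \<Longrightarrow> x * y = y * x"
  by (rule alg_gen_commute[of _ b])
    (use c c'_mem parts_mem_gen[OF c sa_c] parts_mem_gen[OF c'_mem sa_c'] in auto)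

text \<open>With P, N and P', N' the parts of \<open>c\<close> and \<open>c'\<close>, the difference
  of t\<cdot>t and the square of \<open>absv c' - absv c\<close> is 4 (P N' + N P'), which is
  positive by commutation.\<close>

lemma norm_absv_diff: "norm (absv c' - absv c) \<le> \<bar>t\<bar>"
proof -
  let ?P = "pos_part c" and ?N = "neg_part c" and ?P' = "pos_part c'" and ?N' = "neg_part c'"
  let ?e = "absv c' - absv c"
  have es: "st ?e = ?e" using pos_sa[OF pos_absv[OF sa_c]] pos_sa[OF pos_absv[OF sa_c']] by (simp add: st_diff)
  have "pos (4 *\<^sub>R (?P * ?N' + ?N * ?P'))"
    by (intro pos_scaleR pos_add pos_mult pos_pos_part pos_neg_part sa_c sa_c' gen_commute) auto
  also have "4 *\<^sub>R (?P * ?N' + ?N * ?P') = 2 *\<^sub>R (absv c * absv c' - c * c')"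
  proof -
    have "2 *\<^sub>R (?P * ?N' + ?N * ?P') = (?P + ?N) * (?P' + ?N') - (?P - ?N) * (?P' - ?N')"
      by (simp add: algebra_simps scaleR_2)
    then have "2 *\<^sub>R (?P * ?N' + ?N * ?P') = absv c * absv c' - c * c'"
      by (simp add: parts_add parts_diff sa_c sa_c')
    then show ?thesis by (metis scaleR_scaleR mult_2 numeral_Bit0 one_add_one)
  qed
  also have "\<dots> = of_real (t\<^sup>2) - ?e * ?e"
  proof -
    have "of_real (t\<^sup>2) = (c - c') * (c - c')" by (simp add: c' power2_eq_square)
    also have "\<dots> = c * c + c' * c' - 2 *\<^sub>R (c * c')"
      using gen_commute[of c' c] by (simp add: algebra_simps scaleR_2)
    finally have 1: "of_real (t\<^sup>2) = c * c + c' * c' - 2 *\<^sub>R (c * c')" .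
    have "?e * ?e = absv c * absv c + absv c' * absv c' - 2 *\<^sub>R (absv c * absv c')"
      using gen_commute[of "absv c'" "absv c"] by (simp add: algebra_simps scaleR_2)
    then show ?thesis unfolding 1 by (simp add: absv_square sa_c sa_c' algebra_simps)
  qed
  finally have "norm (?e * ?e) \<le> t\<^sup>2" using pos_square[OF es] by (intro norm_le_of_pos_diff) auto
  then show ?thesis using norm_sa_square[OF es]
    by (metis abs_norm_cancel abs_le_square_iff)
qed

lemma norm_parts_diff: "norm (pos_part c' - pos_part c) \<le> \<bar>t\<bar>" "norm (neg_part c' - neg_part c) \<le> \<bar>t\<bar>"
proof -
  have "pos_part c' - pos_part c = (1/2) *\<^sub>R ((absv c' - absv c) - of_real t)"
    "neg_part c' - neg_part c = (1/2) *\<^sub>R ((absv c' - absv c) + of_real t)"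
    by (simp_all add: pos_part_def neg_part_def c' algebra_simps)
  then show "norm (pos_part c' - pos_part c) \<le> \<bar>t\<bar>" "norm (neg_part c' - neg_part c) \<le> \<bar>t\<bar>"
    using norm_triangle_ineq4[of "absv c' - absv c" "of_real t"]
      norm_triangle_ineq[of "absv c' - absv c" "of_real t"] norm_absv_diff by simp_all
qed

text \<open>The product q = N P' is quadratically small: q = N (P' - P) = (N - N') P' gives
  q\<cdot>q = q (P' - P)(N - N'), and both differences have norm at most \<bar>t\<bar>. The
  C*-identity then cancels one factor \<open>norm q\<close>.\<close>

lemma norm_opposite_parts:
  "norm (neg_part c * pos_part c') \<le> t\<^sup>2" "norm (pos_part c * neg_part c') \<le> t\<^sup>2"
proof -
  let ?P = "pos_part c" and ?N = "neg_part c" and ?P' = "pos_part c'" and ?N' = "neg_part c'"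
  have bound: "norm q \<le> t\<^sup>2" if q: "st q = q" "q * q = q * (x * y)" "norm x \<le> \<bar>t\<bar>" "norm y \<le> \<bar>t\<bar>" for q x y
  proof (cases "q = 0")
    case False
    have "norm (x * y) \<le> \<bar>t\<bar> * \<bar>t\<bar>"
      by (rule order_trans[OF norm_mult_ineq]) (intro mult_mono q, auto)
    then have "norm q * norm q \<le> norm q * t\<^sup>2"
      using norm_sa_square[OF q(1)] norm_mult_ineq[of q "x * y"] q(2)
      by (simp add: power2_eq_square) (meson mult_left_mono norm_ge_zero order_trans)
    then show ?thesis using False by simp
  qed simp
  note C = gen_commute and s = pos_sa[OF pos_pos_part] pos_sa[OF pos_neg_part]
  show "norm (?N * ?P') \<le> t\<^sup>2"
  proof (rule bound)
    show "st (?N * ?P') = ?N * ?P'" using C[of ?N ?P'] by (simp add: st_mult s sa_c sa_c')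
    have "?N * ?P' = ?N * (?P' - ?P)" "?N * ?P' = (?N - ?N') * ?P'"
      using parts_mult[OF sa_c] parts_mult[OF sa_c'] by (simp_all add: algebra_simps)
    then have "(?N * ?P') * (?N * ?P') = (?N * (?P' - ?P)) * ((?N - ?N') * ?P')" by simp
    also have "\<dots> = (?N * ?P') * ((?P' - ?P) * (?N - ?N'))"
    proof -
      have "((?P' - ?P) * (?N - ?N')) * ?P' = ?P' * ((?P' - ?P) * (?N - ?N'))"
        by (rule alg_gen_commute[of _ b])
          (use parts_mem_gen[OF c sa_c] parts_mem_gen[OF c'_mem sa_c'] in
            \<open>auto intro!: closed_subalgD[OF closed_subalg_alg_gen]\<close>)
      then show ?thesis by (simp add: mult.assoc)
    qed
    finally show "(?N * ?P') * (?N * ?P') = (?N * ?P') * ((?P' - ?P) * (?N - ?N'))" .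
    show "norm (?P' - ?P) \<le> \<bar>t\<bar>" "norm (?N - ?N') \<le> \<bar>t\<bar>"
      using norm_parts_diff by (auto simp: norm_minus_commute)
  qed
  show "norm (?P * ?N') \<le> t\<^sup>2"
  proof (rule bound)
    show "st (?P * ?N') = ?P * ?N'" using C[of ?P ?N'] by (simp add: st_mult s sa_c sa_c')
    have "?P * ?N' = ?P * (?N' - ?N)" "?P * ?N' = (?P - ?P') * ?N'"
      using parts_mult[OF sa_c] parts_mult[OF sa_c'] by (simp_all add: algebra_simps)
    then have "(?P * ?N') * (?P * ?N') = (?P * (?N' - ?N)) * ((?P - ?P') * ?N')" by simp
    also have "\<dots> = (?P * ?N') * ((?N' - ?N) * (?P - ?P'))"
    proof -
      have "((?N' - ?N) * (?P - ?P')) * ?N' = ?N' * ((?N' - ?N) * (?P - ?P'))"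
        by (rule alg_gen_commute[of _ b])
          (use parts_mem_gen[OF c sa_c] parts_mem_gen[OF c'_mem sa_c'] in
            \<open>auto intro!: closed_subalgD[OF closed_subalg_alg_gen]\<close>)
      then show ?thesis by (simp add: mult.assoc)
    qed
    finally show "(?P * ?N') * (?P * ?N') = (?P * ?N') * ((?N' - ?N) * (?P - ?P'))" .
    show "norm (?N' - ?N) \<le> \<bar>t\<bar>" "norm (?P - ?P') \<le> \<bar>t\<bar>"
      using norm_parts_diff by (auto simp: norm_minus_commute)
  qed
qed

text \<open>Says that \<open>c * absv c\<close> has derivative -2 \<open>absv c\<close> as l grows
  in c = b - l. With e = \<open>absv c' - absv c\<close> the error is 2 P N' - 2 N P' - t e, and the
  three terms account for 5 = 2 + 2 + 1.\<close>

lemma norm_signed_square_diff: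
  "norm (c' * absv c' - c * absv c + (2 * t) *\<^sub>R absv c) \<le> 5 * t\<^sup>2"
proof -
  let ?P = "pos_part c" and ?N = "neg_part c" and ?P' = "pos_part c'" and ?N' = "neg_part c'"
  let ?e = "absv c' - absv c"
  have 1: "?P' - ?P = (1/2) *\<^sub>R (?e - of_real t)" "?N' - ?N = (1/2) *\<^sub>R (?e + of_real t)"
    by (simp_all add: pos_part_def neg_part_def c' algebra_simps)
  have "2 *\<^sub>R (?N * ?P') = 2 *\<^sub>R (?N * (?P' - ?P))" "2 *\<^sub>R (?P * ?N') = 2 *\<^sub>R (?P * (?N' - ?N))"
    using parts_mult[OF sa_c] by (simp_all add: algebra_simps)
  then have "2 *\<^sub>R (?N * ?P') = ?N * ?e - t *\<^sub>R ?N" "2 *\<^sub>R (?P * ?N') = ?P * ?e + t *\<^sub>R ?P"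
    unfolding 1 by (simp_all add: of_real_def right_diff_distrib distrib_left)
  then have "2 *\<^sub>R (?P * ?N') - 2 *\<^sub>R (?N * ?P') = (?P - ?N) * ?e + t *\<^sub>R (?P + ?N)"
    by (simp add: algebra_simps)
  then have 2: "2 *\<^sub>R (?P * ?N') - 2 *\<^sub>R (?N * ?P') = c * ?e + t *\<^sub>R absv c"
    by (simp only: parts_diff[OF sa_c] parts_add[OF sa_c])
  have "c' * absv c' - c * absv c + (2 * t) *\<^sub>R absv c = (c * ?e + t *\<^sub>R absv c) - t *\<^sub>R ?e"
  proof -
    have tt: "(t * 2) *\<^sub>R x = t *\<^sub>R x + t *\<^sub>R x" for x :: 'a by (simp flip: scaleR_add_left)
    show ?thesis by (simp add: c' tt algebra_simps of_real_def)
  qed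
  also have "norm \<dots> \<le> (2 * t\<^sup>2 + 2 * t\<^sup>2) + t\<^sup>2"
    unfolding 2[symmetric]
  proof (intro norm_triangle_le_diff add_mono order_trans[OF norm_triangle_ineq4])
    show "norm (t *\<^sub>R ?e) \<le> t\<^sup>2"
      using mult_left_mono[OF norm_absv_diff, of "\<bar>t\<bar>"] by (simp add: power2_eq_square)
  qed (use norm_opposite_parts in auto)
  finally show ?thesis by simp
qed

end
end

section \<open>Tomiyama's theorem: the expectation is a bimodule map\<close>

context finite_index_expectation
begin

text \<open>Expanding both sides in positive and negative parts, the mixed terms vanish by
  \<open>orthogonal_E_eq_0\<close> and the remaining ones agree.\<close>

lemma E_absv_commute:
  assumes c: "c \<in> B" "st c = c"
  shows "c * E (absv c * a) = absv c * E (c * a)"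
proof -
  let ?P = "pos_part c" and ?N = "neg_part c"
  have B: "?P \<in> B" "?N \<in> B"
    using alg_gen_subset[OF closed_subalg_B c(1)] parts_mem[OF c(2)] by auto
  note p = pos_pos_part[OF c(2)] pos_neg_part[OF c(2)]
  have 1: "?N * E (?P * a) = 0" "?P * E (?N * a) = 0"
    by (rule orthogonal_E_eq_0; use B p parts_mult[OF c(2)] in \<open>simp add: pos_sa\<close>)+
  have "(?P - ?N) * E ((?P + ?N) * a) = (?P + ?N) * E ((?P - ?N) * a)"
    by (simp add: distrib_left distrib_right left_diff_distrib right_diff_distrib E_add E_diff 1)
  then show ?thesis by (simp only: parts_diff[OF c(2)] parts_add[OF c(2)])
qed

text \<open>The commutator of \<open>T\<close> with left multiplication by \<open>b\<close>.\<close>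

definition defect :: "'a \<Rightarrow> ('a \<Rightarrow> 'a) \<Rightarrow> 'a \<Rightarrow> 'a" where
  "defect b T a = T (b * a) - b * T a"

context
  fixes b assumes b: "b \<in> B" "st b = b"
begin

text \<open>Write \<open>\<phi>(f,g) = g E(f a)\<close>, \<open>c = b - l\<close>.  Since \<open>\<phi>(|c|,c) = \<phi>(c,|c|)\<close> for every \<open>l\<close>,
  the function \<open>\<Theta>\<close> below has derivative \<open>0\<close>; its values for large positive and large negative
  \<open>l\<close> are opposite multiples of the triple defect.\<close>

lemma defect_cubed: "defect b (defect b (defect b E)) a = 0"
proof -
  define c where "c l = b - of_real l" for l :: real
  define m where "m l = absv (c l)" for l
  have cG: "c l \<in> alg_gen b" for l
    unfolding c_def by (intro closed_subalgD[OF closed_subalg_alg_gen] alg_gen_self)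
  then have cB: "c l \<in> B" for l using alg_gen_subset[OF closed_subalg_B b(1)] by blast
  have cs: "st (c l) = c l" for l by (rule alg_gen_sa[OF b(2) cG])
  define \<phi> where "\<phi> f g = g * E (f * a)" for f g
  interpret \<phi>: bounded_bilinear \<phi>
  proof
    fix f f' g g' :: 'a and r :: real
    show "\<phi> (f + f') g = \<phi> f g + \<phi> f' g" "\<phi> f (g + g') = \<phi> f g + \<phi> f g'"
      "\<phi> (r *\<^sub>R f) g = r *\<^sub>R \<phi> f g" "\<phi> f (r *\<^sub>R g) = r *\<^sub>R \<phi> f g"
      by (simp_all add: \<phi>_def algebra_simps E_add E_scaleR)
    show "\<exists>K. \<forall>f g. norm (\<phi> f g) \<le> norm f * norm g * K"
    proof (intro exI[of _ "norm a"] allI)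
      fix f g
      have "norm (\<phi> f g) \<le> norm g * norm (E (f * a))" unfolding \<phi>_def by (rule norm_mult_ineq)
      also have "\<dots> \<le> norm g * (norm f * norm a)"
        by (intro mult_left_mono order_trans[OF norm_E] norm_mult_ineq) simp
      finally show "norm (\<phi> f g) \<le> norm f * norm g * norm a" by (simp add: mult_ac)
    qed
  qed
  have sym: "\<phi> (m l) (c l) = \<phi> (c l) (m l)" for l
    unfolding \<phi>_def m_def by (rule E_absv_commute[OF cB cs])
  define m2 where "m2 l = c l * m l" for l
  define m3 where "m3 l = c l * m2 l" for l
  have dc: "(c has_vector_derivative - 1) (at l)" for l
    by (rule has_vector_derivative_quadratic_bound[where C = 0]) (simp add: c_def of_real_def algebra_simps)
  have d2: "(m2 has_vector_derivative (- 2) *\<^sub>R m l) (at l)" for l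
  proof (rule has_vector_derivative_quadratic_bound[where C = 5])
    fix k
    have "c k = c l - of_real (k - l)" by (simp add: c_def)
    from norm_signed_square_diff[OF b(2) cG this]
    show "norm (m2 k - m2 l - (k - l) *\<^sub>R ((- 2) *\<^sub>R m l)) \<le> 5 * (k - l)\<^sup>2"
      by (simp add: m2_def m_def algebra_simps)
  qed
  have d3: "(m3 has_vector_derivative (- 3) *\<^sub>R m2 l) (at l)" for l
  proof -
    have "(m3 has_vector_derivative (c l * ((- 2) *\<^sub>R m l) + (- 1) * m2 l)) (at l)"
      unfolding m3_def[abs_def] by (rule has_vector_derivative_mult[OF dc d2])
    moreover have "c l * ((- 2) *\<^sub>R m l) + (- 1) * m2 l = (- 3) *\<^sub>R m2 l"
      using scaleR_add_left[of "- 2" "- 1" "m2 l"] by (simp add: m2_def)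
    ultimately show ?thesis by simp
  qed
  \<comment> \<open>Origin of this formula: l m = b m - m2 removes the explicit l from \<phi>(m,c) -
    \<phi>(c,m) and leaves terms linear in m and m2 with constant coefficients. These integrate,
    since m is the derivative of -m2/2 and m2 that of -m3/3.\<close>
  define \<Theta> where "\<Theta> l = (1/3) *\<^sub>R (\<phi> 1 (m3 l) - \<phi> (m3 l) 1)
      + (1/2) *\<^sub>R (\<phi> (b * m2 l) 1 - \<phi> (m2 l) b + \<phi> b (m2 l) - \<phi> 1 (b * m2 l))" for l
  note L = bounded_linear.has_vector_derivative[OF \<phi>.bounded_linear_left]
    bounded_linear.has_vector_derivative[OF \<phi>.bounded_linear_right]
    bounded_linear.has_vector_derivative[OF bounded_linear_mult_right]
  have cb: "b = c l + l *\<^sub>R 1" for l by (simp add: c_def of_real_def)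
  have "(\<Theta> has_vector_derivative 0) (at l)" for l
  proof -
    have "(\<Theta> has_vector_derivative
        (1/3) *\<^sub>R (\<phi> 1 ((- 3) *\<^sub>R m2 l) - \<phi> ((- 3) *\<^sub>R m2 l) 1)
      + (1/2) *\<^sub>R (\<phi> (b * ((- 2) *\<^sub>R m l)) 1 - \<phi> ((- 2) *\<^sub>R m l) b
          + \<phi> b ((- 2) *\<^sub>R m l) - \<phi> 1 (b * ((- 2) *\<^sub>R m l)))) (at l)"
      unfolding \<Theta>_def[abs_def]
      by (intro has_vector_derivative_add has_vector_derivative_diff
          bounded_linear.has_vector_derivative[OF bounded_linear_scaleR_right] L d2 d3)
    moreover have "(1/3) *\<^sub>R (\<phi> 1 ((- 3) *\<^sub>R m2 l) - \<phi> ((- 3) *\<^sub>R m2 l) 1)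
      + (1/2) *\<^sub>R (\<phi> (b * ((- 2) *\<^sub>R m l)) 1 - \<phi> ((- 2) *\<^sub>R m l) b
          + \<phi> b ((- 2) *\<^sub>R m l) - \<phi> 1 (b * ((- 2) *\<^sub>R m l)))
      = (\<phi> (m2 l) 1 - \<phi> 1 (m2 l)) - (\<phi> (b * m l) 1 - \<phi> (m l) b + \<phi> b (m l) - \<phi> 1 (b * m l))"
      by (simp add: \<phi>.scaleR_left \<phi>.scaleR_right \<phi>.minus_left \<phi>.minus_right algebra_simps)
    also have "\<dots> = \<phi> (m l) (c l) - \<phi> (c l) (m l)"
      by (subst (1 2 3 4) cb[of l])
        (simp add: \<phi>.add_left \<phi>.add_right \<phi>.scaleR_left \<phi>.scaleR_right m2_def algebra_simps)
    finally show ?thesis using sym[of l] by simp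
  qed
  then obtain k where k: "\<And>l. \<Theta> l = k"
    using has_vector_derivative_zero_constant[of UNIV \<Theta>] by auto
  let ?D = "defect b (defect b (defect b E)) a"
  \<comment> \<open>Where c is definite, every term of \<Theta> has degree three in c, and the terms
    assemble to the alternating binomial sum of the triple commutator. Replacing \<open>b\<close> by
    c leaves commutators unchanged.\<close>
  have val: "\<Theta> l = (s / 6) *\<^sub>R ?D" if ml: "m l = s *\<^sub>R c l" for l s
  proof -
    let ?c = "c l"
    have three: "3 *\<^sub>R x = x + x + x" for x :: 'a
      by (metis numeral_Bit1 numeral_One one_add_one numeral_Bit0 scaleR_left_distrib scaleR_one)
    have bx: "b * x = ?c * x + l *\<^sub>R x" for x by (subst cb[of l]) (simp add: distrib_right)
    have D: "?D = E (?c * (?c * (?c * a))) - 3 *\<^sub>R (?c * E (?c * (?c * a)))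
        + 3 *\<^sub>R (?c * (?c * E (?c * a))) - ?c * (?c * (?c * E a))"
    proof -
      have 1: "defect b E = (\<lambda>x. E (?c * x) - ?c * E x)"
        by (rule ext) (simp add: defect_def bx E_add E_scaleR)
      have 2: "defect b (\<lambda>x. E (?c * x) - ?c * E x) =
          (\<lambda>x. E (?c * (?c * x)) - ?c * E (?c * x) - ?c * (E (?c * x) - ?c * E x))"
        by (rule ext) (simp add: defect_def bx algebra_simps E_add E_scaleR)
      show ?thesis unfolding 1 2
        by (simp add: defect_def bx algebra_simps E_add E_scaleR three)
    qed
    have lin: "(1/3) *\<^sub>R (w - x) + (1/2) *\<^sub>R (x - y + z - w) = (1/6) *\<^sub>R (x - 3 *\<^sub>R y + 3 *\<^sub>R z - w)"
      for x y z w :: 'a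
    proof -
      have "(1/3) *\<^sub>R (w - x) + (1/2) *\<^sub>R (x - y + z - w)
          = (1/6) *\<^sub>R (2 *\<^sub>R (w - x) + 3 *\<^sub>R (x - y + z - w))"
        by (simp only: scaleR_add_right[of "1/6"] scaleR_scaleR) simp
      also have "2 *\<^sub>R (w - x) + 3 *\<^sub>R (x - y + z - w) = x - 3 *\<^sub>R y + 3 *\<^sub>R z - w"
        by (simp add: scaleR_2 three)
      finally show ?thesis .
    qed
    have "\<Theta> l = (1/3) *\<^sub>R (s *\<^sub>R (?c * (?c * (?c * E a))) - s *\<^sub>R E (?c * (?c * (?c * a))))
      + (1/2) *\<^sub>R (s *\<^sub>R E (?c * (?c * (?c * a))) - s *\<^sub>R (?c * E (?c * (?c * a)))
        + s *\<^sub>R (?c * (?c * E (?c * a))) - s *\<^sub>R (?c * (?c * (?c * E a))))"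
      unfolding \<Theta>_def m3_def m2_def ml \<phi>_def
      by (simp add: bx E_add E_scaleR mult.assoc distrib_right distrib_left scaleR_add_right)
    then show ?thesis unfolding lin D by (simp add: algebra_simps)
  qed
  \<comment> \<open>Beyond the norm of \<open>b\<close> the element b - l is definite: s = 1 at -R
    and s = -1 at R. The constant \<Theta> thus equals its own negative.\<close>
  define R where "R = norm b"
  have "pos (c (- R))" using pos_of_real_add[OF b(2), of R] by (simp add: c_def R_def add.commute)
  then have 1: "\<Theta> (- R) = (1/6) *\<^sub>R ?D" by (intro val) (simp add: m_def absv_pos)
  have "pos (- c R)" using pos_of_real_diff[OF b(2), of R] by (simp add: c_def R_def)
  then have 2: "\<Theta> R = (- 1 / 6) *\<^sub>R ?D" by (intro val) (simp add: m_def absv_neg)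
  have "(1/6) *\<^sub>R ?D = (- 1 / 6) *\<^sub>R ?D" using 1 2 k by simp
  then have "((1/6) - (- 1/6)) *\<^sub>R ?D = 0" by (simp only: scaleR_diff_left) simp
  then show ?thesis by simp
qed

end
end

text \<open>If the commutator S of T and u commutes with u, then T u\<dots>u picks up n copies of S
  after n factors. The left side stays bounded while u, having a contractive left inverse, cannot
  shrink them; so S = 0. This lowers the order of a vanishing iterated commutator from two to
  one.\<close>

lemma defect_eq_0_if_squared:
  fixes T :: "'a::real_normed_algebra_1 \<Rightarrow> 'a"
  assumes bounded: "\<And>a. norm (T a) \<le> C * norm a"
    and uv: "v * u = 1" "norm u \<le> 1" "norm v \<le> 1"
    and S: "\<And>a. S a = T (u * a) - u * T a" "\<And>a. S (u * a) = u * S a"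
  shows "S a = 0"
proof (rule ccontr)
  assume "S a \<noteq> 0"
  \<comment> \<open>The factor \<open>v\<close> turns \<open>u ^ n\<close> into the power n - 1 and
    gives the formula a meaning at n = 0.\<close>
  have pow: "T (u ^ n * a) = u ^ n * T a + real n *\<^sub>R (v * (u ^ n * S a))" for n a
  proof (induction n arbitrary: a)
    case (Suc n)
    have vuS: "v * (u ^ Suc n * S a) = u ^ n * S a"
      by (metis mult.assoc mult.left_neutral power_Suc uv(1))
    have "T (u ^ Suc n * a) = T (u ^ n * (u * a))" by (simp add: power_Suc2 mult.assoc del: power_Suc)
    also have "\<dots> = u ^ n * T (u * a) + real n *\<^sub>R (v * (u ^ Suc n * S a))"
      by (simp only: Suc S(2)) (simp add: power_Suc2 mult.assoc del: power_Suc)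
    also have "T (u * a) = u * T a + S a" by (simp add: S(1))
    also have "u ^ n * (u * T a + S a) = u ^ Suc n * T a + v * (u ^ Suc n * S a)"
      by (simp only: vuS distrib_left) (simp add: power_Suc2 mult.assoc del: power_Suc)
    finally show ?case by (simp add: scaleR_add_left add.assoc del: power_Suc) 
  qed simp
  have un: "norm (u ^ n) \<le> 1" for n
    using norm_power_ineq[of u n] power_le_one[OF norm_ge_zero uv(2), of n] by linarith
  have C: "C * norm x \<le> \<bar>C\<bar> * norm x" for x :: 'a by (intro mult_right_mono) auto
  have inv: "norm x \<le> norm (u ^ n * x)" for n x
  proof (induction n arbitrary: x)
    case (Suc n)
    have "norm x = norm (v * (u * x))" using uv(1) by (simp flip: mult.assoc)
    also have "\<dots> \<le> 1 * norm (u * x)"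
      by (rule order_trans[OF norm_mult_ineq]) (intro mult_right_mono uv, simp)
    also have "1 * norm (u * x) \<le> norm (u ^ n * (u * x))" using Suc[of "u * x"] by simp
    finally show ?case by (simp add: power_Suc2 mult.assoc del: power_Suc)
  qed simp
  have le: "real n * norm (S a) \<le> 2 * \<bar>C\<bar> * norm a" for n
  proof -
    let ?y = "v * (u ^ Suc n * S a)"
    have "?y = u ^ n * S a" by (metis mult.assoc mult.left_neutral power_Suc uv(1))
    then have "real n * norm (S a) \<le> real (Suc n) * norm ?y"
      using inv[of "S a" n] by (intro mult_mono) auto
    also have "\<dots> = norm (T (u ^ Suc n * a) - u ^ Suc n * T a)" by (simp only: pow) simp
    also have "\<dots> \<le> norm (T (u ^ Suc n * a)) + norm (u ^ Suc n * T a)" by (rule norm_triangle_ineq4)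
    also have "\<dots> \<le> \<bar>C\<bar> * norm a + \<bar>C\<bar> * norm a"
    proof (intro add_mono)
      have "norm (T (u ^ Suc n * a)) \<le> \<bar>C\<bar> * norm (u ^ Suc n * a)" using bounded C order_trans by blast
      also have "\<dots> \<le> \<bar>C\<bar> * (1 * norm a)"
        by (intro mult_left_mono order_trans[OF norm_mult_ineq] mult_right_mono un) auto
      finally show "norm (T (u ^ Suc n * a)) \<le> \<bar>C\<bar> * norm a" by simp
      have "norm (u ^ Suc n * T a) \<le> 1 * norm (T a)"
        by (intro order_trans[OF norm_mult_ineq] mult_right_mono un) auto
      then show "norm (u ^ Suc n * T a) \<le> \<bar>C\<bar> * norm a" using bounded[of a] C[of a] by simp
    qed
    finally show ?thesis by simp
  qed
  obtain n :: nat where "2 * \<bar>C\<bar> * norm a < real n * norm (S a)"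
    using \<open>S a \<noteq> 0\<close> reals_Archimedean3[of "norm (S a)"] by auto
  with le[of n] show False by simp
qed

context finite_index_expectation
begin

text \<open>The Cayley transform \<open>u = (b - i)(b + i)\<^sup>-\<^sup>1\<close> is unitary, and with \<open>r = (b + i)\<^sup>-\<^sup>1\<close> its defect
  is \<open>2 i r\<close> times the defect of \<open>b\<close>, evaluated at \<open>r a\<close>.\<close>

lemma E_mult_sa:
  assumes b: "b \<in> B" "st b = b"
  shows "E (b * a) = b * E a"
proof -
  have "pos (b * b)" by (rule pos_square[OF b(2)])
  then obtain g where g: "(of_real 1 + b * b) * g = 1" "g * (of_real 1 + b * b) = 1"
    using pos_add_of_real_invertible[OF _ zero_less_one closed_subalg_alg_gen alg_gen_self] by blast
  define j where "j = sc \<i> 1"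
  have jx: "j * x = sc \<i> x" "x * j = sc \<i> x" for x by (simp_all add: j_def mult_sc_left mult_sc_right)
  have bg: "b * g = g * b" by (rule inverse_commute[OF g]) (simp add: algebra_simps)
  \<comment> \<open>\<open>p\<close> = b + i is not self-adjoint, so its inverse is obtained from
    the positive element p q = 1 + b\<cdot>b.\<close>
  define p q r where "p = b + j" and "q = b - j" and "r = q * g"
  have pq: "p * q = of_real 1 + b * b" "q * p = of_real 1 + b * b"
    by (simp_all add: p_def q_def algebra_simps jx sc_add_right sc_diff_right) (simp_all add: j_def)
  have pg: "p * g = g * p" and qg: "q * g = g * q" using bg by (simp_all add: p_def q_def algebra_simps jx)
  have pr: "p * r = 1" "r * p = 1"
    unfolding r_def using pq g pg qg by (metis mult.assoc)+
  have br: "b * r = r * b" by (rule inverse_commute[OF pr]) (simp add: p_def algebra_simps jx)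
  define u where "u = q * r"
  have ur: "u = 1 - sc (2 * \<i>) r"
  proof -
    have "sc (2 * \<i>) 1 = j + j" unfolding j_def mult_2 by (rule sc_add_left)
    then have "q = p - sc (2 * \<i>) 1" by (simp add: p_def q_def)
    then show ?thesis using pr by (simp add: u_def left_diff_distrib mult_sc_left)
  qed
  have st_pq: "st p = q" "st q = p" using b by (simp_all add: p_def q_def j_def st_add st_diff st_sc sc_minus_left)
  have sg: "st g = g" using pos_sa[OF pos_inverse[OF pos_add[OF pos_of_real \<open>pos (b * b)\<close>] g]] by simp
  have "st u * u = 1"
  proof -
    have "st u * u = (g * p * p) * (q * q * g)" by (simp add: u_def r_def st_mult st_pq sg mult.assoc)
    also have "\<dots> = g * (p * (p * q) * q) * g" by (simp add: mult.assoc)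
    also have "p * (p * q) * q = (of_real 1 + b * b) * (of_real 1 + b * b)"
      by (metis pq mult.assoc)
    also have "g * ((of_real 1 + b * b) * (of_real 1 + b * b)) * g = 1"
      using g by (metis mult.assoc mult.left_neutral)
    finally show ?thesis .
  qed
  then have "(norm u)\<^sup>2 = 1" using norm_st_mult[of u] by simp
  then have nu: "norm u = 1" by (smt (verit) norm_ge_zero power2_eq_1_iff)
  define d where "d T a = T (u * a) - u * T a" for T :: "'a \<Rightarrow> 'a" and a
  define G where "G T a = sc (2 * \<i>) (r * T (r * a))" for T :: "'a \<Rightarrow> 'a" and a
  let ?lin = "complex_linear_map sc"
  have lin: "T (x + y) = T x + T y" "T (sc k x) = sc k (T x)" "T (x - y) = T x - T y"
    if "?lin T" for T k x y
  proof -
    show 1: "T (sc k x) = sc k (T x)" for k x using that by (simp add: complex_linear_map_def)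
    show 2: "T (x + y) = T x + T y" for x y using that by (simp add: complex_linear_map_def)
    show "T (x - y) = T x - T y" using 2[of x "sc (- 1) y"] 1[of "- 1" y] by simp
  qed
  have lin_E: "?lin E" using expectation by (simp add: cond_expectation_def)
  have lin_d: "?lin (d T)" if "?lin T" for T
    by (simp add: complex_linear_map_def d_def lin[OF that] distrib_left mult_sc_right sc_diff_right)
  have d_eq: "d T = G (defect b T)" if T: "?lin T" for T
  proof
    fix a
    have "d T a = sc (2 * \<i>) (r * T a - T (r * a))"
      by (simp add: d_def ur left_diff_distrib lin[OF T] mult_sc_left sc_diff_right)
    also have "r * T a - T (r * a) = r * (T (p * (r * a)) - p * T (r * a))"
    proof -
      have "p * (r * a) = a" "r * (p * T (r * a)) = T (r * a)" using pr by (simp_all flip: mult.assoc)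
      then show ?thesis by (simp add: right_diff_distrib)
    qed
    also have "T (p * (r * a)) - p * T (r * a) = defect b T (r * a)"
      by (simp add: p_def distrib_right jx lin[OF T] defect_def)
    finally show "d T a = G (defect b T) a" by (simp add: G_def)
  qed
  have G_comm: "defect b (G T) = G (defect b T)" for T
  proof
    fix a
    have "r * (b * a) = b * (r * a)" "b * (r * T (r * a)) = r * (b * T (r * a))"
      using br by (simp_all flip: mult.assoc)
    then show "defect b (G T) a = G (defect b T) a"
      by (simp add: defect_def G_def mult_sc_right right_diff_distrib sc_diff_right)
  qed
  have d1: "d E = G (defect b E)" by (rule d_eq[OF lin_E])
  have d2: "d (d E) = G (G (defect b (defect b E)))"
    using d_eq[OF lin_d[OF lin_E]] unfolding d1 G_comm .
  \<comment> \<open>\<open>G\<close> commutes with \<open>defect b\<close>, so the three commutators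
    with u gather into the triple commutator with \<open>b\<close>, which is zero.\<close>
  have "d (d (d E)) = G (defect b (d (d E)))" by (intro d_eq lin_d lin_E)
  also have "\<dots> = G (G (G (defect b (defect b (defect b E)))))" unfolding d2 G_comm ..
  also have "defect b (defect b (defect b E)) = (\<lambda>a. 0)" using defect_cubed[OF b] by blast
  finally have ddd: "d (d (d E)) a = 0" for a by (simp add: G_def)
  have nE: "norm (E x) \<le> 1 * norm x" for x using norm_E by simp
  have nd: "norm (d E x) \<le> 2 * norm x" for x
  proof -
    have "norm (E (u * x)) \<le> norm x" "norm (u * E x) \<le> norm x"
      using norm_E[of "u * x"] norm_E[of x] norm_mult_ineq[of u x] norm_mult_ineq[of u "E x"] nu by auto
    then show ?thesis unfolding d_def using norm_triangle_ineq4[of "E (u * x)" "u * E x"] by linarith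
  qed
  note sq = defect_eq_0_if_squared[OF _ \<open>st u * u = 1\<close>]
  \<comment> \<open>The order is lowered twice: first with \<open>d E\<close> as the bounded map,
    then with \<open>E\<close>.\<close>
  have "d (d E) x = 0" for x
    by (rule sq[OF nd, where S = "d (d E)"]) (use nu ddd in \<open>auto simp: d_def\<close>)
  then have "d E x = 0" for x
    by (intro sq[OF nE, where S = "d E"]) (use nu in \<open>auto simp: d_def\<close>)
  \<comment> \<open>Evaluating at \<open>p * a\<close> and multiplying by \<open>p\<close> undoes
    the two factors \<open>r\<close> in \<open>G\<close>.\<close>
  then have "G (defect b E) (p * a) = 0" by (simp add: d_eq[OF lin_E])
  moreover have "r * (p * a) = a" using pr by (simp flip: mult.assoc)
  ultimately have "norm (r * defect b E a) = 0" using norm_sc[of "2 * \<i>" "r * defect b E a"] by (simp add: G_def)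
  then have "p * (r * defect b E a) = 0" by simp
  then have "defect b E a = 0" using pr by (simp flip: mult.assoc)
  then show ?thesis by (simp add: defect_def)
qed

lemma E_mult_left:
  assumes "b \<in> B" shows "E (b * a) = b * E a"
proof -
  obtain h k where hk: "st h = h" "st k = k" "b = h + sc \<i> k" using cartesian_decomposition .
  have "h = (1/2) *\<^sub>R (b + st b)" "k = sc (- \<i>) ((1/2) *\<^sub>R (b - st b))"
    by (simp_all add: hk st_add st_sc sc_minus_left sc_sc flip: scaleR_2)
  then have "h \<in> B" "k \<in> B" using assms by (auto intro!: B_sc B_scaleR B_add B_diff B_st)
  then show ?thesis using hk
    by (simp add: distrib_right E_add mult_sc_left E_sc E_mult_sa)
qed

lemma E_mult_right:
  assumes "b \<in> B" shows "E (a * b) = E a * b"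
  using E_mult_left[OF B_st[OF assms], of "st a"] by (metis E_st st_mult st_st)

end

section \<open>Positivity of the tensor form\<close>

context finite_index_expectation
begin

lemma B_sum: "(\<And>i. i \<in> I \<Longrightarrow> f i \<in> B) \<Longrightarrow> sum f I \<in> B"
  by (induction I rule: infinite_finite_induct) (auto simp: B_0 B_add)

text \<open>Completion of the square in the last variable. The term with \<open>e\<close> replaces
  the last diagonal entry by the invertible \<open>c\<close>.\<close>

lemma schur_identity:
  fixes m :: "nat \<Rightarrow> nat \<Rightarrow> 'a" and x :: "nat \<Rightarrow> 'a"
  assumes st_m: "\<And>i j. st (m i j) = m j i"
    and g: "c * g = 1" "g * c = 1" "st g = g" and c: "c = m n n + e *\<^sub>R 1"
  defines "S \<equiv> \<Sum>j<n. m n j * x j"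
  shows "(\<Sum>i<Suc n. \<Sum>j<Suc n. st (x i) * m i j * x j) + e *\<^sub>R (st (x n) * x n)
    = (\<Sum>i<n. \<Sum>j<n. st (x i) * (m i j - m i n * g * m n j) * x j)
      + st (x n + g * S) * c * (x n + g * S)"
proof -
  let ?Q = "\<Sum>i<n. \<Sum>j<n. st (x i) * m i j * x j"
  have stS: "st S = (\<Sum>i<n. st (x i) * m i n)" by (simp add: S_def st_sum st_mult st_m)
  have "(\<Sum>i<Suc n. \<Sum>j<Suc n. st (x i) * m i j * x j)
      = ?Q + st S * x n + st (x n) * S + st (x n) * m n n * x n"
    by (simp add: sum.distrib stS sum_distrib_right) (simp add: S_def sum_distrib_left mult.assoc)
  then have 1: "(\<Sum>i<Suc n. \<Sum>j<Suc n. st (x i) * m i j * x j) + e *\<^sub>R (st (x n) * x n)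
      = ?Q + st S * x n + st (x n) * S + st (x n) * c * x n"
    by (simp add: c algebra_simps)
  have 2: "(\<Sum>i<n. \<Sum>j<n. st (x i) * (m i j - m i n * g * m n j) * x j) = ?Q - st S * g * S"
    unfolding stS by (simp add: S_def right_diff_distrib left_diff_distrib sum_subtractf sum_product mult.assoc)
      (simp add: sum_distrib_left sum_distrib_right mult.assoc, rule sum.swap)
  have "c * (g * S) = S" "g * (c * x n) = x n" "g * (c * (g * S)) = g * S"
    using g by (simp_all flip: mult.assoc)
  then have 3: "st (x n + g * S) * c * (x n + g * S)
      = st (x n) * c * x n + st (x n) * S + st S * x n + st S * g * S"
    by (simp add: st_add st_mult g algebra_simps)
  show ?thesis unfolding 1 2 3 by simp
qed

text \<open>Positivity against coefficients from \<open>B\<close> passes to coefficients from \<open>A\<close>: eliminate one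
  index at a time by a Schur complement, after making the last diagonal entry invertible.\<close>

lemma pos_form_extend:
  fixes m :: "nat \<Rightarrow> nat \<Rightarrow> 'a" and n :: nat
  assumes m: "\<And>i j. m i j \<in> B" "\<And>i j. st (m i j) = m j i"
    and pos: "\<And>b. (\<And>i. b i \<in> B) \<Longrightarrow> pos (\<Sum>i<n. \<Sum>j<n. st (b i) * m i j * b j)"
  shows "pos (\<Sum>i<n. \<Sum>j<n. st (x i) * m i j * x j)"
  using m pos
proof (induction n arbitrary: m)
  case (Suc n)
  note m = Suc.prems(1,2)
  show ?case
  proof (rule pos_of_add_eps)
    fix e :: real assume e: "e > 0"
    \<comment> \<open>The last unit vector is an admissible coefficient vector because
      \<open>1\<close> lies in \<open>B\<close>.\<close>
    have "pos (\<Sum>i<Suc n. \<Sum>j<Suc n. st (if i = n then 1 else 0) * m i j * (if j = n then 1 else 0))"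
      by (rule Suc.prems(3)) (auto simp: B_1 B_0)
    also have "(\<Sum>i<Suc n. \<Sum>j<Suc n. st (if i = n then 1 else 0) * m i j * (if j = n then 1 else 0)) = m n n"
      by simp
    finally have pm: "pos (m n n)" .
    define c where "c = of_real e + m n n"
    have pc: "pos c" unfolding c_def using e pm by (intro pos_add) auto
    obtain g where g: "g \<in> B" "c * g = 1" "g * c = 1"
      unfolding c_def using pos_add_of_real_invertible[OF pm e closed_subalg_B m(1)] by blast
    have sg: "st g = g" using pos_sa[OF pos_inverse[OF pc g(2,3)]] .
    have c: "c = m n n + e *\<^sub>R 1" by (simp add: c_def of_real_def)
    define m' where "m' i j = m i j - m i n * g * m n j" for i j
    note schur = schur_identity[of m c g n e, OF m(2) g(2,3) sg c, folded m'_def]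
    have "pos (\<Sum>i<n. \<Sum>j<n. st (x i) * m' i j * x j)"
    proof (rule Suc.IH)
      show "m' i j \<in> B" for i j unfolding m'_def by (intro B_diff B_mult m g)
      show "st (m' i j) = m' j i" for i j by (simp add: m'_def st_diff st_mult m sg mult.assoc)
      fix b :: "nat \<Rightarrow> 'a" assume b: "\<And>i. b i \<in> B"
      define S where "S = (\<Sum>j<n. m n j * b j)"
      have SB: "S \<in> B" unfolding S_def by (intro B_sum B_mult m b)
      \<comment> \<open>This last coordinate makes the completed square vanish, so the reduced form
        at \<open>b\<close> is the full form at \<open>b'\<close> plus a positive term.\<close>
      define b' where "b' = b(n := - (g * S))"
      have "- (g * S) \<in> B" using B_diff[OF B_0 B_mult[OF g(1) SB]] by simp
      then have b': "b' i \<in> B" for i by (simp add: b'_def b)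
      have S': "(\<Sum>j<n. m n j * b' j) = S" unfolding S_def by (intro sum.cong) (auto simp: b'_def)
      have "(\<Sum>i<n. \<Sum>j<n. st (b i) * m' i j * b j) = (\<Sum>i<n. \<Sum>j<n. st (b' i) * m' i j * b' j)"
        by (intro sum.cong) (auto simp: b'_def)
      also have "\<dots> = (\<Sum>i<Suc n. \<Sum>j<Suc n. st (b' i) * m i j * b' j) + e *\<^sub>R (st (b' n) * b' n)"
        unfolding schur[of b'] S' by (simp add: b'_def)
      finally have eq: "(\<Sum>i<n. \<Sum>j<n. st (b i) * m' i j * b j)
        = (\<Sum>i<Suc n. \<Sum>j<Suc n. st (b' i) * m i j * b' j) + e *\<^sub>R (st (b' n) * b' n)" .
      show "pos (\<Sum>i<n. \<Sum>j<n. st (b i) * m' i j * b j)"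
        unfolding eq using e
        by (intro pos_add[OF Suc.prems(3)[of b', OF b']] pos_scaleR pos_st_mult_self) simp
    qed
    then show "pos ((\<Sum>i<Suc n. \<Sum>j<Suc n. st (x i) * m i j * x j) + e *\<^sub>R (st (x n) * x n))"
      unfolding schur[of x] using pc by (intro pos_add pos_conj)
  qed
qed simp

text \<open>Against coefficients b i from \<open>B\<close> the bimodule property turns the sum into
  E(y\<cdot>y) with one y starred, where y = \<Sum> a i b i; \<open>pos_form_extend\<close> then
  admits coefficients from \<open>A\<close>.\<close>

lemma pos_gram:
  fixes a x :: "nat \<Rightarrow> 'a"
  shows "pos (\<Sum>i<n. \<Sum>j<n. st (x i) * E (st (a i) * a j) * x j)"
proof (rule pos_form_extend)
  show "st (E (st (a i) * a j)) = E (st (a j) * a i)" for i j by (simp add: st_mult flip: E_st)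
  fix b :: "nat \<Rightarrow> 'a" assume b: "\<And>i. b i \<in> B"
  have "pos (E (st (\<Sum>i<n. a i * b i) * (\<Sum>i<n. a i * b i)))" by (intro E_pos pos_st_mult_self)
  also have "st (\<Sum>i<n. a i * b i) * (\<Sum>i<n. a i * b i) = (\<Sum>i<n. \<Sum>j<n. st (b i) * ((st (a i) * a j) * b j))"
    by (simp add: st_sum st_mult sum_product mult.assoc)
  also have "E \<dots> = (\<Sum>i<n. \<Sum>j<n. st (b i) * E (st (a i) * a j) * b j)"
    by (simp only: E_sum E_mult_left[OF B_st[OF b]] E_mult_right[OF b]) (simp only: mult.assoc)
  finally show "pos (\<Sum>i<n. \<Sum>j<n. st (b i) * E (st (a i) * a j) * b j)" .
qed (rule E_mem)

section \<open>Formal tensors as functions, and their inner product\<close>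

definition tensor_fun :: "('a \<times> 'a) list \<Rightarrow> 'a \<Rightarrow> 'a" where
  "tensor_fun ts t = (\<Sum>(a, x)\<leftarrow>ts. E (t * a) * x)"

text \<open>The inner product of a formal tensor with the vector represented by \<open>g\<close>,
  from moving \<open>a\<close> and V to the other side. It uses only values of \<open>g\<close>, so
  it makes sense before \<open>g\<close> is known to come from a tensor and passes to pointwise
  limits.\<close>

definition pairing :: "('a \<times> 'a) list \<Rightarrow> ('a \<Rightarrow> 'a) \<Rightarrow> 'a" where
  "pairing ts g = (\<Sum>(a, x)\<leftarrow>ts. E (st x * g (st a)))"

lemma tensor_fun_Nil: "tensor_fun [] = (\<lambda>t. 0)"
  and tensor_fun_Cons: "tensor_fun ((a, x) # ts) = (\<lambda>t. E (t * a) * x + tensor_fun ts t)"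
  by (auto simp: tensor_fun_def)

lemma pairing_Nil [simp]: "pairing [] g = 0"
  and pairing_Cons: "pairing ((a, x) # ts) g = E (st x * g (st a)) + pairing ts g"
  by (auto simp: pairing_def)

lemma pairing_add: "pairing ts (\<lambda>t. g t + h t) = pairing ts g + pairing ts h"
  by (induction ts) (auto simp: pairing_Cons distrib_left E_add)

lemma pairing_sc: "pairing ts (\<lambda>t. sc c (g t)) = sc c (pairing ts g)"
  by (induction ts) (auto simp: pairing_Cons mult_sc_right E_sc sc_add_right)

lemma pairing_ract: "b \<in> B \<Longrightarrow> pairing ts (\<lambda>t. g t * b) = pairing ts g * b"
  by (induction ts) (auto simp: pairing_Cons distrib_right E_mult_right simp flip: mult.assoc)

lemma pairing_zero [simp]: "pairing ts (\<lambda>t. 0) = 0"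
  by (induction ts) (auto simp: pairing_Cons)

lemma pairing_mem: "pairing ts g \<in> B"
  by (induction ts) (auto simp: pairing_Cons B_0 intro!: B_add E_mem)

lemma tendsto_pairing:
  assumes "\<And>t. (\<lambda>n. g n t) \<longlonglongrightarrow> h t"
  shows "(\<lambda>n. pairing ts (g n)) \<longlonglongrightarrow> pairing ts h"
  by (induction ts) (auto simp: pairing_Cons intro!: tendsto_add tendsto_E tendsto_mult assms)

lemma pairing_st: "pairing ts (tensor_fun ss) = st (pairing ss (tensor_fun ts))"
proof (induction ts)
  case (Cons p ts)
  obtain a x where p: "p = (a, x)" by force
  have "E (st x * tensor_fun ss (st a)) = st (pairing ss (\<lambda>t. E (t * a) * x))"
  proof (induction ss)
    case (Cons q ss)
    obtain c y where q: "q = (c, y)" by force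
    show ?case using Cons
      by (simp add: q tensor_fun_Cons pairing_Cons distrib_left E_add st_add st_mult mult.assoc flip: E_st)
  qed (simp add: tensor_fun_Nil)
  then show ?case using Cons
    by (simp add: p pairing_Cons tensor_fun_Cons pairing_add st_add)
qed (simp add: tensor_fun_Nil)

lemma pairing_pos: "pos (pairing ts (tensor_fun ts))"
proof -
  let ?n = "length ts" and ?a = "\<lambda>i. fst (ts ! i)" and ?x = "\<lambda>i. snd (ts ! i)"
  have "pos (E (\<Sum>i<?n. \<Sum>j<?n. st (?x i) * E (st (?a i) * ?a j) * ?x j))"
    by (intro E_pos pos_gram)
  also have "E (\<Sum>i<?n. \<Sum>j<?n. st (?x i) * E (st (?a i) * ?a j) * ?x j) = pairing ts (tensor_fun ts)"
    by (simp add: pairing_def tensor_fun_def sum_list_sum_nth E_sum sum_distrib_left mult.assoc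
        case_prod_beta lessThan_atLeast0)
  finally show ?thesis .
qed

end

section \<open>C*-valued forms\<close>

text \<open>Shared by the tensors and their completion. The form may be degenerate; Cauchy-Schwarz
  up to a constant and the triangle inequality are drawn from the scalar structure alone.\<close>

locale cstar_form = unital_cstar sc st
  for sc :: "complex \<Rightarrow> 'a::{real_normed_algebra_1,banach} \<Rightarrow> 'a" and st :: "'a \<Rightarrow> 'a" +
  fixes X :: "('b \<Rightarrow> 'a) set" and ip :: "('b \<Rightarrow> 'a) \<Rightarrow> ('b \<Rightarrow> 'a) \<Rightarrow> 'a"
  assumes X_add: "f \<in> X \<Longrightarrow> g \<in> X \<Longrightarrow> (\<lambda>t. f t + g t) \<in> X"
    and X_sc: "f \<in> X \<Longrightarrow> (\<lambda>t. sc c (f t)) \<in> X"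
    and ip_add: "f \<in> X \<Longrightarrow> g \<in> X \<Longrightarrow> h \<in> X \<Longrightarrow> ip f (\<lambda>t. g t + h t) = ip f g + ip f h"
    and ip_sc: "f \<in> X \<Longrightarrow> g \<in> X \<Longrightarrow> ip f (\<lambda>t. sc c (g t)) = sc c (ip f g)"
    and ip_st: "f \<in> X \<Longrightarrow> g \<in> X \<Longrightarrow> ip g f = st (ip f g)"
    and ip_pos: "f \<in> X \<Longrightarrow> pos (ip f f)"
begin

definition nrm :: "('b \<Rightarrow> 'a) \<Rightarrow> real" where "nrm f = sqrt (norm (ip f f))"

lemma nrm_nonneg [simp]: "nrm f \<ge> 0" by (simp add: nrm_def)
lemma nrm_square: "(nrm f)\<^sup>2 = norm (ip f f)" by (simp add: nrm_def)

lemma X_diff: "f \<in> X \<Longrightarrow> g \<in> X \<Longrightarrow> (\<lambda>t. f t - g t) \<in> X"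
  using X_add[OF _ X_sc, of f g "- 1"] by simp

lemma ip_add_left: "f \<in> X \<Longrightarrow> g \<in> X \<Longrightarrow> h \<in> X \<Longrightarrow> ip (\<lambda>t. f t + g t) h = ip f h + ip g h"
  using ip_st[OF _ X_add, of h f g] ip_st[of h f] ip_st[of h g] ip_add[of h f g] by (simp add: st_add)

lemma ip_sc_left: "f \<in> X \<Longrightarrow> g \<in> X \<Longrightarrow> ip (\<lambda>t. sc c (f t)) g = sc (cnj c) (ip f g)"
  using ip_st[OF _ X_sc, of g f c] ip_st[of g f] ip_sc[of g f c] by (simp add: st_sc)

lemma ip_diff: "f \<in> X \<Longrightarrow> g \<in> X \<Longrightarrow> h \<in> X \<Longrightarrow> ip f (\<lambda>t. g t - h t) = ip f g - ip f h"
  using ip_add[OF _ _ X_sc, of f g h "- 1"] ip_sc[of f h "- 1"] by simp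

lemma ip_diff_left: "f \<in> X \<Longrightarrow> g \<in> X \<Longrightarrow> h \<in> X \<Longrightarrow> ip (\<lambda>t. f t - g t) h = ip f h - ip g h"
  using ip_st[OF _ X_diff, of h f g] ip_st[of h f] ip_st[of h g] ip_diff[of h f g] by (simp add: st_diff)

text \<open>Positivity of the form at f + s g for both signs of s bounds s times the symmetrised
  product. The constant is sharp enough for the exact triangle inequality.\<close>

lemma norm_ip_plus_adjoint:
  assumes f: "f \<in> X" and g: "g \<in> X"
  shows "norm (ip f g + ip g f) \<le> 2 * nrm f * nrm g"
proof -
  let ?h = "ip f g + ip g f"
  have hs: "st ?h = ?h" using ip_st[OF f g] by (simp add: st_add add.commute)
  have p: "pos (of_real ((nrm f)\<^sup>2 + s\<^sup>2 * (nrm g)\<^sup>2) + s *\<^sub>R ?h)" for s :: real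
  proof -
    let ?u = "\<lambda>t. f t + sc (complex_of_real s) (g t)"
    have u: "?u \<in> X" by (intro X_add X_sc f g)
    have "ip ?u ?u = ip f f + s *\<^sub>R ?h + s\<^sup>2 *\<^sub>R ip g g"
      using f g by (simp add: ip_add ip_add_left X_sc X_add ip_sc ip_sc_left)
        (simp add: sc_of_real algebra_simps power2_eq_square)
    moreover have "pos ((of_real ((nrm f)\<^sup>2) - ip f f) + s\<^sup>2 *\<^sub>R (of_real ((nrm g)\<^sup>2) - ip g g) + ip ?u ?u)"
      by (intro pos_add pos_scaleR pos_of_real_diff pos_sa ip_pos f g u) (auto simp: nrm_square)
    ultimately show ?thesis by (simp add: algebra_simps scaleR_conv_of_real)
  qed
  have b: "s * norm ?h \<le> (nrm f)\<^sup>2 + s\<^sup>2 * (nrm g)\<^sup>2" if s: "s > 0" for s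
  proof -
    have "norm (s *\<^sub>R ?h) \<le> (nrm f)\<^sup>2 + s\<^sup>2 * (nrm g)\<^sup>2"
      using p[of s] p[of "- s"] by (intro norm_le_of_pos_both) (auto simp: hs st_scaleR)
    then show ?thesis using s by simp
  qed
  \<comment> \<open>Optimising s calls for the quotient of the two norms; the shift by e avoids
    division by zero and is removed by a limit.\<close>
  have e: "norm ?h \<le> 2 * (nrm f + e) * (nrm g + e)" if e: "e > 0" for e
  proof -
    have pf: "nrm f + e > 0" and pg: "nrm g + e > 0" using e nrm_nonneg by (simp_all add: add_nonneg_pos)
    let ?s = "(nrm f + e) / (nrm g + e)"
    have "?s * norm ?h \<le> (nrm f)\<^sup>2 + ?s\<^sup>2 * (nrm g)\<^sup>2" using pf pg by (intro b) simp
    also have "\<dots> \<le> (nrm f + e)\<^sup>2 + ?s\<^sup>2 * (nrm g + e)\<^sup>2"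
      using e by (intro add_mono mult_left_mono power_mono) auto
    also have "\<dots> = 2 * (nrm f + e)\<^sup>2" using pg by (simp add: power_divide)
    also have "\<dots> = ?s * (2 * (nrm f + e) * (nrm g + e))" using pg by (simp add: power2_eq_square)
    finally show ?thesis using pf pg by (simp only: mult_le_cancel_left_pos divide_pos_pos)
  qed
  have "((\<lambda>e. 2 * (nrm f + e) * (nrm g + e)) \<longlongrightarrow> 2 * (nrm f + 0) * (nrm g + 0)) (at_right 0)"
    by (intro tendsto_intros)
  then have "norm ?h \<le> 2 * (nrm f + 0) * (nrm g + 0)"
    by (rule tendsto_lowerbound) (rule eventually_at_rightI[of 0 1], rule e, auto)
  then show ?thesis by simp
qed

lemma nrm_sc: "f \<in> X \<Longrightarrow> nrm (\<lambda>t. sc c (f t)) = cmod c * nrm f"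
  by (simp add: nrm_def ip_sc ip_sc_left X_sc norm_sc real_sqrt_mult)

text \<open>The factor 2 comes from treating the self-adjoint and skew parts of the product
  separately.\<close>

lemma norm_ip:
  assumes f: "f \<in> X" and g: "g \<in> X"
  shows "norm (ip f g) \<le> 2 * nrm f * nrm g"
proof -
  let ?h = "ip f g + ip g f" and ?k = "ip f (\<lambda>t. sc \<i> (g t)) + ip (\<lambda>t. sc \<i> (g t)) f"
  have "2 *\<^sub>R ip f g = ?h - sc \<i> ?k"
    using f g by (simp add: ip_sc ip_sc_left sc_add_right sc_minus_left sc_minus_right scaleR_2 sc_diff_right)
  then have "2 * norm (ip f g) \<le> norm ?h + norm (sc \<i> ?k)"
    by (metis abs_numeral norm_scaleR norm_triangle_ineq4)
  also have "norm ?h \<le> 2 * nrm f * nrm g" by (rule norm_ip_plus_adjoint[OF f g])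
  also have "norm (sc \<i> ?k) \<le> 2 * nrm f * nrm g"
    using norm_ip_plus_adjoint[OF f X_sc[OF g, of \<i>]] by (simp add: norm_sc nrm_sc g)
  finally show ?thesis by simp
qed

lemma nrm_triangle:
  assumes f: "f \<in> X" and g: "g \<in> X"
  shows "nrm (\<lambda>t. f t + g t) \<le> nrm f + nrm g"
proof (rule power2_le_imp_le)
  have "ip (\<lambda>t. f t + g t) (\<lambda>t. f t + g t) = (ip f f + ip g g) + (ip f g + ip g f)"
    using f g by (simp add: ip_add ip_add_left X_add)
  then have "norm (ip (\<lambda>t. f t + g t) (\<lambda>t. f t + g t)) \<le> norm (ip f f + ip g g) + norm (ip f g + ip g f)"
    by (metis norm_triangle_ineq)
  also have "\<dots> \<le> ((nrm f)\<^sup>2 + (nrm g)\<^sup>2) + 2 * nrm f * nrm g"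
    unfolding nrm_square by (intro add_mono norm_ip_plus_adjoint f g norm_triangle_ineq)
  finally show "(nrm (\<lambda>t. f t + g t))\<^sup>2 \<le> (nrm f + nrm g)\<^sup>2"
    unfolding nrm_square power2_sum by simp
qed simp

lemma nrm_minus_commute: "f \<in> X \<Longrightarrow> g \<in> X \<Longrightarrow> nrm (\<lambda>t. f t - g t) = nrm (\<lambda>t. g t - f t)"
  using nrm_sc[OF X_diff, of f g "- 1"] by simp

lemma nrm_triangle_diff:
  assumes "f \<in> X" "g \<in> X" "h \<in> X"
  shows "nrm (\<lambda>t. f t - h t) \<le> nrm (\<lambda>t. f t - g t) + nrm (\<lambda>t. g t - h t)"
  using nrm_triangle[OF X_diff[OF assms(1,2)] X_diff[OF assms(2,3)]] by simp

lemma nrm_diff_triangle: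
  assumes "f \<in> X" "g \<in> X"
  shows "nrm f \<le> nrm g + nrm (\<lambda>t. f t - g t)"
  using nrm_triangle[OF X_diff[OF assms] assms(2)] by simp

end

context finite_index_expectation
begin

section \<open>The pre-Hilbert module of tensors and its bounded evaluations\<close>

definition tensors :: "('a \<Rightarrow> 'a) set" where "tensors = range tensor_fun"

definition tip :: "('a \<Rightarrow> 'a) \<Rightarrow> ('a \<Rightarrow> 'a) \<Rightarrow> 'a" where
  "tip f g = pairing (SOME ts. f = tensor_fun ts) g"

text \<open>By hermitian symmetry the pairing with a tensor \<open>g\<close> depends on
  \<open>ts\<close> only through \<open>tensor_fun ts\<close>, so the choice in \<open>tip\<close>
  is harmless.\<close>

lemma tip_eq_pairing:
  assumes "g \<in> tensors" shows "tip (tensor_fun ts) g = pairing ts g"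
proof -
  define ts' where "ts' = (SOME ts'. tensor_fun ts = tensor_fun ts')"
  have ts': "tensor_fun ts = tensor_fun ts'" unfolding ts'_def by (rule someI[of _ ts]) simp
  obtain ss where "g = tensor_fun ss" using assms by (auto simp: tensors_def)
  then have "pairing ts g = pairing ts' g" using pairing_st ts' by metis
  then show ?thesis by (simp add: tip_def ts'_def)
qed

lemma tensors_zero: "(\<lambda>t. 0) \<in> tensors"
  unfolding tensors_def tensor_fun_Nil[symmetric] by (rule rangeI)

lemma tensors_add:
  assumes "f \<in> tensors" "g \<in> tensors" shows "(\<lambda>t. f t + g t) \<in> tensors"
proof -
  obtain ts ss where "f = tensor_fun ts" "g = tensor_fun ss" using assms by (auto simp: tensors_def)
  then have "(\<lambda>t. f t + g t) = tensor_fun (ts @ ss)" by (auto simp: tensor_fun_def)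
  then show ?thesis by (auto simp: tensors_def)
qed

lemma tensors_ract:
  assumes "f \<in> tensors" shows "(\<lambda>t. f t * b) \<in> tensors"
proof -
  obtain ts where f: "f = tensor_fun ts" using assms by (auto simp: tensors_def)
  have "(\<lambda>t. f t * b) = tensor_fun (map (\<lambda>(a, x). (a, x * b)) ts)" unfolding f
    by (induction ts) (auto simp: tensor_fun_Nil tensor_fun_Cons distrib_right mult.assoc fun_eq_iff)
  then show ?thesis by (auto simp: tensors_def)
qed

lemma tensors_sc: "f \<in> tensors \<Longrightarrow> (\<lambda>t. sc c (f t)) \<in> tensors"
  using tensors_ract[of f "sc c 1"] by (simp add: mult_sc_right)

lemma tensor_fun_shift:
  "(\<lambda>t. tensor_fun ts (t * a)) = tensor_fun (map (\<lambda>(c, x). (a * c, x)) ts)"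
  by (induction ts) (auto simp: tensor_fun_Nil tensor_fun_Cons mult.assoc fun_eq_iff)

lemma tensors_shift:
  assumes "f \<in> tensors" shows "(\<lambda>t. f (t * a)) \<in> tensors"
proof -
  obtain ts where f: "f = tensor_fun ts" using assms unfolding tensors_def by blast
  show ?thesis unfolding f tensor_fun_shift tensors_def by (rule rangeI)
qed

lemma tip_mem: "tip f g \<in> B" by (simp add: tip_def pairing_mem)

lemma tip_shift:
  assumes "f \<in> tensors" "g \<in> tensors"
  shows "tip (\<lambda>t. f (t * a)) g = tip f (\<lambda>t. g (t * st a))"
proof -
  obtain ts where f: "f = tensor_fun ts" using assms by (auto simp: tensors_def)
  have "pairing (map (\<lambda>(c, x). (a * c, x)) ts) g = pairing ts (\<lambda>t. g (t * st a))"
    by (induction ts) (auto simp: pairing_Cons st_mult)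
  then show ?thesis unfolding f tensor_fun_shift
    using assms tensors_shift by (simp add: tip_eq_pairing)
qed

lemma tip_st:
  assumes "f \<in> tensors" "g \<in> tensors" shows "tip g f = st (tip f g)"
proof -
  obtain ts ss where ts: "f = tensor_fun ts" and ss: "g = tensor_fun ss"
    using assms unfolding tensors_def by blast
  show ?thesis
    using pairing_st[of ss ts] tip_eq_pairing[OF assms(1), of ss] tip_eq_pairing[OF assms(2), of ts]
    unfolding ts ss by argo
qed

lemma tip_pos:
  assumes "f \<in> tensors" shows "pos (tip f f)"
proof -
  obtain ts where ts: "f = tensor_fun ts" using assms unfolding tensors_def by blast
  show ?thesis using tip_eq_pairing[OF assms, of ts] pairing_pos[of ts] unfolding ts by argo
qed

lemma cstar_form_tensors: "cstar_form sc st tensors tip"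
proof (intro cstar_form.intro cstar_form_axioms.intro)
  fix f g h :: "'a \<Rightarrow> 'a" and c
  show "unital_cstar sc st" by (rule unital_cstar_axioms)
  show "f \<in> tensors \<Longrightarrow> g \<in> tensors \<Longrightarrow> (\<lambda>t. f t + g t) \<in> tensors" by (rule tensors_add)
  show "f \<in> tensors \<Longrightarrow> (\<lambda>t. sc c (f t)) \<in> tensors" by (rule tensors_sc)
  show "tip f (\<lambda>t. g t + h t) = tip f g + tip f h" unfolding tip_def by (rule pairing_add)
  show "tip f (\<lambda>t. sc c (g t)) = sc c (tip f g)" unfolding tip_def by (rule pairing_sc)
  show "f \<in> tensors \<Longrightarrow> g \<in> tensors \<Longrightarrow> tip g f = st (tip f g)" by (rule tip_st)
  show "f \<in> tensors \<Longrightarrow> pos (tip f f)" by (rule tip_pos)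
qed

sublocale tensor: cstar_form sc st tensors tip
  by (rule cstar_form_tensors)

lemma tensor_fun_add_arg: "tensor_fun ts (s + t) = tensor_fun ts s + tensor_fun ts t"
  by (induction ts) (auto simp: tensor_fun_Nil tensor_fun_Cons distrib_right E_add)

lemma tensor_fun_sc_arg: "tensor_fun ts (sc c t) = sc c (tensor_fun ts t)"
  by (induction ts) (auto simp: tensor_fun_Nil tensor_fun_Cons mult_sc_left E_sc sc_add_right)

text \<open>\<open>norm a\<^sup>2 - a\<^sup>*a = y\<^sup>*y\<close> turns the difference of the two squared norms into the squared
  norm of the shift by \<open>y\<close>.\<close>

lemma nrm_shift_le:
  assumes f: "f \<in> tensors"
  shows "tensor.nrm (\<lambda>t. f (t * a)) \<le> norm a * tensor.nrm f"
proof (rule power2_le_imp_le)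
  obtain ts where ts: "f = tensor_fun ts" using f by (auto simp: tensors_def)
  have sh: "tip (\<lambda>t. f (t * c)) (\<lambda>t. f (t * c)) = tip f (\<lambda>t. f (t * (st c * c)))" for c
    using tip_shift[OF f tensors_shift[OF f, of c], of c] by (simp add: mult.assoc)
  have "pos (of_real ((norm a)\<^sup>2) - st a * a)"
    by (rule pos_of_real_diff) (auto simp: st_mult norm_st_mult)
  then obtain y where y: "of_real ((norm a)\<^sup>2) - st a * a = st y * y"
    by (metis cstar_pos_iff_pos cstar_pos_def)
  have fd: "f (t * (st y * y)) = sc (complex_of_real ((norm a)\<^sup>2)) (f t) + sc (- 1) (f (t * (st a * a)))" for t
  proof -
    have "t * (st y * y) = sc (complex_of_real ((norm a)\<^sup>2)) t + sc (- 1) (t * (st a * a))"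
      unfolding y[symmetric] sc_of_real by (simp add: right_diff_distrib of_real_def)
    then show ?thesis unfolding ts by (simp only: tensor_fun_add_arg tensor_fun_sc_arg)
  qed
  have "pos (tip (\<lambda>t. f (t * y)) (\<lambda>t. f (t * y)))" by (intro tensor.ip_pos tensors_shift f)
  also have "tip (\<lambda>t. f (t * y)) (\<lambda>t. f (t * y))
      = (norm a)\<^sup>2 *\<^sub>R tip f f - tip (\<lambda>t. f (t * a)) (\<lambda>t. f (t * a))"
    unfolding sh fd
    using f by (simp only: tensor.ip_add tensors_sc tensors_shift tensor.ip_sc) (simp add: sc_of_real flip: of_real_power)
  finally have "norm (tip (\<lambda>t. f (t * a)) (\<lambda>t. f (t * a))) \<le> norm ((norm a)\<^sup>2 *\<^sub>R tip f f)"
    by (intro norm_mono_pos tensor.ip_pos tensors_shift f)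
  then show "(tensor.nrm (\<lambda>t. f (t * a)))\<^sup>2 \<le> (norm a * tensor.nrm f)\<^sup>2"
    by (simp add: tensor.nrm_square power_mult_distrib)
qed simp

text \<open>Pair \<open>f\<close> with the tensor of \<open>st t\<close> and \<open>f t\<close>: the
  result is E of the square of \<open>f t\<close>, from which \<open>norm_square_le_E\<close>
  recovers the norm of \<open>f t\<close>. The 2 is that of \<open>norm_ip\<close>.\<close>

lemma norm_tensor_apply_le:
  assumes f: "f \<in> tensors"
  shows "norm (f t) \<le> 2 * K * norm t * tensor.nrm f"
proof (cases "f t = 0")
  case False
  let ?e = "tensor_fun [(st t, f t)]"
  have e: "?e \<in> tensors" by (simp add: tensors_def)
  have tf: "tip ?e f = E (st (f t) * f t)" by (simp add: tip_eq_pairing f pairing_def)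
  have "(tensor.nrm ?e)\<^sup>2 = norm (E (st (f t) * (E (t * st t) * f t)))"
    by (simp add: tensor.nrm_square tip_eq_pairing e pairing_def) (simp add: tensor_fun_def)
  also have "\<dots> \<le> norm (st (f t)) * (norm (E (t * st t)) * norm (f t))"
    by (intro order_trans[OF norm_E] order_trans[OF norm_mult_ineq] mult_left_mono norm_mult_ineq) simp
  also have "\<dots> \<le> norm (f t) * ((norm t)\<^sup>2 * norm (f t))"
    using norm_E[of "t * st t"] by (intro mult_mono) (auto simp: norm_mult_st)
  also have "\<dots> = (norm t * norm (f t))\<^sup>2" by (simp add: power2_eq_square mult_ac)
  finally have ne: "tensor.nrm ?e \<le> norm t * norm (f t)"
    by (rule power2_le_imp_le) simp
  have "(norm (f t))\<^sup>2 \<le> K * norm (tip ?e f)" unfolding tf by (rule norm_square_le_E)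
  also have "\<dots> \<le> K * (2 * tensor.nrm ?e * tensor.nrm f)"
    using K_ge_1 by (intro mult_left_mono tensor.norm_ip e f) auto
  also have "\<dots> \<le> K * (2 * (norm t * norm (f t)) * tensor.nrm f)"
    using K_ge_1 ne by (intro mult_left_mono mult_right_mono) auto
  finally have "norm (f t) * norm (f t) \<le> (2 * K * norm t * tensor.nrm f) * norm (f t)"
    by (simp add: power2_eq_square mult_ac)
  then show ?thesis using False by simp
next
  case True
  have "0 \<le> 2 * K * norm t * tensor.nrm f" using K_ge_1 by (intro mult_nonneg_nonneg) auto
  with True show ?thesis by simp
qed

end

section \<open>Completion\<close>

context finite_index_expectation
begin

definition approximates :: "(nat \<Rightarrow> 'a \<Rightarrow> 'a) \<Rightarrow> ('a \<Rightarrow> 'a) \<Rightarrow> bool" where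
  "approximates s m \<longleftrightarrow> (\<forall>n. s n \<in> tensors) \<and>
     (\<forall>e>0. \<exists>N. \<forall>j\<ge>N. \<forall>k\<ge>N. tensor.nrm (\<lambda>t. s j t - s k t) < e) \<and>
     (\<forall>t. (\<lambda>n. s n t) \<longlonglongrightarrow> m t)"

lemma approximatesD:
  assumes "approximates s m"
  shows "s n \<in> tensors" "e > 0 \<Longrightarrow> \<exists>N. \<forall>j\<ge>N. \<forall>k\<ge>N. tensor.nrm (\<lambda>t. s j t - s k t) < e"
    "(\<lambda>n. s n t) \<longlonglongrightarrow> m t"
  using assms unfolding approximates_def by auto

lemma nrm_zero [simp]: "tensor.nrm (\<lambda>t. 0) = 0"
  by (simp add: tensor.nrm_def tip_def)

lemma approximates_const: "f \<in> tensors \<Longrightarrow> approximates (\<lambda>n. f) f"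
  by (auto simp: approximates_def)

lemma approximates_add:
  assumes s: "approximates s m" and z: "approximates z w"
  shows "approximates (\<lambda>n t. s n t + z n t) (\<lambda>t. m t + w t)"
  unfolding approximates_def
proof (intro conjI allI impI)
  show "(\<lambda>t. s n t + z n t) \<in> tensors" for n
    by (rule tensors_add[OF approximatesD(1)[OF s] approximatesD(1)[OF z]])
  show "(\<lambda>n. s n t + z n t) \<longlonglongrightarrow> m t + w t" for t
    by (rule tendsto_add[OF approximatesD(3)[OF s] approximatesD(3)[OF z]])
  fix e :: real assume e: "e > 0"
  obtain N1 where N1: "\<And>j k. j \<ge> N1 \<Longrightarrow> k \<ge> N1 \<Longrightarrow> tensor.nrm (\<lambda>t. s j t - s k t) < e / 2"
    using approximatesD(2)[OF s, of "e / 2"] e by auto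
  obtain N2 where N2: "\<And>j k. j \<ge> N2 \<Longrightarrow> k \<ge> N2 \<Longrightarrow> tensor.nrm (\<lambda>t. z j t - z k t) < e / 2"
    using approximatesD(2)[OF z, of "e / 2"] e by auto
  show "\<exists>N. \<forall>j\<ge>N. \<forall>k\<ge>N. tensor.nrm (\<lambda>t. (s j t + z j t) - (s k t + z k t)) < e"
  proof (intro exI[of _ "max N1 N2"] allI impI)
    fix j k assume jk: "j \<ge> max N1 N2" "k \<ge> max N1 N2"
    have "tensor.nrm (\<lambda>t. (s j t - s k t) + (z j t - z k t))
        \<le> tensor.nrm (\<lambda>t. s j t - s k t) + tensor.nrm (\<lambda>t. z j t - z k t)"
      by (intro tensor.nrm_triangle tensor.X_diff approximatesD(1)[OF s] approximatesD(1)[OF z])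
    also have "\<dots> < e / 2 + e / 2" using jk by (intro add_strict_mono N1 N2) auto
    finally show "tensor.nrm (\<lambda>t. (s j t + z j t) - (s k t + z k t)) < e"
      by (simp add: algebra_simps)
  qed
qed

text \<open>Passes bounded operations on tensors to limits: scalars, the left action and the right
  action are all instances.\<close>

lemma approximates_map:
  assumes s: "approximates s m"
    and \<Phi>: "\<And>f. f \<in> tensors \<Longrightarrow> \<Phi> f \<in> tensors"
      "\<And>f g. \<Phi> (\<lambda>t. f t - g t) = (\<lambda>t. \<Phi> f t - \<Phi> g t)"
      "\<And>f. f \<in> tensors \<Longrightarrow> tensor.nrm (\<Phi> f) \<le> C * tensor.nrm f"
      "\<And>t. (\<lambda>n. \<Phi> (s n) t) \<longlonglongrightarrow> \<Phi> m t"
  shows "approximates (\<lambda>n. \<Phi> (s n)) (\<Phi> m)"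
  unfolding approximates_def
proof (intro conjI allI impI \<Phi>(1,4) approximatesD(1)[OF s])
  fix e :: real assume e: "e > 0"
  have C: "\<bar>C\<bar> + 1 > 0" by (simp add: add_nonneg_pos)
  then obtain N where N: "\<And>j k. j \<ge> N \<Longrightarrow> k \<ge> N \<Longrightarrow> tensor.nrm (\<lambda>t. s j t - s k t) < e / (\<bar>C\<bar> + 1)"
    using approximatesD(2)[OF s, of "e / (\<bar>C\<bar> + 1)"] e by auto
  show "\<exists>N. \<forall>j\<ge>N. \<forall>k\<ge>N. tensor.nrm (\<lambda>t. \<Phi> (s j) t - \<Phi> (s k) t) < e"
  proof (intro exI[of _ N] allI impI)
    fix j k assume jk: "j \<ge> N" "k \<ge> N"
    have "tensor.nrm (\<Phi> (\<lambda>t. s j t - s k t)) \<le> C * tensor.nrm (\<lambda>t. s j t - s k t)"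
      by (intro \<Phi>(3) tensor.X_diff approximatesD(1)[OF s])
    also have "\<dots> \<le> (\<bar>C\<bar> + 1) * tensor.nrm (\<lambda>t. s j t - s k t)"
      by (intro mult_right_mono) auto
    also have "\<dots> < (\<bar>C\<bar> + 1) * (e / (\<bar>C\<bar> + 1))" using N[OF jk] C by (intro mult_strict_left_mono)
    also have "\<dots> = e" using C by simp
    finally show "tensor.nrm (\<lambda>t. \<Phi> (s j) t - \<Phi> (s k) t) < e" by (simp add: \<Phi>(2))
  qed
qed

lemma approximates_sc: "approximates s m \<Longrightarrow> approximates (\<lambda>n t. sc c (s n t)) (\<lambda>t. sc c (m t))"
  by (rule approximates_map[where C = "cmod c" and \<Phi> = "\<lambda>f t. sc c (f t)"])
    (auto simp: tensors_sc sc_diff_right tensor.nrm_sc intro: tendsto_sc approximatesD(3))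

lemma approximates_diff:
  "approximates s m \<Longrightarrow> approximates z w \<Longrightarrow> approximates (\<lambda>n t. s n t - z n t) (\<lambda>t. m t - w t)"
  using approximates_add[OF _ approximates_sc[of z w "- 1"]] by simp

lemma approximates_shift: "approximates s m \<Longrightarrow> approximates (\<lambda>n t. s n (t * a)) (\<lambda>t. m (t * a))"
  by (rule approximates_map[where C = "norm a" and \<Phi> = "\<lambda>f t. f (t * a)"])
    (auto simp: tensors_shift nrm_shift_le intro: approximatesD(3))

lemma tip_ract: "b \<in> B \<Longrightarrow> tip f (\<lambda>t. g t * b) = tip f g * b"
  unfolding tip_def by (rule pairing_ract)

lemma nrm_ract_le:
  assumes f: "f \<in> tensors" and b: "b \<in> B"
  shows "tensor.nrm (\<lambda>t. f t * b) \<le> norm b * tensor.nrm f"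
proof (rule power2_le_imp_le)
  let ?g = "\<lambda>t. f t * b"
  have g: "?g \<in> tensors" by (rule tensors_ract[OF f])
  have "tip ?g ?g = tip ?g f * b" by (rule tip_ract[OF b])
  also have "tip ?g f = st (tip f f * b)" using tip_st[OF f g] tip_ract[OF b, of f f] by simp
  finally have "norm (tip ?g ?g) \<le> norm (tip f f * b) * norm b"
    using norm_mult_ineq[of "st (tip f f * b)" b] by simp
  also have "\<dots> \<le> (norm (tip f f) * norm b) * norm b"
    by (intro mult_right_mono norm_mult_ineq) simp
  finally show "(tensor.nrm ?g)\<^sup>2 \<le> (norm b * tensor.nrm f)\<^sup>2"
    by (simp add: tensor.nrm_square power_mult_distrib power2_eq_square mult_ac flip: tensor.nrm_square)
qed simp

lemma approximates_ract:
  "approximates s m \<Longrightarrow> b \<in> B \<Longrightarrow> approximates (\<lambda>n t. s n t * b) (\<lambda>t. m t * b)"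
  by (rule approximates_map[where C = "norm b" and \<Phi> = "\<lambda>f t. f t * b"])
    (auto simp: tensors_ract left_diff_distrib nrm_ract_le intro: tendsto_mult approximatesD(3))

lemma approximates_bounded:
  assumes s: "approximates s m"
  obtains M where "M > 0" "\<And>n. tensor.nrm (s n) \<le> M"
proof -
  have "Cauchy (\<lambda>n. tensor.nrm (s n))"
  proof (rule CauchyI)
    fix e :: real assume "e > 0"
    then obtain N where N: "\<forall>j\<ge>N. \<forall>k\<ge>N. tensor.nrm (\<lambda>t. s j t - s k t) < e"
      using approximatesD(2)[OF s] by blast
    show "\<exists>N. \<forall>j\<ge>N. \<forall>k\<ge>N. norm (tensor.nrm (s j) - tensor.nrm (s k)) < e"
    proof (intro exI[of _ N] allI impI)
      fix j k assume jk: "j \<ge> N" "k \<ge> N"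
      have "tensor.nrm (s j) \<le> tensor.nrm (s k) + tensor.nrm (\<lambda>t. s j t - s k t)"
        "tensor.nrm (s k) \<le> tensor.nrm (s j) + tensor.nrm (\<lambda>t. s k t - s j t)"
        by (intro tensor.nrm_diff_triangle approximatesD(1)[OF s])+
      moreover have "tensor.nrm (\<lambda>t. s j t - s k t) < e" "tensor.nrm (\<lambda>t. s k t - s j t) < e"
        using N jk by blast+
      ultimately show "norm (tensor.nrm (s j) - tensor.nrm (s k)) < e"
        unfolding real_norm_def by linarith
    qed
  qed
  then have "Bseq (\<lambda>n. tensor.nrm (s n))" by (rule Cauchy_Bseq)
  then show ?thesis using that by (auto simp: Bseq_def)
qed

lemma tip_Cauchy:
  assumes s: "approximates s m" and z: "approximates z w"
  shows "Cauchy (\<lambda>n. tip (s n) (z n))"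
proof (rule CauchyI)
  fix e :: real assume e: "e > 0"
  obtain M where M: "M > 0" "\<And>n. tensor.nrm (s n) \<le> M" using approximates_bounded[OF s] by blast
  obtain L where L: "L > 0" "\<And>n. tensor.nrm (z n) \<le> L" using approximates_bounded[OF z] by blast
  obtain N1 where N1: "\<And>j k. j \<ge> N1 \<Longrightarrow> k \<ge> N1 \<Longrightarrow> tensor.nrm (\<lambda>t. s j t - s k t) < e / (4 * L)"
    using approximatesD(2)[OF s, of "e / (4 * L)"] e L by auto
  obtain N2 where N2: "\<And>j k. j \<ge> N2 \<Longrightarrow> k \<ge> N2 \<Longrightarrow> tensor.nrm (\<lambda>t. z j t - z k t) < e / (4 * M)"
    using approximatesD(2)[OF z, of "e / (4 * M)"] e M by auto
  note [simp] = approximatesD(1)[OF s] approximatesD(1)[OF z]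
  show "\<exists>N. \<forall>j\<ge>N. \<forall>k\<ge>N. norm (tip (s j) (z j) - tip (s k) (z k)) < e"
  proof (intro exI[of _ "max N1 N2"] allI impI)
    fix j k assume jk: "j \<ge> max N1 N2" "k \<ge> max N1 N2"
    have "tip (s j) (z j) - tip (s k) (z k)
        = tip (\<lambda>t. s j t - s k t) (z j) + tip (s k) (\<lambda>t. z j t - z k t)"
      by (simp add: tensor.ip_diff tensor.ip_diff_left)
    then have "norm (tip (s j) (z j) - tip (s k) (z k))
        \<le> 2 * tensor.nrm (\<lambda>t. s j t - s k t) * tensor.nrm (z j)
          + 2 * tensor.nrm (s k) * tensor.nrm (\<lambda>t. z j t - z k t)"
      by (simp only:) (intro norm_triangle_le add_mono tensor.norm_ip, auto intro: tensor.X_diff)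
    also have "\<dots> \<le> 2 * tensor.nrm (\<lambda>t. s j t - s k t) * L + 2 * M * tensor.nrm (\<lambda>t. z j t - z k t)"
      by (intro add_mono mult_mono) (use M L in \<open>auto simp: less_imp_le\<close>)
    also have "\<dots> < 2 * (e / (4 * L)) * L + 2 * M * (e / (4 * M))"
      using jk M L
      by (intro add_strict_mono mult_strict_right_mono mult_strict_left_mono N1 N2) auto
    also have "\<dots> = e" using M L by simp
    finally show "norm (tip (s j) (z j) - tip (s k) (z k)) < e" .
  qed
qed

text \<open>A Cauchy sequence \<open>d\<close> tending to \<open>0\<close> pointwise is null: \<open>\<langle>d\<^sub>n, d\<^sub>n\<rangle>\<close> is close to \<open>\<langle>d\<^sub>N, d\<^sub>n\<rangle>\<close>,
  which involves finitely many values of \<open>d\<^sub>n\<close>.\<close>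

lemma approximates_zero_null:
  assumes d: "approximates d (\<lambda>t. 0)"
  shows "(\<lambda>n. tensor.nrm (d n)) \<longlonglongrightarrow> 0"
proof -
  note [simp] = approximatesD(1)[OF d]
  obtain l where l: "(\<lambda>n. tip (d n) (d n)) \<longlonglongrightarrow> l"
    using tip_Cauchy[OF d d] Cauchy_convergent convergentD by blast
  obtain M where M: "M > 0" "\<And>n. tensor.nrm (d n) \<le> M" using approximates_bounded[OF d] by blast
  have "norm l \<le> 0 + e" if e: "e > 0" for e
  proof -
    obtain N where N: "\<And>j k. j \<ge> N \<Longrightarrow> k \<ge> N \<Longrightarrow> tensor.nrm (\<lambda>t. d j t - d k t) < e / (2 * M)"
      using approximatesD(2)[OF d, of "e / (2 * M)"] e M by auto
    have "(\<lambda>n. tip (d N) (d n)) \<longlonglongrightarrow> tip (d N) (\<lambda>t. 0)"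
      unfolding tip_def by (rule tendsto_pairing[OF approximatesD(3)[OF d]])
    then have "(\<lambda>n. tip (d N) (d n)) \<longlonglongrightarrow> 0" by (simp add: tip_def)
    then have "(\<lambda>n. e + norm (tip (d N) (d n))) \<longlonglongrightarrow> e + norm (0::'a)"
      by (intro tendsto_intros)
    then have lim: "(\<lambda>n. e + norm (tip (d N) (d n))) \<longlonglongrightarrow> 0 + e" by simp
    show ?thesis
    proof (rule LIMSEQ_le[OF tendsto_norm[OF l] lim], intro exI[of _ N] allI impI)
      fix n assume n: "n \<ge> N"
      have "tip (d n) (d n) = tip (\<lambda>t. d n t - d N t) (d n) + tip (d N) (d n)"
        by (simp add: tensor.ip_diff_left)
      then have "norm (tip (d n) (d n)) \<le> norm (tip (\<lambda>t. d n t - d N t) (d n)) + norm (tip (d N) (d n))"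
        by (metis norm_triangle_ineq)
      also have "norm (tip (\<lambda>t. d n t - d N t) (d n)) \<le> 2 * tensor.nrm (\<lambda>t. d n t - d N t) * tensor.nrm (d n)"
        by (intro tensor.norm_ip tensor.X_diff) auto
      also have "\<dots> \<le> 2 * (e / (2 * M)) * M"
        by (intro mult_mono) (use N[OF n order_refl] M e in \<open>auto simp: less_imp_le\<close>)
      also have "\<dots> = e" using M by simp
      finally show "norm (tip (d n) (d n)) \<le> e + norm (tip (d N) (d n))" by simp
    qed
  qed
  then have "l = 0" using field_le_epsilon[of "norm l" 0] by auto
  then have "(\<lambda>n. sqrt (norm (tip (d n) (d n)))) \<longlonglongrightarrow> sqrt (norm (0::'a))"
    using l by (intro tendsto_intros) simp
  then show ?thesis by (simp add: tensor.nrm_def)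
qed

definition completion :: "('a \<Rightarrow> 'a) set" where "completion = {m. \<exists>s. approximates s m}"

definition cip :: "('a \<Rightarrow> 'a) \<Rightarrow> ('a \<Rightarrow> 'a) \<Rightarrow> 'a" where
  "cip m w = lim (\<lambda>n. tip ((SOME s. approximates s m) n) ((SOME s. approximates s w) n))"

lemma completionI: "approximates s m \<Longrightarrow> m \<in> completion"
  and completionE: "m \<in> completion \<Longrightarrow> (\<And>s. approximates s m \<Longrightarrow> thesis) \<Longrightarrow> thesis"
  by (auto simp: completion_def)

text \<open>Independence of the chosen sequences: two approximations of one function differ by a
  null sequence, by \<open>approximates_zero_null\<close>.\<close>

lemma tendsto_cip:
  assumes s: "approximates s m" and z: "approximates z w"
  shows "(\<lambda>n. tip (s n) (z n)) \<longlonglongrightarrow> cip m w"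
proof -
  define s' z' where "s' = (SOME s. approximates s m)" and "z' = (SOME s. approximates s w)"
  have s': "approximates s' m" unfolding s'_def by (rule someI[of "\<lambda>s. approximates s m", OF s])
  have z': "approximates z' w" unfolding z'_def by (rule someI[of "\<lambda>s. approximates s w", OF z])
  note [simp] = approximatesD(1)[OF s] approximatesD(1)[OF z] approximatesD(1)[OF s'] approximatesD(1)[OF z']
  have lim: "(\<lambda>n. tip (s' n) (z' n)) \<longlonglongrightarrow> cip m w"
    unfolding cip_def s'_def[symmetric] z'_def[symmetric]
    using Cauchy_convergent[OF tip_Cauchy[OF s' z']] by (simp add: convergent_LIMSEQ_iff)
  obtain M where M: "M > 0" "\<And>n. tensor.nrm (s' n) \<le> M" using approximates_bounded[OF s'] by blast
  obtain L where L: "L > 0" "\<And>n. tensor.nrm (z n) \<le> L" using approximates_bounded[OF z] by blast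
  have "(\<lambda>n. tip (s n) (z n) - tip (s' n) (z' n)) \<longlonglongrightarrow> 0"
  proof (rule Lim_null_comparison)
    have ds: "(\<lambda>n. tensor.nrm (\<lambda>t. s n t - s' n t)) \<longlonglongrightarrow> 0"
      using approximates_zero_null[of "\<lambda>n t. s n t - s' n t"] approximates_diff[OF s s'] by simp
    have dz: "(\<lambda>n. tensor.nrm (\<lambda>t. z n t - z' n t)) \<longlonglongrightarrow> 0"
      using approximates_zero_null[of "\<lambda>n t. z n t - z' n t"] approximates_diff[OF z z'] by simp
    have "(\<lambda>n. 2 * tensor.nrm (\<lambda>t. s n t - s' n t) * L + 2 * M * tensor.nrm (\<lambda>t. z n t - z' n t))
        \<longlonglongrightarrow> 2 * 0 * L + 2 * M * 0"
      by (intro tendsto_intros ds dz)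
    then show "(\<lambda>n. 2 * tensor.nrm (\<lambda>t. s n t - s' n t) * L + 2 * M * tensor.nrm (\<lambda>t. z n t - z' n t))
        \<longlonglongrightarrow> 0" by simp
    show "\<forall>\<^sub>F n in sequentially. norm (tip (s n) (z n) - tip (s' n) (z' n))
        \<le> 2 * tensor.nrm (\<lambda>t. s n t - s' n t) * L + 2 * M * tensor.nrm (\<lambda>t. z n t - z' n t)"
    proof (rule always_eventually, rule allI)
      fix n
      have "tip (s n) (z n) - tip (s' n) (z' n)
          = tip (\<lambda>t. s n t - s' n t) (z n) + tip (s' n) (\<lambda>t. z n t - z' n t)"
        by (simp add: tensor.ip_diff tensor.ip_diff_left)
      then have "norm (tip (s n) (z n) - tip (s' n) (z' n))
          \<le> 2 * tensor.nrm (\<lambda>t. s n t - s' n t) * tensor.nrm (z n)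
            + 2 * tensor.nrm (s' n) * tensor.nrm (\<lambda>t. z n t - z' n t)"
        by (simp only:) (intro norm_triangle_le add_mono tensor.norm_ip, auto intro: tensor.X_diff)
      also have "\<dots> \<le> 2 * tensor.nrm (\<lambda>t. s n t - s' n t) * L + 2 * M * tensor.nrm (\<lambda>t. z n t - z' n t)"
        by (intro add_mono mult_mono) (use M L in \<open>auto simp: less_imp_le\<close>)
      finally show "norm (tip (s n) (z n) - tip (s' n) (z' n))
        \<le> 2 * tensor.nrm (\<lambda>t. s n t - s' n t) * L + 2 * M * tensor.nrm (\<lambda>t. z n t - z' n t)" .
    qed
  qed
  from tendsto_add[OF this lim] show ?thesis by simp
qed

lemma cstar_form_completion: "cstar_form sc st completion cip"
proof (intro cstar_form.intro cstar_form_axioms.intro)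
  fix f g h :: "'a \<Rightarrow> 'a" and c
  show "unital_cstar sc st" by (rule unital_cstar_axioms)
  show "f \<in> completion \<Longrightarrow> g \<in> completion \<Longrightarrow> (\<lambda>t. f t + g t) \<in> completion"
    by (elim completionE, rule completionI, rule approximates_add)
  show "f \<in> completion \<Longrightarrow> (\<lambda>t. sc c (f t)) \<in> completion"
    by (elim completionE, rule completionI, rule approximates_sc)
  show "cip f (\<lambda>t. g t + h t) = cip f g + cip f h"
    if fgh: "f \<in> completion" "g \<in> completion" "h \<in> completion"
  proof -
    obtain u v w where uvw: "approximates u f" "approximates v g" "approximates w h"
      using fgh by (auto simp: completion_def)
    have "(\<lambda>n. tip (u n) (\<lambda>t. v n t + w n t)) \<longlonglongrightarrow> cip f g + cip f h"
      using tendsto_add[OF tendsto_cip[OF uvw(1,2)] tendsto_cip[OF uvw(1,3)]] uvw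
      by (simp add: tensor.ip_add approximatesD(1))
    then show ?thesis using LIMSEQ_unique tendsto_cip[OF uvw(1) approximates_add[OF uvw(2,3)]] by blast
  qed
  show "cip f (\<lambda>t. sc c (g t)) = sc c (cip f g)"
    if fg: "f \<in> completion" "g \<in> completion"
  proof -
    obtain u v where uv: "approximates u f" "approximates v g"
      using fg by (auto simp: completion_def)
    have "(\<lambda>n. tip (u n) (\<lambda>t. sc c (v n t))) \<longlonglongrightarrow> sc c (cip f g)"
      using tendsto_sc[OF tendsto_cip[OF uv]] uv by (simp add: tensor.ip_sc approximatesD(1))
    then show ?thesis using LIMSEQ_unique tendsto_cip[OF uv(1) approximates_sc[OF uv(2)]] by blast
  qed
  show "cip g f = st (cip f g)" if fg: "f \<in> completion" "g \<in> completion"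
  proof -
    obtain u v where uv: "approximates u f" "approximates v g"
      using fg by (auto simp: completion_def)
    have "tip (v n) (u n) = st (tip (u n) (v n))" for n
      by (rule tip_st[OF approximatesD(1)[OF uv(1)] approximatesD(1)[OF uv(2)]])
    then have "(\<lambda>n. tip (v n) (u n)) \<longlonglongrightarrow> st (cip f g)"
      using tendsto_st[OF tendsto_cip[OF uv]] by presburger
    then show ?thesis using LIMSEQ_unique tendsto_cip[OF uv(2,1)] by blast
  qed
  show "pos (cip f f)" if "f \<in> completion"
  proof -
    obtain u where u: "approximates u f" using \<open>f \<in> completion\<close> by (auto simp: completion_def)
    show ?thesis by (rule pos_limit[OF tip_pos[OF approximatesD(1)[OF u]] tendsto_cip[OF u u]])
  qed
qed

sublocale compl: cstar_form sc st completion cip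
  by (rule cstar_form_completion)

lemma tensors_subset_completion: "f \<in> tensors \<Longrightarrow> f \<in> completion"
  by (rule completionI[OF approximates_const])

lemma cip_tensors: "f \<in> tensors \<Longrightarrow> g \<in> tensors \<Longrightarrow> cip f g = tip f g"
  using tendsto_cip[OF approximates_const approximates_const, of f g] LIMSEQ_unique[OF tendsto_const] by metis

lemma nrm_tensors: "f \<in> tensors \<Longrightarrow> compl.nrm f = tensor.nrm f"
  by (simp add: compl.nrm_def tensor.nrm_def cip_tensors)

lemma tendsto_nrm:
  assumes "approximates s m" shows "(\<lambda>n. tensor.nrm (s n)) \<longlonglongrightarrow> compl.nrm m"
  unfolding compl.nrm_def tensor.nrm_def by (intro tendsto_intros tendsto_cip assms)

lemma cip_mem:
  assumes "m \<in> completion" "w \<in> completion" shows "cip m w \<in> B"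
proof -
  obtain s z where "approximates s m" "approximates z w" using assms by (auto simp: completion_def)
  then show ?thesis by (rule closed_sequentially[OF B_closed tip_mem tendsto_cip])
qed

lemma completion_ract: "m \<in> completion \<Longrightarrow> b \<in> B \<Longrightarrow> (\<lambda>t. m t * b) \<in> completion"
  by (elim completionE, rule completionI, rule approximates_ract)

lemma cip_ract:
  assumes "m \<in> completion" "w \<in> completion" "b \<in> B"
  shows "cip m (\<lambda>t. w t * b) = cip m w * b"
proof -
  obtain s z where sz: "approximates s m" "approximates z w" using assms by (auto simp: completion_def)
  have "(\<lambda>n. tip (s n) (\<lambda>t. z n t * b)) \<longlonglongrightarrow> cip m w * b"
    unfolding tip_ract[OF assms(3)] by (intro tendsto_mult tendsto_cip sz tendsto_const)
  then show ?thesis using LIMSEQ_unique tendsto_cip[OF sz(1) approximates_ract[OF sz(2) assms(3)]] by blast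
qed

lemma completion_shift: "m \<in> completion \<Longrightarrow> (\<lambda>t. m (t * a)) \<in> completion"
  by (elim completionE, rule completionI, rule approximates_shift)

lemma cip_shift:
  assumes "m \<in> completion" "w \<in> completion"
  shows "cip (\<lambda>t. m (t * a)) w = cip m (\<lambda>t. w (t * st a))"
proof -
  obtain s z where sz: "approximates s m" "approximates z w" using assms by (auto simp: completion_def)
  have eq: "tip (\<lambda>t. s n (t * a)) (z n) = tip (s n) (\<lambda>t. z n (t * st a))" for n
    by (rule tip_shift[OF approximatesD(1)[OF sz(1)] approximatesD(1)[OF sz(2)]])
  show ?thesis
    using tendsto_cip[OF approximates_shift[OF sz(1), of a] sz(2)]
      tendsto_cip[OF sz(1) approximates_shift[OF sz(2), of "st a"]]
    unfolding eq by (rule LIMSEQ_unique)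
qed

lemma nrm_completion_shift_le:
  assumes "m \<in> completion"
  shows "compl.nrm (\<lambda>t. m (t * a)) \<le> norm a * compl.nrm m"
proof -
  obtain s where s: "approximates s m" using assms by (auto simp: completion_def)
  have r: "(\<lambda>n. norm a * tensor.nrm (s n)) \<longlonglongrightarrow> norm a * compl.nrm m"
    by (intro tendsto_intros tendsto_nrm s)
  show ?thesis
    by (rule LIMSEQ_le[OF tendsto_nrm[OF approximates_shift[OF s]] r])
      (use nrm_shift_le[OF approximatesD(1)[OF s]] in auto)
qed

lemma norm_completion_apply_le:
  assumes "m \<in> completion"
  shows "norm (m t) \<le> 2 * K * norm t * compl.nrm m"
proof -
  obtain s where s: "approximates s m" using assms by (auto simp: completion_def)
  have r: "(\<lambda>n. 2 * K * norm t * tensor.nrm (s n)) \<longlonglongrightarrow> 2 * K * norm t * compl.nrm m"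
    by (intro tendsto_intros tendsto_nrm s)
  show ?thesis
    by (rule LIMSEQ_le[OF tendsto_norm[OF approximatesD(3)[OF s]] r])
      (use norm_tensor_apply_le[OF approximatesD(1)[OF s]] in auto)
qed

text \<open>Supplies additivity of the left action in the algebra element, which acts through the
  argument.\<close>

lemma completion_add_arg:
  assumes "m \<in> completion" shows "m (x + y) = m x + m y"
proof -
  obtain s where s: "approximates s m" using assms by (auto simp: completion_def)
  have eq: "s n (x + y) = s n x + s n y" for n
    using approximatesD(1)[OF s, of n] by (auto simp: tensors_def tensor_fun_add_arg)
  show ?thesis
    using approximatesD(3)[OF s, of "x + y"] tendsto_add[OF approximatesD(3)[OF s, of x] approximatesD(3)[OF s, of y]]
    unfolding eq by (rule LIMSEQ_unique)
qed

lemma completion_sc_arg: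
  assumes "m \<in> completion" shows "m (sc c x) = sc c (m x)"
proof -
  obtain s where s: "approximates s m" using assms by (auto simp: completion_def)
  have eq: "s n (sc c x) = sc c (s n x)" for n
    using approximatesD(1)[OF s, of n] by (auto simp: tensors_def tensor_fun_sc_arg)
  show ?thesis
    using approximatesD(3)[OF s, of "sc c x"] tendsto_sc[OF approximatesD(3)[OF s, of x], of c]
    unfolding eq by (rule LIMSEQ_unique)
qed

lemma approximates_nrm:
  assumes s: "approximates s m" and e: "e > 0"
  shows "\<exists>N. \<forall>n\<ge>N. compl.nrm (\<lambda>t. s n t - m t) \<le> e"
proof -
  obtain N where N: "\<And>j k. j \<ge> N \<Longrightarrow> k \<ge> N \<Longrightarrow> tensor.nrm (\<lambda>t. s j t - s k t) < e"
    using approximatesD(2)[OF s e] by auto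
  have "compl.nrm (\<lambda>t. s n t - m t) \<le> e" if n: "n \<ge> N" for n
  proof (rule LIMSEQ_le_const2)
    show "(\<lambda>k. tensor.nrm (\<lambda>t. s n t - s k t)) \<longlonglongrightarrow> compl.nrm (\<lambda>t. s n t - m t)"
      by (rule tendsto_nrm[OF approximates_diff[OF approximates_const[OF approximatesD(1)[OF s]] s]])
    show "\<exists>N. \<forall>k\<ge>N. tensor.nrm (\<lambda>t. s n t - s k t) \<le> e"
      using N[OF n] by (auto intro!: exI[of _ N] less_imp_le)
  qed
  then show ?thesis by blast
qed

lemma completion_approx:
  assumes m: "m \<in> completion" and e: "e > 0"
  obtains f where "f \<in> tensors" "compl.nrm (\<lambda>t. m t - f t) < e"
proof -
  obtain s where s: "approximates s m" using m by (auto simp: completion_def)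
  obtain N where "compl.nrm (\<lambda>t. s N t - m t) \<le> e / 2"
    using approximates_nrm[OF s, of "e / 2"] e by auto
  then have "compl.nrm (\<lambda>t. m t - s N t) < e"
    using e compl.nrm_minus_commute[OF m tensors_subset_completion[OF approximatesD(1)[OF s, of N]]] by simp
  then show ?thesis using that approximatesD(1)[OF s] by blast
qed

text \<open>Each term is replaced by a tensor at distance below 1/(n+1). The tensors form a Cauchy
  sequence, and its pointwise limit is the required element.\<close>

lemma completion_complete:
  fixes s :: "nat \<Rightarrow> 'a \<Rightarrow> 'a"
  assumes s: "\<And>n. s n \<in> completion"
    and cauchy: "\<And>e. e > 0 \<Longrightarrow> \<exists>N. \<forall>j\<ge>N. \<forall>k\<ge>N. compl.nrm (\<lambda>t. s j t - s k t) < e"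
  shows "\<exists>m\<in>completion. \<forall>e>0. \<exists>N. \<forall>n\<ge>N. compl.nrm (\<lambda>t. s n t - m t) < e"
proof -
  have "\<exists>f\<in>tensors. compl.nrm (\<lambda>t. s n t - f t) < inverse (real (Suc n))" for n
    by (rule completion_approx[OF s[of n], of "inverse (real (Suc n))"]) auto
  then obtain f where f: "\<And>n. f n \<in> tensors" "\<And>n. compl.nrm (\<lambda>t. s n t - f n t) < inverse (real (Suc n))"
    by metis
  note fC = tensors_subset_completion[OF f(1)]
  have small: "\<exists>N. \<forall>n\<ge>N. compl.nrm (\<lambda>t. s n t - f n t) < e" if e: "e > 0" for e
  proof -
    obtain N where N: "inverse (real (Suc N)) < e" using reals_Archimedean[OF e] by auto
    have "compl.nrm (\<lambda>t. s n t - f n t) < e" if "n \<ge> N" for n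
    proof -
      have "inverse (real (Suc n)) \<le> inverse (real (Suc N))" using that by (intro le_imp_inverse_le) auto
      then show ?thesis using f(2)[of n] N by linarith
    qed
    then show ?thesis by blast
  qed
  have fcauchy: "\<exists>N. \<forall>j\<ge>N. \<forall>k\<ge>N. tensor.nrm (\<lambda>t. f j t - f k t) < e" if e: "e > 0" for e
  proof -
    obtain N1 where N1: "\<And>n. n \<ge> N1 \<Longrightarrow> compl.nrm (\<lambda>t. s n t - f n t) < e / 3" using small[of "e / 3"] e by auto
    obtain N2 where N2: "\<And>j k. j \<ge> N2 \<Longrightarrow> k \<ge> N2 \<Longrightarrow> compl.nrm (\<lambda>t. s j t - s k t) < e / 3"
      using cauchy[of "e / 3"] e by auto
    have "tensor.nrm (\<lambda>t. f j t - f k t) < e" if "j \<ge> max N1 N2" "k \<ge> max N1 N2" for j k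
    proof -
      have "compl.nrm (\<lambda>t. f j t - f k t) \<le> compl.nrm (\<lambda>t. f j t - s j t) + compl.nrm (\<lambda>t. s j t - f k t)"
        by (intro compl.nrm_triangle_diff fC s)
      also have "compl.nrm (\<lambda>t. s j t - f k t) \<le> compl.nrm (\<lambda>t. s j t - s k t) + compl.nrm (\<lambda>t. s k t - f k t)"
        by (intro compl.nrm_triangle_diff fC s)
      also have "compl.nrm (\<lambda>t. f j t - s j t) = compl.nrm (\<lambda>t. s j t - f j t)"
        by (intro compl.nrm_minus_commute fC s)
      finally have "compl.nrm (\<lambda>t. f j t - f k t) < e"
        using N1[of j] N1[of k] N2[of j k] that by auto
      then show ?thesis by (simp add: nrm_tensors tensor.X_diff f(1))
    qed
    then show ?thesis by blast
  qed
  \<comment> \<open>The evaluation bound reduces pointwise convergence to completeness of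
    \<open>A\<close>; the summand 1 keeps the divisor positive.\<close>
  have "Cauchy (\<lambda>n. f n t)" for t
  proof (rule CauchyI)
    fix e :: real assume e: "e > 0"
    let ?c = "2 * K * norm t + 1"
    have c: "?c > 0" using K_ge_1 by (intro add_nonneg_pos mult_nonneg_nonneg) auto
    obtain N where N: "\<And>j k. j \<ge> N \<Longrightarrow> k \<ge> N \<Longrightarrow> tensor.nrm (\<lambda>t. f j t - f k t) < e / ?c"
      using fcauchy[of "e / ?c"] e c by auto
    have "norm (f j t - f k t) < e" if jk: "j \<ge> N" "k \<ge> N" for j k
    proof -
      have "norm (f j t - f k t) \<le> 2 * K * norm t * tensor.nrm (\<lambda>t. f j t - f k t)"
        by (rule norm_tensor_apply_le[OF tensor.X_diff[OF f(1) f(1)]])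
      also have "\<dots> \<le> ?c * tensor.nrm (\<lambda>t. f j t - f k t)" by (intro mult_right_mono) auto
      also have "\<dots> < ?c * (e / ?c)" using N[OF jk] c by (intro mult_strict_left_mono)
      also have "\<dots> = e" using c by simp
      finally show ?thesis .
    qed
    then show "\<exists>N. \<forall>j\<ge>N. \<forall>k\<ge>N. norm (f j t - f k t) < e" by blast
  qed
  then have "\<exists>l. (\<lambda>n. f n t) \<longlonglongrightarrow> l" for t using Cauchy_convergent convergentD by blast
  then obtain m where "\<And>t. (\<lambda>n. f n t) \<longlonglongrightarrow> m t" by metis
  then have fm: "approximates f m" using f(1) fcauchy by (simp add: approximates_def)
  have "\<exists>N. \<forall>n\<ge>N. compl.nrm (\<lambda>t. s n t - m t) < e" if e: "e > 0" for e
  proof -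
    obtain N1 where N1: "\<And>n. n \<ge> N1 \<Longrightarrow> compl.nrm (\<lambda>t. s n t - f n t) < e / 2" using small[of "e / 2"] e by auto
    obtain N2 where N2: "\<And>n. n \<ge> N2 \<Longrightarrow> compl.nrm (\<lambda>t. f n t - m t) \<le> e / 2"
      using approximates_nrm[OF fm, of "e / 2"] e by auto
    have "compl.nrm (\<lambda>t. s n t - m t) < e" if "n \<ge> max N1 N2" for n
      using compl.nrm_triangle_diff[OF s fC completionI[OF fm], of n n] N1[of n] N2[of n] that by auto
    then show ?thesis by blast
  qed
  then show ?thesis using completionI[OF fm] by blast
qed

section \<open>The completion as a Hilbert module with left action\<close>

definition corr_module :: "('a \<Rightarrow> 'a, 'a) hmod" where
  "corr_module = \<lparr>hcarrier = completion, hadd = (\<lambda>f g t. f t + g t), hzero = (\<lambda>t. 0),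
     hsc = (\<lambda>c f t. sc c (f t)), hract = (\<lambda>f b t. f t * b), hinner = cip\<rparr>"

lemma corr_module_simps [simp]:
  "hcarrier corr_module = completion" "hadd corr_module f g = (\<lambda>t. f t + g t)"
  "hzero corr_module = (\<lambda>t. 0)" "hsc corr_module c f = (\<lambda>t. sc c (f t))"
  "hract corr_module f b = (\<lambda>t. f t * b)" "hinner corr_module = cip"
  by (simp_all add: corr_module_def)

lemma hnorm_corr_module [simp]: "hnorm corr_module f = compl.nrm f"
  by (simp add: hnorm_def compl.nrm_def)

lemma hdiff_corr_module [simp]: "hdiff corr_module f g = (\<lambda>t. f t - g t)"
  by (simp add: hdiff_def)

lemma hilbert_module_corr: "hilbert_module sc st B corr_module"
  unfolding hilbert_module_def Let_def corr_module_simps hnorm_corr_module hdiff_corr_module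
proof (intro conjI ballI allI impI)
  show "(\<lambda>t. 0) \<in> completion" by (rule tensors_subset_completion[OF tensors_zero])
  show "cip y x = st (cip x y)" if "x \<in> completion" "y \<in> completion" for x y
    by (rule compl.ip_st[OF that])
  show "cstar_pos st (cip x x)" if "x \<in> completion" for x
    using compl.ip_pos[OF that] by (simp add: cstar_pos_iff_pos)
  \<comment> \<open>Definiteness is again the evaluation bound: zero module norm forces every value
    to vanish.\<close>
  show "x = (\<lambda>t. 0)" if "x \<in> completion" "cip x x = 0" for x
  proof
    show "x t = 0" for t using norm_completion_apply_le[OF that(1), of t] that(2) by (simp add: compl.nrm_def)
  qed
  show "\<exists>l\<in>completion. \<forall>e>0. \<exists>N. \<forall>n\<ge>N. compl.nrm (\<lambda>t. s n t - l t) < e"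
    if "(\<forall>n. s n \<in> completion) \<and> (\<forall>e>0. \<exists>N. \<forall>m\<ge>N. \<forall>n\<ge>N. compl.nrm (\<lambda>t. s m t - s n t) < e)" for s :: "nat \<Rightarrow> 'a \<Rightarrow> 'a"
    using completion_complete[of s] that by blast
qed (auto simp: compl.X_add compl.X_sc completion_ract algebra_simps sc_add_right sc_add_left sc_sc
    mult_sc_left mult_sc_right cip_mem compl.ip_add compl.ip_sc cip_ract)

lemma star_hom_corr: "star_hom_end sc st B corr_module (\<lambda>a m t. m (t * a))"
  unfolding star_hom_end_def hmod_end_def Let_def corr_module_simps hnorm_corr_module
proof (intro conjI ballI allI)
  show "\<exists>K. \<forall>x\<in>completion. compl.nrm (\<lambda>t. x (t * a)) \<le> K * compl.nrm x" for a
    using nrm_completion_shift_le by blast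
  show "(\<lambda>t. x (t * (a + a'))) = (\<lambda>t. x (t * a) + x (t * a'))" if "x \<in> completion" for a a' x
    by (simp add: distrib_left completion_add_arg[OF that])
  show "(\<lambda>t. x (t * sc c a)) = (\<lambda>t. sc c (x (t * a)))" if "x \<in> completion" for c a x
    by (simp add: mult_sc_right completion_sc_arg[OF that])
qed (auto simp: completion_shift cip_shift mult.assoc)

end

section \<open>Transport of Hilbert modules along an injection\<close>

text \<open>Transport leaves the inner product unchanged under decoding, so completeness and density
  carry over with the same estimates.\<close>

definition hmod_image :: "('m \<Rightarrow> 'n) \<Rightarrow> ('m, 'a) hmod \<Rightarrow> ('n, 'a) hmod" where
  "hmod_image \<phi> M = (let \<psi> = inv_into (hcarrier M) \<phi> in
     \<lparr>hcarrier = \<phi> ` hcarrier M, hadd = (\<lambda>x y. \<phi> (hadd M (\<psi> x) (\<psi> y))), hzero = \<phi> (hzero M),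
      hsc = (\<lambda>c x. \<phi> (hsc M c (\<psi> x))), hract = (\<lambda>x b. \<phi> (hract M (\<psi> x) b)),
      hinner = (\<lambda>x y. hinner M (\<psi> x) (\<psi> y))\<rparr>)"

locale hmod_transport =
  fixes sc :: "complex \<Rightarrow> 'a::{real_normed_algebra_1,banach} \<Rightarrow> 'a" and st :: "'a \<Rightarrow> 'a"
    and B :: "'a set" and M :: "('m, 'a) hmod" and \<phi> :: "'m \<Rightarrow> 'n"
  assumes inj: "inj_on \<phi> (hcarrier M)" and module: "hilbert_module sc st B M"
begin

abbreviation "\<psi> \<equiv> inv_into (hcarrier M) \<phi>"
abbreviation "M' \<equiv> hmod_image \<phi> M"

lemma inv_code [simp]: "x \<in> hcarrier M \<Longrightarrow> \<psi> (\<phi> x) = x" by (rule inv_into_f_f[OF inj])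

lemma image_simps [simp]:
  "hcarrier M' = \<phi> ` hcarrier M" "hadd M' x y = \<phi> (hadd M (\<psi> x) (\<psi> y))" "hzero M' = \<phi> (hzero M)"
  "hsc M' c x = \<phi> (hsc M c (\<psi> x))" "hract M' x b = \<phi> (hract M (\<psi> x) b)"
  "hinner M' x y = hinner M (\<psi> x) (\<psi> y)"
  by (simp_all add: hmod_image_def Let_def)

lemma closure [simp]:
  "hzero M \<in> hcarrier M" "x \<in> hcarrier M \<Longrightarrow> y \<in> hcarrier M \<Longrightarrow> hadd M x y \<in> hcarrier M"
  "x \<in> hcarrier M \<Longrightarrow> hsc M c x \<in> hcarrier M"
  "x \<in> hcarrier M \<Longrightarrow> b \<in> B \<Longrightarrow> hract M x b \<in> hcarrier M"
  using module unfolding hilbert_module_def Let_def by auto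

lemma hdiff_mem: "x \<in> hcarrier M \<Longrightarrow> y \<in> hcarrier M \<Longrightarrow> hdiff M x y \<in> hcarrier M"
  by (simp add: hdiff_def)

lemma hdiff_image: "x \<in> hcarrier M \<Longrightarrow> y \<in> hcarrier M \<Longrightarrow> hdiff M' (\<phi> x) (\<phi> y) = \<phi> (hdiff M x y)"
  by (simp add: hdiff_def)

lemma hnorm_image: "x \<in> hcarrier M \<Longrightarrow> hnorm M' (\<phi> x) = hnorm M x"
  by (simp add: hnorm_def)

lemma hilbert_module_image: "hilbert_module sc st B M'"
proof -
  have complete: "\<exists>l\<in>hcarrier M'. \<forall>e>0. \<exists>N. \<forall>n\<ge>N. hnorm M' (hdiff M' (s n) l) < e"
    if s: "(\<forall>n. s n \<in> hcarrier M') \<and>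
      (\<forall>e>0. \<exists>N. \<forall>m\<ge>N. \<forall>n\<ge>N. hnorm M' (hdiff M' (s m) (s n)) < e)" for s :: "nat \<Rightarrow> 'n"
  proof -
    have "\<forall>n. \<exists>x\<in>hcarrier M. s n = \<phi> x" using s by auto
    then obtain r where r: "\<And>n. r n \<in> hcarrier M" "\<And>n. s n = \<phi> (r n)" by metis
    have d: "hnorm M' (hdiff M' (s n) (\<phi> x)) = hnorm M (hdiff M (r n) x)" if "x \<in> hcarrier M" for n x
      using that r by (simp only: hdiff_image hnorm_image hdiff_mem)
    have "\<forall>e>0. \<exists>N. \<forall>m\<ge>N. \<forall>n\<ge>N. hnorm M (hdiff M (r m) (r n)) < e"
      using conjunct2[OF s] by (simp only: r(2) d[OF r(1), unfolded r(2)])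
    moreover have "\<forall>s::nat \<Rightarrow> 'm. (\<forall>n. s n \<in> hcarrier M) \<and>
      (\<forall>e>0. \<exists>N. \<forall>m\<ge>N. \<forall>n\<ge>N. hnorm M (hdiff M (s m) (s n)) < e) \<longrightarrow>
      (\<exists>l\<in>hcarrier M. \<forall>e>0. \<exists>N. \<forall>n\<ge>N. hnorm M (hdiff M (s n) l) < e)"
      using module unfolding hilbert_module_def Let_def by (elim conjE) assumption
    ultimately obtain l where l: "l \<in> hcarrier M" "\<forall>e>0. \<exists>N. \<forall>n\<ge>N. hnorm M (hdiff M (r n) l) < e"
      using r(1) by blast
    show ?thesis
      by (rule bexI[of _ "\<phi> l"]) (use l d[OF l(1)] in auto)
  qed
  note h = module[unfolded hilbert_module_def Let_def]
  have ax:
    "\<forall>x\<in>hcarrier M. \<forall>y\<in>hcarrier M. \<forall>z\<in>hcarrier M. hadd M (hadd M x y) z = hadd M x (hadd M y z)"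
    "\<forall>x\<in>hcarrier M. \<forall>y\<in>hcarrier M. hadd M x y = hadd M y x"
    "\<forall>x\<in>hcarrier M. hadd M x (hzero M) = x"
    "\<forall>x\<in>hcarrier M. hadd M x (hsc M (-1) x) = hzero M"
    "\<forall>c. \<forall>x\<in>hcarrier M. \<forall>y\<in>hcarrier M. hsc M c (hadd M x y) = hadd M (hsc M c x) (hsc M c y)"
    "\<forall>c d. \<forall>x\<in>hcarrier M. hsc M (c + d) x = hadd M (hsc M c x) (hsc M d x)"
    "\<forall>c d. \<forall>x\<in>hcarrier M. hsc M (c * d) x = hsc M c (hsc M d x)"
    "\<forall>x\<in>hcarrier M. hsc M 1 x = x"
    "\<forall>x\<in>hcarrier M. \<forall>y\<in>hcarrier M. \<forall>b\<in>B. hract M (hadd M x y) b = hadd M (hract M x b) (hract M y b)"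
    "\<forall>x\<in>hcarrier M. \<forall>b\<in>B. \<forall>b'\<in>B. hract M x (b + b') = hadd M (hract M x b) (hract M x b')"
    "\<forall>x\<in>hcarrier M. \<forall>b\<in>B. \<forall>b'\<in>B. hract M x (b * b') = hract M (hract M x b) b'"
    "\<forall>x\<in>hcarrier M. \<forall>y\<in>hcarrier M. hinner M x y \<in> B"
    "\<forall>x\<in>hcarrier M. \<forall>y\<in>hcarrier M. \<forall>z\<in>hcarrier M. hinner M x (hadd M y z) = hinner M x y + hinner M x z"
    "\<forall>c. \<forall>x\<in>hcarrier M. \<forall>y\<in>hcarrier M. hinner M x (hsc M c y) = sc c (hinner M x y)"
    "\<forall>x\<in>hcarrier M. \<forall>y\<in>hcarrier M. \<forall>b\<in>B. hinner M x (hract M y b) = hinner M x y * b"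
    "\<forall>x\<in>hcarrier M. cstar_pos st (hinner M x x)"
    "\<forall>x\<in>hcarrier M. hinner M x x = 0 \<longrightarrow> x = hzero M"
    using h by - (elim conjE, assumption)+
  have eq: "\<phi> x = \<phi> (hzero M) \<Longrightarrow> x \<in> hcarrier M \<Longrightarrow> x = hzero M" for x
    using inj by (simp add: inj_on_eq_iff)
  show ?thesis
    unfolding hilbert_module_def Let_def
  proof (intro conjI)
    show "\<forall>s::nat \<Rightarrow> 'n. (\<forall>n. s n \<in> hcarrier M') \<and>
      (\<forall>e>0. \<exists>N. \<forall>m\<ge>N. \<forall>n\<ge>N. hnorm M' (hdiff M' (s m) (s n)) < e) \<longrightarrow>
      (\<exists>l\<in>hcarrier M'. \<forall>e>0. \<exists>N. \<forall>n\<ge>N. hnorm M' (hdiff M' (s n) l) < e)"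
      using complete by blast
    have ract: "\<forall>c. \<forall>x\<in>hcarrier M. \<forall>b\<in>B. hsc M c (hract M x b) = hract M (hsc M c x) b \<and> hsc M c (hract M x b) = hract M x (sc c b)"
      using h by (elim conjE) assumption
    show "\<forall>c. \<forall>x\<in>hcarrier M'. \<forall>b\<in>B. hsc M' c (hract M' x b) = hract M' (hsc M' c x) b \<and>
        hsc M' c (hract M' x b) = hract M' x (sc c b)"
    proof (intro allI ballI)
      fix c x b assume "x \<in> hcarrier M'" and b: "b \<in> B"
      then obtain y where y: "y \<in> hcarrier M" "x = \<phi> y" by auto
      have e: "hsc M c (hract M y b) = hract M (hsc M c y) b"
        "hsc M c (hract M y b) = hract M y (sc c b)" using ract y(1) b by blast+
      show "hsc M' c (hract M' x b) = hract M' (hsc M' c x) b \<and>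
          hsc M' c (hract M' x b) = hract M' x (sc c b)"
        using y b by (simp flip: e)
    qed
    have sym: "\<forall>x\<in>hcarrier M. \<forall>y\<in>hcarrier M. hinner M y x = st (hinner M x y)"
      using h by (elim conjE) assumption
    show "\<forall>x\<in>hcarrier M'. \<forall>y\<in>hcarrier M'. hinner M' y x = st (hinner M' x y)"
    proof (intro ballI)
      fix x y assume "x \<in> hcarrier M'" "y \<in> hcarrier M'"
      then have "\<psi> x \<in> hcarrier M" "\<psi> y \<in> hcarrier M" by auto
      then show "hinner M' y x = st (hinner M' x y)" unfolding image_simps using sym by blast
    qed
  qed (use ax eq in auto)
qed

lemma star_hom_end_image:
  assumes "star_hom_end sc st B M \<pi>"
  shows "star_hom_end sc st B M' (\<lambda>a x. \<phi> (\<pi> a (\<psi> x)))"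
proof -
  note h = assms[unfolded star_hom_end_def hmod_end_def Let_def]
  have mem [simp]: "\<And>a x. x \<in> hcarrier M \<Longrightarrow> \<pi> a x \<in> hcarrier M" using h by auto
  have bd: "\<exists>K. \<forall>x\<in>hcarrier M. hnorm M (\<pi> a x) \<le> K * hnorm M x" for a using h by auto
  show ?thesis
    unfolding star_hom_end_def hmod_end_def Let_def
    by (intro conjI allI) (use h bd in \<open>simp_all add: hnorm_image\<close>)
qed

lemma hspan_subset:
  assumes "x \<in> hspan M S" "S \<subseteq> hcarrier M" shows "x \<in> hcarrier M"
  using assms by (induction rule: hspan.induct) auto

lemma hspan_image:
  assumes "x \<in> hspan M S" "S \<subseteq> hcarrier M" shows "\<phi> x \<in> hspan M' (\<phi> ` S)"
  using assms(1)
proof (induction rule: hspan.induct)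
  case hspan_zero
  show ?case using hspan.hspan_zero[of M'] by simp
next
  case (hspan_gen x)
  then show ?case by (intro hspan.hspan_gen) simp
next
  case (hspan_add x y)
  then show ?case using hspan.hspan_add[of "\<phi> x" M' _ "\<phi> y"] hspan_subset assms(2) by simp
next
  case (hspan_sc x c)
  then show ?case using hspan.hspan_sc[of "\<phi> x" M'] hspan_subset assms(2) by simp
qed

lemma hdense_image:
  assumes "hdense M (hspan M S)" "S \<subseteq> hcarrier M"
  shows "hdense M' (hspan M' (\<phi> ` S))"
  unfolding hdense_def
proof (intro ballI allI impI)
  fix m and e :: real assume "m \<in> hcarrier M'" and e: "e > 0"
  then obtain x where x: "x \<in> hcarrier M" "m = \<phi> x" by auto
  obtain n where n: "n \<in> hspan M S" "hnorm M (hdiff M x n) < e"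
    using assms(1) x e unfolding hdense_def by blast
  then have "hnorm M' (hdiff M' m (\<phi> n)) < e"
    using x hspan_subset[OF n(1) assms(2)] by (simp only: hdiff_image hnorm_image hdiff_mem)
  then show "\<exists>n\<in>hspan M' (\<phi> ` S). hnorm M' (hdiff M' m n) < e"
    using hspan_image[OF n(1) assms(2)] by blast
qed

end

context finite_index_expectation
begin

section \<open>The isometry, density of its orbit, and coding of the carrier\<close>

definition corr_embed :: "'a \<Rightarrow> 'a \<Rightarrow> 'a" where "corr_embed x = (\<lambda>t. E t * x)"

lemma corr_embed_shift: "(\<lambda>t. corr_embed x (t * a)) = tensor_fun [(a, x)]"
  by (simp add: corr_embed_def tensor_fun_def fun_eq_iff)

lemma corr_embed_eq: "corr_embed x = tensor_fun [(1, x)]"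
  using corr_embed_shift[of x 1] by simp

lemma corr_embed_mem: "corr_embed x \<in> completion"
  unfolding corr_embed_eq by (intro tensors_subset_completion) (simp add: tensors_def)

text \<open>The adjoint relation for V: the right side is the inner product of \<open>x\<close> and
  \<open>m 1\<close> in {A, E}.\<close>

lemma cip_corr_embed:
  assumes "m \<in> completion" shows "cip (corr_embed x) m = E (st x * m 1)"
proof -
  obtain s where s: "approximates s m" using assms by (auto simp: completion_def)
  have "approximates (\<lambda>n. corr_embed x) (corr_embed x)"
    unfolding corr_embed_eq by (intro approximates_const) (simp add: tensors_def)
  then have "(\<lambda>n. tip (corr_embed x) (s n)) \<longlonglongrightarrow> cip (corr_embed x) m" using s by (rule tendsto_cip)
  moreover have "tip (corr_embed x) (s n) = E (st x * s n 1)" for n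
    unfolding corr_embed_eq using approximatesD(1)[OF s] by (simp add: tip_eq_pairing pairing_def)
  moreover have "(\<lambda>n. E (st x * s n 1)) \<longlonglongrightarrow> E (st x * m 1)"
    by (intro tendsto_E tendsto_mult tendsto_const approximatesD(3)[OF s])
  ultimately show ?thesis using LIMSEQ_unique by simp
qed

lemma hdense_corr:
  "hdense corr_module (hspan corr_module {(\<lambda>t. corr_embed x (t * a)) | a x. True})"
  (is "hdense _ (hspan _ ?S)")
  unfolding hdense_def
proof (intro ballI allI impI)
  fix m and e :: real assume "m \<in> hcarrier corr_module" "e > 0"
  then obtain f where f: "f \<in> tensors" "compl.nrm (\<lambda>t. m t - f t) < e"
    using completion_approx by auto
  have "tensor_fun ts \<in> hspan corr_module ?S" for ts
  proof (induction ts)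
    case Nil
    then show ?case using hspan.hspan_zero[of corr_module] by (simp add: tensor_fun_Nil)
  next
    case (Cons p ts)
    obtain a x where p: "p = (a, x)" by force
    have "tensor_fun [(a, x)] \<in> hspan corr_module ?S"
      unfolding corr_embed_shift[symmetric] by (intro hspan.hspan_gen) auto
    from hspan.hspan_add[OF this Cons] show ?case
      by (simp add: p tensor_fun_Cons tensor_fun_Nil)
  qed
  then have "f \<in> hspan corr_module ?S" using f(1) by (auto simp: tensors_def)
  then show "\<exists>n\<in>hspan corr_module ?S. hnorm corr_module (hdiff corr_module m n) < e"
    using f(2) by auto
qed

text \<open>The carrier of the module has to live on sequences of formal tensors, so each function in the
  completion is represented by one sequence approximating it.\<close>

definition code :: "('a \<Rightarrow> 'a) \<Rightarrow> nat \<Rightarrow> ('a \<times> 'a) list" where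
  "code m = (SOME u. approximates (\<lambda>n. tensor_fun (u n)) m)"

lemma approximates_code:
  assumes "m \<in> completion" shows "approximates (\<lambda>n. tensor_fun (code m n)) m"
proof -
  obtain s where s: "approximates s m" using assms by (auto simp: completion_def)
  have "\<forall>n. \<exists>ts. s n = tensor_fun ts" using approximatesD(1)[OF s] by (auto simp: tensors_def)
  then obtain u where "\<And>n. s n = tensor_fun (u n)" by metis
  then have "s = (\<lambda>n. tensor_fun (u n))" by blast
  with s have "approximates (\<lambda>n. tensor_fun (u n)) m" by simp
  then show ?thesis unfolding code_def by (rule someI[of "\<lambda>u. approximates (\<lambda>n. tensor_fun (u n)) m"])
qed

lemma inj_on_code: "inj_on code completion"
proof (rule inj_onI, rule ext)
  fix m w t assume m: "m \<in> completion" and w: "w \<in> completion" and eq: "code m = code w"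
  show "m t = w t"
    using approximatesD(3)[OF approximates_code[OF m], of t] approximatesD(3)[OF approximates_code[OF w], of t]
    unfolding eq by (rule LIMSEQ_unique)
qed

end

theorem theorem3:
  fixes sc :: "complex \<Rightarrow> 'a::{real_normed_algebra_1,banach} \<Rightarrow> 'a"
    and st :: "'a \<Rightarrow> 'a"
    and B :: "'a set"
    and E :: "'a \<Rightarrow> 'a"
    and K :: real
  assumes "unital_cstar_algebra sc st"
    and "cstar_subalgebra sc st B"
    and "cond_expectation sc E B"
    and "K \<ge> 1"
    and "positive_map st (\<lambda>a. K *\<^sub>R E a - a)"
  shows "\<exists>(M :: (nat \<Rightarrow> ('a \<times> 'a) list, 'a) hmod) \<pi> V W.
           hilbert_module sc st B M \<and>
           star_hom_end sc st B M \<pi> \<and>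
           partial_isometry_from_A st E M V W \<and>
           (\<forall>a x. E a * x = W (\<pi> a (V x))) \<and>
           hdense M (hspan M {\<pi> a1 (V a2) | a1 a2. True})"
proof -
  interpret finite_index_expectation sc st B E K
    by unfold_locales (use assms in auto)
  interpret hmod_transport sc st B corr_module code
    by unfold_locales (simp_all add: inj_on_code hilbert_module_corr)
  define \<pi> where "\<pi> a x = code (\<lambda>t. \<psi> x (t * a))" for a x
  define V where "V x = code (corr_embed x)" for x
  define W where "W x = \<psi> x 1" for x
  have shift: "(\<lambda>t. corr_embed x (t * a)) \<in> completion" for x a
    by (rule completion_shift[OF corr_embed_mem])
  have inv: "inv_into completion code (code m) = m" if "m \<in> completion" for m
    by (rule inv_into_f_f[OF inj_on_code that])
  have \<pi>V: "\<pi> a (V x) = code (\<lambda>t. corr_embed x (t * a))" for a x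
    by (simp add: \<pi>_def V_def inv corr_embed_mem)
  have WV: "W (\<pi> a (V x)) = E a * x" for a x
    by (simp add: \<pi>V W_def inv shift) (simp add: corr_embed_def)
  have S: "{\<pi> a1 (V a2) | a1 a2. True} = code ` {(\<lambda>t. corr_embed x (t * a)) | a x. True}"
    unfolding \<pi>V by auto
  show ?thesis
  proof (intro exI conjI allI)
    show "hilbert_module sc st B M'" by (rule hilbert_module_image)
    show "star_hom_end sc st B M' \<pi>"
      unfolding \<pi>_def[abs_def] by (rule star_hom_end_image[OF star_hom_corr])
    show "partial_isometry_from_A st E M' V W"
      unfolding partial_isometry_from_A_def
    proof (intro conjI allI ballI)
      show "V x \<in> hcarrier M'" for x using corr_embed_mem by (simp add: V_def)
      show "hinner M' (V x) m = E (st x * W m)" if "m \<in> hcarrier M'" for x m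
        using that by (auto simp: V_def W_def cip_corr_embed corr_embed_mem inv)
      \<comment> \<open>V is even isometric: W(V x) = E(1) x = x.\<close>
      show "V (W (V x)) = V x" for x
        by (simp add: V_def W_def inv corr_embed_mem) (simp add: corr_embed_def)
    qed
    show "E a * x = W (\<pi> a (V x))" for a x by (simp add: WV)
    show "hdense M' (hspan M' {\<pi> a1 (V a2) | a1 a2. True})"
      unfolding S by (rule hdense_image[OF hdense_corr]) (use shift in auto)
  qed
qed

end
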